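(* Let $n\ge 2$. There are no (nontrivial) linear relations among the images of $\{\underline{x}^{\underline{r}}\,\partial^D_w\}_{w\in D_n,\ \underline{r}\in\mathbb{N}^n}$ in $\mathrm{End}(\mathrm{Pol}_n^-)$, nor among the images of $\{\partial^D_w\,\underline{x}^{\underline{r}}\}_{w\in D_n,\ \underline{r}\in\mathbb{N}^n}$ in $\mathrm{End}(\mathrm{Pol}_n^-)$. Thus each of these two sets forms a $\mathbb{Z}$-basis of the spin type D nilHecke algebra ${}^{D}\mathrm{NH}_n^-$.
   Context: $\mathrm{Pol}_n^-$ is the unital $\mathbb{Z}$-algebra generated by $x_1,\dots,x_n$ subject to $x_ix_j+x_jx_i=0$ for all $i\ne j$; $\mathrm{End}(\mathrm{Pol}_n^-)$ is its ring of $\mathbb{Z}$-module endomorphisms. The spin type D nilHecke algebra ${}^{D}\mathrm{NH}_n^-$ is the unital $\mathbb{Z}$-algebra generated by $x_1,\dots,x_n$, $\partial_1^-,\dots,\partial_{n-1}^-$, $\partial_n^D$ subject to $x_ix_j+x_jx_i=0$ ($i\neq j$) and, for $1\le i\le n-1$ (whenever the indices make sense): $(\partial_i^-)^2=0$; $\partial_i^-\partial_{i+1}^-\partial_i^-=\partial_{i+1}^-\partial_i^-\partial_{i+1}^-$; $\partial_i^-\partial_j^-+\partial_j^-\partial_i^-=0$ for $|i-j|>1$; $x_i\partial_i^-+\partial_i^-x_{i+1}=1$; $\partial_i^-x_i+x_{i+1}\partial_i^-=1$; $\partial_i^-x_j+x_j\partial_i^-=0$ for $j\ne i,i+1$; and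 $(\partial_n^D)^2=0$; $\partial_n^D\partial_{n-2}^-\partial_n^D=\partial_{n-2}^-\partial_n^D\partial_{n-2}^-$; $\partial_n^D\partial_i^-+\partial_i^-\partial_n^D=0$ for $1\le i\le n-3$; $\partial_n^D\partial_{n-1}^--\partial_{n-1}^-\partial_n^D=0$; $x_{n-1}\partial_n^D-\partial_n^Dx_n=1$; $\partial_n^Dx_{n-1}-x_n\partial_n^D=1$; $\partial_n^Dx_i+x_i\partial_n^D=0$ for $1\le i\le n-2$. It acts on $\mathrm{Pol}_n^-$ as follows. The $x_i$ act by left multiplication. For $1\le i\le n-1$ let $s_i$ be the algebra endomorphism of $\mathrm{Pol}_n^-$ with $s_i(x_i)=-x_{i+1}$, $s_i(x_{i+1})=-x_i$, $s_i(x_j)=-x_j$ for $j\ne i,i+1$, and let $s_n^D$ be the algebra endomorphism with $s_n^D(x_n)=x_{n-1}$, $s_n^D(x_{n-1})=x_n$, $s_n^D(x_j)=-x_j$ for $j\le n-2$. Then $\partial_i^-$ and $\partial_n^D$ act as the $\mathbb{Z}$-linear (odd Demazure) operators that kill $1$ and satisfy: $\partial_i^-(x_j)=1$ if $j\in\{i,i+1\}$ and $0$ otherwise; $\partial_n^D(x_n)=-1$, $\partial_n^D(x_{n-1})=1$, $\partial_n^D(x_j)=0$ for $j\le n-2$; $\partial_i^-(fg)=\partial_i^-(f)g+s_i(f)\partial_i^-(g)$, $\partial_n^D(fg)=\partial_n^D(f)g+s_n^D(f)\partial_n^D(g)$. $D_n=\langle s_1,\dots,s_n\rangle$ is the Weyl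 group of type $D_n$ with simple reflections $s_1,\dots,s_{n-1}$ (generating $S_n$) and $s_n$, where $s_ns_{n-2}s_n=s_{n-2}s_ns_{n-2}$ and $s_n$ commutes with $s_i$ for $i\le n-1$, $i\neq n-2$. Write $\partial_{i}:=\partial_i^-$ for $i<n$, $\partial_n:=\partial_n^D$. For each $w\in D_n$ a reduced expression $w=s_{i_1}\cdots s_{i_\ell}$ is chosen and $\partial_w^D:=\partial_{i_1}\cdots\partial_{i_\ell}$ (well defined up to sign). For $\underline{r}=(r_1,\dots,r_n)\in\mathbb{N}^n$ (with $0\in\mathbb{N}$), $\underline{x}^{\underline{r}}=x_1^{r_1}\cdots x_n^{r_n}$. *)

theory Defs
  imports "HOL-Algebra.QuotRing" "HOL-Algebra.Bij" "HOL-Algebra.Generated_Groups" "HOL-Combinatorics.Transposition"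
begin

section \<open>Unital rings given by generators and relations\<close>

text \<open>The free unital ring on \<open>A\<close>: finitely supported integer functions on words over \<open>A\<close>,
  multiplied by concatenation of words.\<close>

definition free_alg :: "'a set \<Rightarrow> ('a list \<Rightarrow> int) ring" where
  "free_alg A =
    \<lparr>carrier = {f. finite {w. f w \<noteq> 0} \<and> {w. f w \<noteq> 0} \<subseteq> lists A},
     monoid.mult = (\<lambda>f g w. \<Sum>k\<le>length w. f (take k w) * g (drop k w)),
     one = (\<lambda>w. if w = [] then 1 else 0),
     ring.zero = (\<lambda>w. 0),
     add = (\<lambda>f g w. f w + g w)\<rparr>"

definition free_gen :: "'a \<Rightarrow> 'a list \<Rightarrow> int" where
  "free_gen a = (\<lambda>w. if w = [a] then 1 else 0)"

text \<open>A pair \<open>(l, r)\<close> in \<open>rels\<close> stands for the defining relation \<open>l = r\<close>.\<close>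

definition rel_ideal :: "'a set \<Rightarrow> (('a list \<Rightarrow> int) \<times> ('a list \<Rightarrow> int)) set \<Rightarrow> ('a list \<Rightarrow> int) set" where
  "rel_ideal A rels = Idl\<^bsub>free_alg A\<^esub> {l \<ominus>\<^bsub>free_alg A\<^esub> r | l r. (l, r) \<in> rels}"

definition presented_alg ::
    "'a set \<Rightarrow> (('a list \<Rightarrow> int) \<times> ('a list \<Rightarrow> int)) set \<Rightarrow> ('a list \<Rightarrow> int) set ring" where
  "presented_alg A rels = free_alg A Quot rel_ideal A rels"

definition presented_gen ::
    "'a set \<Rightarrow> (('a list \<Rightarrow> int) \<times> ('a list \<Rightarrow> int)) set \<Rightarrow> 'a \<Rightarrow> ('a list \<Rightarrow> int) set" where
  "presented_gen A rels a = rel_ideal A rels +>\<^bsub>free_alg A\<^esub> free_gen a"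


section \<open>Integral linear independence and bases of families\<close>

definition z_independent :: "('a, 'm) ring_scheme \<Rightarrow> 'i set \<Rightarrow> ('i \<Rightarrow> 'a) \<Rightarrow> bool" where
  "z_independent R I b \<longleftrightarrow>
    b \<in> I \<rightarrow> carrier R \<and>
    (\<forall>J (c :: 'i \<Rightarrow> int). finite J \<and> J \<subseteq> I \<and> (\<Oplus>\<^bsub>R\<^esub>j\<in>J. [c j] \<cdot>\<^bsub>R\<^esub> b j) = \<zero>\<^bsub>R\<^esub>
       \<longrightarrow> (\<forall>j\<in>J. c j = 0))"

definition z_basis :: "('a, 'm) ring_scheme \<Rightarrow> 'i set \<Rightarrow> ('i \<Rightarrow> 'a) \<Rightarrow> bool" where
  "z_basis R I b \<longleftrightarrow>
    z_independent R I b \<and>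
    (\<forall>a\<in>carrier R. \<exists>J (c :: 'i \<Rightarrow> int). finite J \<and> J \<subseteq> I \<and> a = (\<Oplus>\<^bsub>R\<^esub>j\<in>J. [c j] \<cdot>\<^bsub>R\<^esub> b j))"


section \<open>The ring of additive endomorphisms of a ring\<close>

text \<open>Endomorphisms are represented by functions that are \<^const>\<open>undefined\<close> off the carrier,
  as in \<^const>\<open>BijGroup\<close>, so that equality in the ring is equality of maps on the carrier.\<close>

definition end_ring :: "('a, 'm) ring_scheme \<Rightarrow> ('a \<Rightarrow> 'a) ring" where
  "end_ring R =
    \<lparr>carrier = hom (add_monoid R) (add_monoid R) \<inter> extensional (carrier R),
     monoid.mult = (\<lambda>f g. compose (carrier R) f g),
     one = (\<lambda>x\<in>carrier R. x),
     ring.zero = (\<lambda>x\<in>carrier R. \<zero>\<^bsub>R\<^esub>),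
     add = (\<lambda>f g. \<lambda>x\<in>carrier R. f x \<oplus>\<^bsub>R\<^esub> g x)\<rparr>"


section \<open>The skew polynomial ring\<close>

definition pol_rels :: "nat \<Rightarrow> ((nat list \<Rightarrow> int) \<times> (nat list \<Rightarrow> int)) set" where
  "pol_rels n =
    (let F = free_alg {1..n}; x = free_gen in
     {(x i \<otimes>\<^bsub>F\<^esub> x j \<oplus>\<^bsub>F\<^esub> x j \<otimes>\<^bsub>F\<^esub> x i, \<zero>\<^bsub>F\<^esub>) | i j. i \<in> {1..n} \<and> j \<in> {1..n} \<and> i \<noteq> j})"

definition Pol :: "nat \<Rightarrow> (nat list \<Rightarrow> int) set ring" where
  "Pol n = presented_alg {1..n} (pol_rels n)"

definition pol_x :: "nat \<Rightarrow> nat \<Rightarrow> (nat list \<Rightarrow> int) set" where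
  "pol_x n i = presented_gen {1..n} (pol_rels n) i"


section \<open>The spin type D nilHecke algebra\<close>

text \<open>\<open>Dl i\<close> is the generator \<open>\<partial>\<^sub>i\<^sup>-\<close> for \<open>i < n\<close>, and \<open>Dl n\<close> is \<open>\<partial>\<^sub>n\<^sup>D\<close>.\<close>

datatype nh_gen = X nat | Dl nat

definition nh_gens :: "nat \<Rightarrow> nh_gen set" where
  "nh_gens n = X ` {1..n} \<union> Dl ` {1..n}"

definition nh_rels :: "nat \<Rightarrow> ((nh_gen list \<Rightarrow> int) \<times> (nh_gen list \<Rightarrow> int)) set" where
  "nh_rels n =
    (let F = free_alg (nh_gens n); x = (\<lambda>i. free_gen (X i)); d = (\<lambda>i. free_gen (Dl i)) in
     {(x i \<otimes>\<^bsub>F\<^esub> x j \<oplus>\<^bsub>F\<^esub> x j \<otimes>\<^bsub>F\<^esub> x i, \<zero>\<^bsub>F\<^esub>) | i j. i \<in> {1..n} \<and> j \<in> {1..n} \<and> i \<noteq> j} \<union>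
     {(d i \<otimes>\<^bsub>F\<^esub> d i, \<zero>\<^bsub>F\<^esub>) | i. 1 \<le> i \<and> i < n} \<union>
     {(d i \<otimes>\<^bsub>F\<^esub> d (i + 1) \<otimes>\<^bsub>F\<^esub> d i, d (i + 1) \<otimes>\<^bsub>F\<^esub> d i \<otimes>\<^bsub>F\<^esub> d (i + 1)) | i. 1 \<le> i \<and> i + 1 < n} \<union>
     {(d i \<otimes>\<^bsub>F\<^esub> d j \<oplus>\<^bsub>F\<^esub> d j \<otimes>\<^bsub>F\<^esub> d i, \<zero>\<^bsub>F\<^esub>) | i j.
        1 \<le> i \<and> i < n \<and> 1 \<le> j \<and> j < n \<and> \<bar>int i - int j\<bar> > 1} \<union>
     {(x i \<otimes>\<^bsub>F\<^esub> d i \<oplus>\<^bsub>F\<^esub> d i \<otimes>\<^bsub>F\<^esub> x (i + 1), \<one>\<^bsub>F\<^esub>) | i. 1 \<le> i \<and> i < n} \<union>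
     {(d i \<otimes>\<^bsub>F\<^esub> x i \<oplus>\<^bsub>F\<^esub> x (i + 1) \<otimes>\<^bsub>F\<^esub> d i, \<one>\<^bsub>F\<^esub>) | i. 1 \<le> i \<and> i < n} \<union>
     {(d i \<otimes>\<^bsub>F\<^esub> x j \<oplus>\<^bsub>F\<^esub> x j \<otimes>\<^bsub>F\<^esub> d i, \<zero>\<^bsub>F\<^esub>) | i j.
        1 \<le> i \<and> i < n \<and> j \<in> {1..n} \<and> j \<noteq> i \<and> j \<noteq> i + 1} \<union>
     {(d n \<otimes>\<^bsub>F\<^esub> d n, \<zero>\<^bsub>F\<^esub>)} \<union>
     (if 3 \<le> n then {(d n \<otimes>\<^bsub>F\<^esub> d (n - 2) \<otimes>\<^bsub>F\<^esub> d n, d (n - 2) \<otimes>\<^bsub>F\<^esub> d n \<otimes>\<^bsub>F\<^esub> d (n - 2))} else {}) \<union>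
     {(d n \<otimes>\<^bsub>F\<^esub> d i \<oplus>\<^bsub>F\<^esub> d i \<otimes>\<^bsub>F\<^esub> d n, \<zero>\<^bsub>F\<^esub>) | i. 1 \<le> i \<and> i + 3 \<le> n} \<union>
     {(d n \<otimes>\<^bsub>F\<^esub> d (n - 1) \<ominus>\<^bsub>F\<^esub> d (n - 1) \<otimes>\<^bsub>F\<^esub> d n, \<zero>\<^bsub>F\<^esub>)} \<union>
     {(x (n - 1) \<otimes>\<^bsub>F\<^esub> d n \<ominus>\<^bsub>F\<^esub> d n \<otimes>\<^bsub>F\<^esub> x n, \<one>\<^bsub>F\<^esub>)} \<union>
     {(d n \<otimes>\<^bsub>F\<^esub> x (n - 1) \<ominus>\<^bsub>F\<^esub> x n \<otimes>\<^bsub>F\<^esub> d n, \<one>\<^bsub>F\<^esub>)} \<union>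
     {(d n \<otimes>\<^bsub>F\<^esub> x i \<oplus>\<^bsub>F\<^esub> x i \<otimes>\<^bsub>F\<^esub> d n, \<zero>\<^bsub>F\<^esub>) | i. 1 \<le> i \<and> i + 2 \<le> n})"

definition NH :: "nat \<Rightarrow> (nh_gen list \<Rightarrow> int) set ring" where
  "NH n = presented_alg (nh_gens n) (nh_rels n)"

definition nh_x :: "nat \<Rightarrow> nat \<Rightarrow> (nh_gen list \<Rightarrow> int) set" where
  "nh_x n i = presented_gen (nh_gens n) (nh_rels n) (X i)"

definition nh_d :: "nat \<Rightarrow> nat \<Rightarrow> (nh_gen list \<Rightarrow> int) set" where
  "nh_d n i = presented_gen (nh_gens n) (nh_rels n) (Dl i)"


section \<open>The action on skew polynomials\<close>

text \<open>In the three descriptions below, \<^const>\<open>extensional\<close> pins down the values off the carrier,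
  so that the described map is unique as a HOL function.\<close>

definition odd_refl :: "nat \<Rightarrow> nat \<Rightarrow> (nat list \<Rightarrow> int) set \<Rightarrow> (nat list \<Rightarrow> int) set" where
  "odd_refl n i =
    (THE s. s \<in> ring_hom (Pol n) (Pol n) \<inter> extensional (carrier (Pol n)) \<and>
      (\<forall>j\<in>{1..n}. s (pol_x n j) =
         (if i < n then
            (if j = i then \<ominus>\<^bsub>Pol n\<^esub> pol_x n (i + 1)
             else if j = i + 1 then \<ominus>\<^bsub>Pol n\<^esub> pol_x n i
             else \<ominus>\<^bsub>Pol n\<^esub> pol_x n j)
          else
            (if j = n then pol_x n (n - 1)
             else if j = n - 1 then pol_x n n
             else \<ominus>\<^bsub>Pol n\<^esub> pol_x n j))))"

definition odd_demazure :: "nat \<Rightarrow> nat \<Rightarrow> (nat list \<Rightarrow> int) set \<Rightarrow> (nat list \<Rightarrow> int) set" where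
  "odd_demazure n i =
    (THE d. d \<in> carrier (end_ring (Pol n)) \<and>
      d \<one>\<^bsub>Pol n\<^esub> = \<zero>\<^bsub>Pol n\<^esub> \<and>
      (\<forall>j\<in>{1..n}. d (pol_x n j) =
         (if i < n then
            (if j = i \<or> j = i + 1 then \<one>\<^bsub>Pol n\<^esub> else \<zero>\<^bsub>Pol n\<^esub>)
          else
            (if j = n then \<ominus>\<^bsub>Pol n\<^esub> \<one>\<^bsub>Pol n\<^esub>
             else if j = n - 1 then \<one>\<^bsub>Pol n\<^esub>
             else \<zero>\<^bsub>Pol n\<^esub>))) \<and>
      (\<forall>f\<in>carrier (Pol n). \<forall>g\<in>carrier (Pol n).
         d (f \<otimes>\<^bsub>Pol n\<^esub> g) =
           d f \<otimes>\<^bsub>Pol n\<^esub> g \<oplus>\<^bsub>Pol n\<^esub> odd_refl n i f \<otimes>\<^bsub>Pol n\<^esub> d g))"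

definition nh_act ::
    "nat \<Rightarrow> (nh_gen list \<Rightarrow> int) set \<Rightarrow> (nat list \<Rightarrow> int) set \<Rightarrow> (nat list \<Rightarrow> int) set" where
  "nh_act n =
    (THE h. h \<in> ring_hom (NH n) (end_ring (Pol n)) \<inter> extensional (carrier (NH n)) \<and>
      (\<forall>i\<in>{1..n}. h (nh_x n i) = (\<lambda>f\<in>carrier (Pol n). pol_x n i \<otimes>\<^bsub>Pol n\<^esub> f)) \<and>
      (\<forall>i\<in>{1..n}. h (nh_d n i) = odd_demazure n i))"


section \<open>The Weyl group of type D\<close>

text \<open>The Weyl group acts on the vectors \<open>\<plusminus>e\<^sub>1, \<dots>, \<plusminus>e\<^sub>n\<close>, and hence by signed permutations of
  \<open>\<plusminus>1, \<dots>, \<plusminus>n\<close> (extended by the identity to all integers). For \<open>i < n\<close>, \<open>simple_refl n i\<close> is the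
  reflection in \<open>e\<^sub>i - e\<^bsub>i+1\<^esub>\<close>; \<open>simple_refl n n\<close> is the reflection in \<open>e\<^bsub>n-1\<^esub> + e\<^sub>n\<close>.\<close>

definition simple_refl :: "nat \<Rightarrow> nat \<Rightarrow> int \<Rightarrow> int" where
  "simple_refl n i =
    (if i < n then transpose (int i) (int i + 1) \<circ> transpose (- int i) (- (int i + 1))
     else transpose (int n - 1) (- int n) \<circ> transpose (- (int n - 1)) (int n))"

definition weyl_D :: "nat \<Rightarrow> (int \<Rightarrow> int) set" where
  "weyl_D n = generate (BijGroup UNIV) (simple_refl n ` {1..n})"

definition word_prod :: "nat \<Rightarrow> nat list \<Rightarrow> int \<Rightarrow> int" where
  "word_prod n is = foldr (\<lambda>i w. simple_refl n i \<circ> w) is id"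

definition reduced_expr :: "nat \<Rightarrow> (int \<Rightarrow> int) \<Rightarrow> nat list \<Rightarrow> bool" where
  "reduced_expr n w is \<longleftrightarrow>
    set is \<subseteq> {1..n} \<and> word_prod n is = w \<and>
    (\<forall>js. set js \<subseteq> {1..n} \<and> word_prod n js = w \<longrightarrow> length is \<le> length js)"


section \<open>Monomials in the nilHecke algebra\<close>

definition nh_monom :: "nat \<Rightarrow> (nat \<Rightarrow> nat) \<Rightarrow> (nh_gen list \<Rightarrow> int) set" where
  "nh_monom n r =
    foldr (\<lambda>i a. (nh_x n i [^]\<^bsub>NH n\<^esub> r i) \<otimes>\<^bsub>NH n\<^esub> a) [1..<Suc n] \<one>\<^bsub>NH n\<^esub>"

definition nh_d_word :: "nat \<Rightarrow> nat list \<Rightarrow> (nh_gen list \<Rightarrow> int) set" where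
  "nh_d_word n is = foldr (\<lambda>i a. nh_d n i \<otimes>\<^bsub>NH n\<^esub> a) is \<one>\<^bsub>NH n\<^esub>"

text \<open>Exponent vectors are functions on \<open>{1..n}\<close>, undefined elsewhere, so that distinct indices
  are distinct vectors.\<close>

definition basis_index :: "nat \<Rightarrow> ((int \<Rightarrow> int) \<times> (nat \<Rightarrow> nat)) set" where
  "basis_index n = weyl_D n \<times> ({1..n} \<rightarrow>\<^sub>E UNIV)"

end

theory Submission
  imports Defs
begin

text \<open>Write \<open>\<partial>\<^sub>i\<close> for the divided difference generators, \<open>\<ell>\<close> for the length on \<open>D\<^sub>n\<close> and \<open>w\<^sub>0\<close> for
  the longest element.

  The \<open>\<partial>\<^sub>i\<close> satisfy the braid relations of type D up to sign and square to zero. Hence a product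
  of \<open>\<partial>\<^sub>i\<close> along a reduced word depends, up to sign, only on the group element
  (\<open>matsumoto\<close>), and the product along any other word is zero (\<open>d_word_not_reduced\<close>). This
  alone gives spanning: the additive group generated from the \<open>\<partial>\<^sub>w\<close> by left multiplication by the
  \<open>x\<^sub>j\<close> is closed under left multiplication by \<open>\<partial>\<^sub>i\<close>, because \<open>\<partial>\<^sub>i\<close> moves past \<open>x\<^sub>j\<close> at the cost
  of an integer, so it is a left ideal that contains \<open>1\<close> (\<open>monom_spanning\<close>).

  For independence suppose \<open>\<Sum>\<^sub>w f\<^sub>w \<partial>\<^sub>w = 0\<close> as operators, with skew polynomials \<open>f\<^sub>w\<close> that are not all
  zero, and let \<open>w\<close> be of minimal length with \<open>f\<^sub>w \<noteq> 0\<close>. Compose on the right with \<open>\<partial>\<^sub>u\<close>, where \<open>u\<close> is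
  the inverse of \<open>w\<close> times \<open>w\<^sub>0\<close>. Since \<open>\<ell>(w) + \<ell>(u) = \<ell>(w\<^sub>0)\<close> (\<open>length_complement\<close>), a summand
  with \<open>v \<noteq> w\<close> and \<open>\<ell>(v) \<ge> \<ell>(w)\<close> contributes the product along a non-reduced word, that is zero,
  and only \<open>f\<^sub>w \<partial>\<^sub>w\<^sub>0\<close> is left, up to sign. The operator \<open>\<partial>\<^sub>w\<^sub>0\<close> maps the product of the
  \<open>x\<^sub>k\<close> to the powers \<open>2 (n - k)\<close>, \<open>k < n\<close>, to the nonzero integer \<open>2\<close> to the power \<open>n - 1\<close>
  (\<open>longest_top\<close>). So \<open>f\<^sub>w = 0\<close>, because the skew monomials are independent over the integers
  (\<open>coefficient_monomial\<close>).

  The word reversal that fixes all generators respects the relations, hence defines an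
  anti-automorphism (\<open>reversal_exists\<close>). Up to signs it exchanges the two families, which settles the
  second family in the nilHecke algebra. The first basis and the independence of its image show that
  the action is faithful, so the image of the second basis is independent too.

  The action itself, like the operators \<open>\<partial>\<^sub>i\<close> on skew polynomials, is obtained from the universal
  property of rings given by generators and relations (\<open>hom_exists\<close>).\<close>

section \<open>Presented rings and their universal property\<close>

lemma free_alg_simps:
  "carrier (free_alg A) = {f. finite {w. f w \<noteq> 0} \<and> {w. f w \<noteq> 0} \<subseteq> lists A}"
  "\<one>\<^bsub>free_alg A\<^esub> = (\<lambda>w. if w = [] then 1 else 0)"
  "\<zero>\<^bsub>free_alg A\<^esub> = (\<lambda>w. 0)"
  "f \<oplus>\<^bsub>free_alg A\<^esub> g = (\<lambda>w. f w + g w)"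
  "f \<otimes>\<^bsub>free_alg A\<^esub> g = (\<lambda>w. \<Sum>k\<le>length w. f (take k w) * g (drop k w))"
  by (simp_all add: free_alg_def)

lemma free_mult_closed:
  assumes "f \<in> carrier (free_alg A)" "g \<in> carrier (free_alg A)"
  shows "f \<otimes>\<^bsub>free_alg A\<^esub> g \<in> carrier (free_alg A)"
proof -
  let ?S = "{w. f w \<noteq> 0}" and ?T = "{w. g w \<noteq> 0}"
  let ?h = "\<lambda>w. \<Sum>k\<le>length w. f (take k w) * g (drop k w)"
  have sub: "{w. ?h w \<noteq> 0} \<subseteq> (\<lambda>(u, v). u @ v) ` (?S \<times> ?T)"
  proof
    fix w assume "w \<in> {w. ?h w \<noteq> 0}"
    then obtain k where "f (take k w) * g (drop k w) \<noteq> 0"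
      by (metis (mono_tags, lifting) mem_Collect_eq sum.neutral)
    then have "(take k w, drop k w) \<in> ?S \<times> ?T" by auto
    then show "w \<in> (\<lambda>(u, v). u @ v) ` (?S \<times> ?T)"
      by (metis (mono_tags, lifting) append_take_drop_id image_eqI split_conv)
  qed
  have "finite ((\<lambda>(u, v). u @ v) ` (?S \<times> ?T))"
    using assms by (intro finite_imageI finite_cartesian_product) (auto simp: free_alg_simps)
  moreover have "(\<lambda>(u, v). u @ v) ` (?S \<times> ?T) \<subseteq> lists A"
    using assms by (fastforce simp: free_alg_simps)
  ultimately show ?thesis
    using sub unfolding free_alg_simps by (blast intro: finite_subset)
qed

text \<open>Both sides sum over the decompositions of \<open>w\<close> into three consecutive factors.\<close>

lemma free_mult_assoc:
  "(\<Sum>k\<le>length w. (\<Sum>j\<le>length (take k w). f (take j (take k w)) * g (drop j (take k w))) * h (drop k w))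
   = (\<Sum>k\<le>length w. f (take k w) *
       (\<Sum>j\<le>length (drop k w). g (take j (drop k w)) * h (drop j (drop k w))))"
  for f g h :: "'a list \<Rightarrow> int"
proof -
  let ?n = "length w"
  let ?t = "\<lambda>i j. f (take i w) * g (take j (drop i w)) * h (drop (i + j) w)"
  have "(\<Sum>k\<le>?n. (\<Sum>j\<le>length (take k w). f (take j (take k w)) * g (drop j (take k w))) * h (drop k w))
      = (\<Sum>k\<le>?n. \<Sum>j\<le>k. ?t j (k - j))"
  proof (rule sum.cong[OF refl])
    fix k assume "k \<in> {..?n}"
    then show "(\<Sum>j\<le>length (take k w). f (take j (take k w)) * g (drop j (take k w))) * h (drop k w)
        = (\<Sum>j\<le>k. ?t j (k - j))"
      unfolding sum_distrib_right
      by (intro sum.cong) (auto simp: min_def drop_take)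
  qed
  also have "\<dots> = (\<Sum>(i, j) \<in> {(i, j). i + j \<le> ?n}. ?t i j)"
    by (rule sum.triangle_reindex_eq[symmetric])
  also have "{(i, j). i + j \<le> ?n} = Sigma {..?n} (\<lambda>i. {..?n - i})"
    by auto
  also have "(\<Sum>(i, j) \<in> Sigma {..?n} (\<lambda>i. {..?n - i}). ?t i j) = (\<Sum>i\<le>?n. \<Sum>j\<le>?n - i. ?t i j)"
    by (rule sum.Sigma[symmetric]) auto
  also have "\<dots> = (\<Sum>k\<le>?n. f (take k w) *
       (\<Sum>j\<le>length (drop k w). g (take j (drop k w)) * h (drop j (drop k w))))"
    by (auto simp: sum_distrib_left mult.assoc add.commute intro!: sum.cong)
  finally show ?thesis .
qed

lemma free_alg_ring: "ring (free_alg A)"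
proof (rule ringI)
  show "abelian_group (free_alg A)"
  proof (rule abelian_groupI)
    fix f g assume "f \<in> carrier (free_alg A)" "g \<in> carrier (free_alg A)"
    moreover have "{w. f w + g w \<noteq> 0} \<subseteq> {w. f w \<noteq> 0} \<union> {w. g w \<noteq> 0}" by auto
    ultimately show "f \<oplus>\<^bsub>free_alg A\<^esub> g \<in> carrier (free_alg A)"
      unfolding free_alg_simps by (auto intro: finite_subset)
  next
    fix f assume "f \<in> carrier (free_alg A)"
    then show "\<exists>g\<in>carrier (free_alg A). g \<oplus>\<^bsub>free_alg A\<^esub> f = \<zero>\<^bsub>free_alg A\<^esub>"
      by (intro bexI[of _ "\<lambda>w. - f w"]) (auto simp: free_alg_simps)
  qed (auto simp: free_alg_simps)
  show "Group.monoid (free_alg A)"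
  proof (rule monoidI)
    fix f g h
    show "f \<otimes>\<^bsub>free_alg A\<^esub> g \<otimes>\<^bsub>free_alg A\<^esub> h = f \<otimes>\<^bsub>free_alg A\<^esub> (g \<otimes>\<^bsub>free_alg A\<^esub> h)"
      unfolding free_alg_simps by (rule ext, rule free_mult_assoc)
  next
    fix f assume "f \<in> carrier (free_alg A)"
    show "\<one>\<^bsub>free_alg A\<^esub> \<otimes>\<^bsub>free_alg A\<^esub> f = f"
    proof
      fix w :: "'a list"
      have "(\<Sum>k\<le>length w. (if take k w = [] then 1 else 0) * f (drop k w))
          = (\<Sum>k\<le>length w. if k = 0 then f w else 0)"
        by (rule sum.cong) auto
      then show "(\<one>\<^bsub>free_alg A\<^esub> \<otimes>\<^bsub>free_alg A\<^esub> f) w = f w" by (simp add: free_alg_simps)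
    qed
    show "f \<otimes>\<^bsub>free_alg A\<^esub> \<one>\<^bsub>free_alg A\<^esub> = f"
    proof
      fix w :: "'a list"
      have "(\<Sum>k\<le>length w. f (take k w) * (if drop k w = [] then 1 else 0))
          = (\<Sum>k\<le>length w. if k = length w then f w else 0)"
        by (rule sum.cong) auto
      then show "(f \<otimes>\<^bsub>free_alg A\<^esub> \<one>\<^bsub>free_alg A\<^esub>) w = f w" by (simp add: free_alg_simps)
    qed
  qed (auto simp: free_mult_closed, auto simp: free_alg_simps)
qed (auto simp: free_alg_simps algebra_simps sum.distrib)

lemma free_gen_closed: "a \<in> A \<Longrightarrow> free_gen a \<in> carrier (free_alg A)"
  by (auto simp: free_alg_simps free_gen_def)

lemma free_a_inv: "f \<in> carrier (free_alg A) \<Longrightarrow> \<ominus>\<^bsub>free_alg A\<^esub> f = (\<lambda>w. - f w)"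
  by (rule abelian_group.minus_equality[OF ring.is_abelian_group[OF free_alg_ring]])
     (auto simp: free_alg_simps)

lemma free_gen_mult:
  "free_gen a \<otimes>\<^bsub>free_alg A\<^esub> g = (\<lambda>w. case w of [] \<Rightarrow> 0 | b # v \<Rightarrow> if b = a then g v else 0)"
proof
  fix w :: "'a list"
  show "(free_gen a \<otimes>\<^bsub>free_alg A\<^esub> g) w = (case w of [] \<Rightarrow> 0 | b # v \<Rightarrow> if b = a then g v else 0)"
  proof (cases w)
    case (Cons b v)
    have "(\<Sum>k\<le>length w. free_gen a (take k w) * g (drop k w))
        = (\<Sum>k\<le>length w. if k = 1 then (if b = a then g v else 0) else 0)"
    proof (rule sum.cong[OF refl])
      fix k assume "k \<in> {..length w}"
      then show "free_gen a (take k w) * g (drop k w)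
          = (if k = 1 then (if b = a then g v else 0) else 0)"
        using Cons by (cases k) (auto simp: free_gen_def)
    qed
    also have "\<dots> = (if b = a then g v else 0)"
      using Cons by (subst sum.delta) auto
    finally show ?thesis by (simp add: Cons free_alg_simps)
  qed (simp add: free_alg_simps free_gen_def)
qed

text \<open>The free ring is generated, as an additive group, by products of letters multiplied up from
  the right. Induction along this generation replaces bookkeeping with supports from here on.\<close>

lemma free_alg_induct [consumes 1, case_names one gen add neg]:
  assumes f: "f \<in> carrier (free_alg A)"
    and one: "P \<one>\<^bsub>free_alg A\<^esub>"
    and gen: "\<And>a f. a \<in> A \<Longrightarrow> f \<in> carrier (free_alg A) \<Longrightarrow> P f \<Longrightarrow> P (free_gen a \<otimes>\<^bsub>free_alg A\<^esub> f)"
    and add: "\<And>f g. f \<in> carrier (free_alg A) \<Longrightarrow> g \<in> carrier (free_alg A) \<Longrightarrow> P f \<Longrightarrow> P g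
       \<Longrightarrow> P (f \<oplus>\<^bsub>free_alg A\<^esub> g)"
    and neg: "\<And>f. f \<in> carrier (free_alg A) \<Longrightarrow> P f \<Longrightarrow> P (\<ominus>\<^bsub>free_alg A\<^esub> f)"
  shows "P f"
proof -
  interpret F: ring "free_alg A" by (rule free_alg_ring)
  let ?\<delta> = "\<lambda>c w v. if v = w then c else (0::int)"
  have car: "?\<delta> c w \<in> carrier (free_alg A)" if "w \<in> lists A" for c w
    using that by (auto simp: free_alg_simps)
  have zero: "P (\<lambda>w. 0)"
    using add[OF F.one_closed F.a_inv_closed[OF F.one_closed] one neg[OF F.one_closed one]]
    by (simp add: F.r_neg) (simp add: free_alg_simps)
  have word: "P (?\<delta> 1 w)" if "w \<in> lists A" for w
    using that
  proof (induction w)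
    case Nil
    then show ?case using one by (simp add: free_alg_simps)
  next
    case (Cons a w)
    have "?\<delta> 1 (a # w) = free_gen a \<otimes>\<^bsub>free_alg A\<^esub> ?\<delta> 1 w"
      unfolding free_gen_mult by (auto split: list.split)
    then show ?case using gen[OF _ car Cons.IH] Cons.hyps by simp
  qed
  have nat_mult: "P (?\<delta> (int k) w)" if "w \<in> lists A" for k w
  proof (induction k)
    case (Suc k)
    have "?\<delta> (int (Suc k)) w = ?\<delta> 1 w \<oplus>\<^bsub>free_alg A\<^esub> ?\<delta> (int k) w"
      by (auto simp: free_alg_simps)
    then show ?case using add[OF car[OF that] car[OF that] word[OF that] Suc.IH] by simp
  qed (use zero in \<open>simp cong: if_cong\<close>)
  have int_mult: "P (?\<delta> c w)" if "w \<in> lists A" for c w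
  proof (cases c)
    case (neg k)
    have "?\<delta> c w = \<ominus>\<^bsub>free_alg A\<^esub> (?\<delta> (int (Suc k)) w)"
      unfolding free_a_inv[OF car[OF that]] neg by auto
    then show ?thesis using assms(5)[OF car[OF that] nat_mult[OF that]] by simp
  qed (use nat_mult[OF that] in auto)
  have "P (\<lambda>v. if v \<in> S then f v else 0)" if "finite S" "S \<subseteq> lists A" for S
    using that
  proof (induction S)
    case (insert w S)
    have "(\<lambda>v. if v \<in> insert w S then f v else 0)
        = ?\<delta> (f w) w \<oplus>\<^bsub>free_alg A\<^esub> (\<lambda>v. if v \<in> S then f v else 0)"
      using insert.hyps by (auto simp: free_alg_simps)
    moreover have "(\<lambda>v. if v \<in> S then f v else 0) \<in> carrier (free_alg A)"
      using insert.prems insert.hyps by (auto simp: free_alg_simps)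
    ultimately show ?case
      using add[OF car _ int_mult insert.IH] insert.prems by simp
  qed (use zero in simp)
  from this[of "{w. f w \<noteq> 0}"] f have "P (\<lambda>v. if f v \<noteq> 0 then f v else 0)"
    by (simp add: free_alg_simps)
  moreover have "(\<lambda>v. if f v \<noteq> 0 then f v else 0) = f" by auto
  ultimately show ?thesis by (simp only:)
qed

text \<open>Substitution of \<open>\<phi>\<close> into a noncommutative polynomial.\<close>

definition eval_free :: "('b, 'm) ring_scheme \<Rightarrow> ('a \<Rightarrow> 'b) \<Rightarrow> ('a list \<Rightarrow> int) \<Rightarrow> 'b" where
  "eval_free R \<phi> f =
     (\<Oplus>\<^bsub>R\<^esub>w\<in>{w. f w \<noteq> 0}. [f w] \<cdot>\<^bsub>R\<^esub> foldr (\<lambda>a y. \<phi> a \<otimes>\<^bsub>R\<^esub> y) w \<one>\<^bsub>R\<^esub>)"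

context ring begin

lemma foldr_mult_closed:
  "\<phi> \<in> A \<rightarrow> carrier R \<Longrightarrow> w \<in> lists A \<Longrightarrow> foldr (\<lambda>a y. \<phi> a \<otimes> y) w \<one> \<in> carrier R"
  by (induction w) auto

lemma zero_add_pow [simp]: "[(0::int)] \<cdot> a = \<zero>"
  by (simp add: add_pow_def)

text \<open>Summing over any larger finite set of words makes evaluation additive term by term.\<close>

lemma eval_free_superset:
  assumes "\<phi> \<in> A \<rightarrow> carrier R" "finite B" "{w. f w \<noteq> 0} \<subseteq> B" "B \<subseteq> lists A"
  shows "eval_free R \<phi> f = (\<Oplus>w\<in>B. [f w] \<cdot> foldr (\<lambda>a y. \<phi> a \<otimes> y) w \<one>)"
  unfolding eval_free_def
proof (rule add.finprod_mono_neutral_cong_left)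
  have "foldr (\<lambda>a y. \<phi> a \<otimes> y) w \<one> \<in> carrier R" if "w \<in> B" for w
    using foldr_mult_closed[OF assms(1)] assms(4) that by blast
  then show "(\<lambda>w. [f w] \<cdot> foldr (\<lambda>a y. \<phi> a \<otimes> y) w \<one>) \<in> B \<rightarrow> carrier R" by auto
qed (use assms in auto)

lemma eval_free_closed:
  assumes "\<phi> \<in> A \<rightarrow> carrier R" "f \<in> carrier (free_alg A)"
  shows "eval_free R \<phi> f \<in> carrier R"
proof -
  have "foldr (\<lambda>a y. \<phi> a \<otimes> y) w \<one> \<in> carrier R" if "f w \<noteq> 0" for w
    using foldr_mult_closed[OF assms(1)] assms(2) that by (auto simp: free_alg_simps)
  then show ?thesis unfolding eval_free_def by (intro finsum_closed) auto
qed

lemma eval_free_add: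
  assumes \<phi>: "\<phi> \<in> A \<rightarrow> carrier R"
    and "f \<in> carrier (free_alg A)" "g \<in> carrier (free_alg A)"
  shows "eval_free R \<phi> (f \<oplus>\<^bsub>free_alg A\<^esub> g) = eval_free R \<phi> f \<oplus> eval_free R \<phi> g"
proof -
  let ?B = "{w. f w \<noteq> 0} \<union> {w. g w \<noteq> 0}"
  have B: "finite ?B" "?B \<subseteq> lists A" using assms by (auto simp: free_alg_simps)
  have wc: "foldr (\<lambda>a y. \<phi> a \<otimes> y) w \<one> \<in> carrier R" if "w \<in> ?B" for w
    using foldr_mult_closed[OF \<phi>] B(2) that by blast
  have "eval_free R \<phi> (f \<oplus>\<^bsub>free_alg A\<^esub> g)
      = (\<Oplus>w\<in>?B. [(f w + g w)] \<cdot> foldr (\<lambda>a y. \<phi> a \<otimes> y) w \<one>)"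
    unfolding free_alg_simps using B by (intro eval_free_superset[OF \<phi> B(1) _ B(2)]) auto
  also have "\<dots> = (\<Oplus>w\<in>?B. [f w] \<cdot> foldr (\<lambda>a y. \<phi> a \<otimes> y) w \<one> \<oplus> [g w] \<cdot> foldr (\<lambda>a y. \<phi> a \<otimes> y) w \<one>)"
    using wc by (intro finsum_cong' refl funcsetI) (simp_all add: add.int_pow_mult)
  also have "\<dots> = eval_free R \<phi> f \<oplus> eval_free R \<phi> g"
    unfolding eval_free_superset[OF \<phi> B(1) Un_upper1 B(2)]
      eval_free_superset[OF \<phi> B(1) Un_upper2 B(2)]
    using wc by (intro finsum_addf funcsetI) simp_all
  finally show ?thesis .
qed

lemma eval_free_one: "eval_free R \<phi> \<one>\<^bsub>free_alg A\<^esub> = \<one>"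
proof -
  have "{w :: 'b list. (if w = [] then 1 else 0) \<noteq> (0::int)} = {[]}" by auto
  then show ?thesis by (simp add: eval_free_def free_alg_simps)
qed

lemma eval_free_gen_mult:
  assumes \<phi>: "\<phi> \<in> A \<rightarrow> carrier R" and a: "a \<in> A" and f: "f \<in> carrier (free_alg A)"
  shows "eval_free R \<phi> (free_gen a \<otimes>\<^bsub>free_alg A\<^esub> f) = \<phi> a \<otimes> eval_free R \<phi> f"
proof -
  let ?wp = "\<lambda>w. foldr (\<lambda>a y. \<phi> a \<otimes> y) w \<one>"
  let ?S = "{w. f w \<noteq> 0}"
  have S: "finite ?S" "?S \<subseteq> lists A" using f by (auto simp: free_alg_simps)
  have wc: "?wp w \<in> carrier R" if "w \<in> ?S" for w
    using foldr_mult_closed[OF \<phi>] S(2) that by blast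
  have \<phi>a: "\<phi> a \<in> carrier R" using \<phi> a by auto
  have eq: "{w. (free_gen a \<otimes>\<^bsub>free_alg A\<^esub> f) w \<noteq> 0} = (Cons a) ` ?S"
    unfolding free_gen_mult by (auto split: list.splits if_splits simp: image_iff)
      (metis list.exhaust)
  have "eval_free R \<phi> (free_gen a \<otimes>\<^bsub>free_alg A\<^esub> f)
      = (\<Oplus>w\<in>?S. [f w] \<cdot> (\<phi> a \<otimes> ?wp w))"
    unfolding eval_free_def eq using wc \<phi>a
    by (subst finsum_reindex) (auto simp: free_gen_mult intro!: finsum_cong')
  also have "\<dots> = (\<Oplus>w\<in>?S. \<phi> a \<otimes> [f w] \<cdot> ?wp w)"
    using wc \<phi>a by (intro finsum_cong' refl funcsetI) (simp_all add: add_pow_rdistr_int)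
  also have "\<dots> = \<phi> a \<otimes> eval_free R \<phi> f"
    unfolding eval_free_def using S(1) wc \<phi>a by (intro finsum_rdistr[symmetric]) auto
  finally show ?thesis .
qed

lemma eval_free_gen:
  assumes "\<phi> \<in> A \<rightarrow> carrier R" "a \<in> A"
  shows "eval_free R \<phi> (free_gen a) = \<phi> a"
proof -
  interpret F: ring "free_alg A" by (rule free_alg_ring)
  show ?thesis
    using eval_free_gen_mult[OF assms F.one_closed] free_gen_closed[OF assms(2)]
      funcset_mem[OF assms]
    by (simp add: eval_free_one)
qed

text \<open>Multiplicativity needs no double sum: the left factors for which it holds contain \<open>1\<close> and are
  closed under sums, negatives and left multiplication by letters.\<close>

lemma eval_free_hom:
  assumes \<phi>: "\<phi> \<in> A \<rightarrow> carrier R"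
  shows "eval_free R \<phi> \<in> ring_hom (free_alg A) R"
proof (rule ring_hom_memI)
  interpret F: ring "free_alg A" by (rule free_alg_ring)
  fix f g assume fg: "f \<in> carrier (free_alg A)" "g \<in> carrier (free_alg A)"
  note ev_closed = eval_free_closed[OF \<phi>]
  from fg(1) show "eval_free R \<phi> (f \<otimes>\<^bsub>free_alg A\<^esub> g) = eval_free R \<phi> f \<otimes> eval_free R \<phi> g"
  proof (induction rule: free_alg_induct)
    case one
    then show ?case using fg(2) ev_closed by (simp add: eval_free_one)
  next
    case (gen a f)
    have "\<phi> a \<in> carrier R" using gen(1) \<phi> by auto
    then show ?case
      using gen fg(2) ev_closed
      by (simp add: F.m_assoc free_gen_closed eval_free_gen_mult[OF \<phi>] m_assoc)
  next
    case (add f h)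
    then show ?case using fg(2) ev_closed
      by (simp add: F.l_distr eval_free_add[OF \<phi>] l_distr)
  next
    case (neg f)
    have "eval_free R \<phi> (\<ominus>\<^bsub>free_alg A\<^esub> h) = \<ominus> eval_free R \<phi> h"
      if h: "h \<in> carrier (free_alg A)" for h
    proof (rule minus_equality[symmetric])
      have "eval_free R \<phi> (\<zero>\<^bsub>free_alg A\<^esub>) = \<zero>" by (simp add: eval_free_def free_alg_simps)
      then show "eval_free R \<phi> (\<ominus>\<^bsub>free_alg A\<^esub> h) \<oplus> eval_free R \<phi> h = \<zero>"
        using eval_free_add[OF \<phi> F.a_inv_closed[OF h] h] h by (simp add: F.l_neg)
    qed (use h ev_closed in auto)
    then show ?case using neg fg(2) ev_closed by (simp add: F.l_minus l_minus)
  qed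
qed (use eval_free_closed[OF \<phi>] eval_free_add[OF \<phi>] in \<open>auto simp: eval_free_one\<close>)

end

locale presentation =
  fixes A :: "'a set" and rels :: "(('a list \<Rightarrow> int) \<times> ('a list \<Rightarrow> int)) set"
  assumes rels_closed: "(l, r) \<in> rels \<Longrightarrow> l \<in> carrier (free_alg A) \<and> r \<in> carrier (free_alg A)"
begin

abbreviation "F \<equiv> free_alg A"
abbreviation "Q \<equiv> presented_alg A rels"
abbreviation "proj \<equiv> (+>\<^bsub>F\<^esub>) (rel_ideal A rels)"

sublocale F: ring F by (rule free_alg_ring)

lemma relators_closed: "{l \<ominus>\<^bsub>F\<^esub> r | l r. (l, r) \<in> rels} \<subseteq> carrier F"
  using rels_closed by auto

sublocale I: ideal "rel_ideal A rels" F
  unfolding rel_ideal_def by (rule F.genideal_ideal[OF relators_closed])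

sublocale proj: ring_hom_ring F Q proj
  unfolding presented_alg_def by (rule I.rcos_ring_hom_ring)

lemma proj_rel: "(l, r) \<in> rels \<Longrightarrow> proj l = proj r"
proof -
  assume lr: "(l, r) \<in> rels"
  then have "l \<ominus>\<^bsub>F\<^esub> r \<in> rel_ideal A rels"
    using F.genideal_self[OF relators_closed] unfolding rel_ideal_def by blast
  then show ?thesis
    using F.quotient_eq_iff_same_a_r_cos[OF I.is_ideal] rels_closed[OF lr] by blast
qed

lemma proj_surj: "a \<in> carrier Q \<Longrightarrow> \<exists>f\<in>carrier F. a = proj f"
  unfolding presented_alg_def FactRing_def A_RCOSETS_def'
  by (auto simp: a_r_coset_def)

lemma gen_closed: "a \<in> A \<Longrightarrow> presented_gen A rels a \<in> carrier Q"
  unfolding presented_gen_def by (rule proj.hom_closed) (rule free_gen_closed)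

lemma presented_induct [consumes 1, case_names one gen add neg]:
  assumes "x \<in> carrier Q"
    and one: "P \<one>\<^bsub>Q\<^esub>"
    and gen: "\<And>a y. a \<in> A \<Longrightarrow> y \<in> carrier Q \<Longrightarrow> P y \<Longrightarrow> P (presented_gen A rels a \<otimes>\<^bsub>Q\<^esub> y)"
    and add: "\<And>y z. y \<in> carrier Q \<Longrightarrow> z \<in> carrier Q \<Longrightarrow> P y \<Longrightarrow> P z \<Longrightarrow> P (y \<oplus>\<^bsub>Q\<^esub> z)"
    and neg: "\<And>y. y \<in> carrier Q \<Longrightarrow> P y \<Longrightarrow> P (\<ominus>\<^bsub>Q\<^esub> y)"
  shows "P x"
proof -
  obtain f where f: "f \<in> carrier F" "x = proj f" using proj_surj[OF assms(1)] by auto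
  from f(1) have "P (proj f)"
  proof (induction rule: free_alg_induct)
    case (gen a f)
    then show ?case
      using assms(3)[OF gen(1) proj.hom_closed[OF gen(2)] gen(3)]
      by (simp only: proj.hom_mult[OF free_gen_closed[OF gen(1)] gen(2)] presented_gen_def)
  next
    case one
    then show ?case using assms(2) by (simp only: proj.hom_one)
  next
    case (add f g)
    then show ?case
      using assms(4)[OF proj.hom_closed[OF add(1)] proj.hom_closed[OF add(2)] add(3,4)]
      by (simp only: proj.hom_add)
  next
    case (neg f)
    then show ?case
      using assms(5)[OF proj.hom_closed[OF neg(1)] neg(2)] by (simp only: proj.hom_a_inv)
  qed
  then show ?thesis using f by simp
qed

lemma hom_unique:
  assumes "ring R"
    and "h \<in> ring_hom Q R \<inter> extensional (carrier Q)" "h' \<in> ring_hom Q R \<inter> extensional (carrier Q)"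
    and "\<And>a. a \<in> A \<Longrightarrow> h (presented_gen A rels a) = h' (presented_gen A rels a)"
  shows "h = h'"
proof (rule extensionalityI)
  interpret h: ring_hom_ring Q R h
    using assms(2) by (intro ring_hom_ringI2 proj.S.ring_axioms assms(1)) simp
  interpret h': ring_hom_ring Q R h'
    using assms(3) by (intro ring_hom_ringI2 proj.S.ring_axioms assms(1)) simp
  fix x assume "x \<in> carrier Q"
  then show "h x = h' x"
    by (induction rule: presented_induct) (auto simp: gen_closed assms(4))
qed (use assms in auto)

text \<open>Evaluation kills the relators, so it factors through the quotient. The condition on the
  relations is phrased for an arbitrary homomorphism \<open>e\<close> extending \<open>\<phi>\<close>: then each instance is
  checked by pushing \<open>e\<close> through the terms of the relation.\<close>

lemma hom_exists:
  assumes R: "ring R" and \<phi>: "\<phi> \<in> A \<rightarrow> carrier R"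
    and rel: "\<And>e l r. ring_hom_ring F R e \<Longrightarrow> (\<And>a. a \<in> A \<Longrightarrow> e (free_gen a) = \<phi> a)
        \<Longrightarrow> (l, r) \<in> rels \<Longrightarrow> e l = e r"
  shows "\<exists>h. h \<in> ring_hom Q R \<inter> extensional (carrier Q) \<and>
           (\<forall>a\<in>A. h (presented_gen A rels a) = \<phi> a)"
proof -
  interpret R: ring R by (rule R)
  define e where "e = eval_free R \<phi>"
  interpret e: ring_hom_ring F R e
    unfolding e_def by (rule ring_hom_ringI2[OF F.ring_axioms R R.eval_free_hom[OF \<phi>]])
  have e_gen: "e (free_gen a) = \<phi> a" if "a \<in> A" for a
    unfolding e_def by (rule R.eval_free_gen[OF \<phi> that])
  have "rel_ideal A rels \<subseteq> a_kernel F R e"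
    unfolding rel_ideal_def
  proof (rule F.genideal_minimal[OF e.kernel_is_ideal], safe)
    fix l r assume lr: "(l, r) \<in> rels"
    have "e l = e r" using rel[OF e.ring_hom_ring_axioms e_gen lr] .
    then show "l \<ominus>\<^bsub>F\<^esub> r \<in> a_kernel F R e"
      using rels_closed[OF lr] unfolding a_kernel_def' by (simp add: a_minus_def R.r_neg)
  qed
  then have ker: "e i = \<zero>\<^bsub>R\<^esub>" if "i \<in> rel_ideal A rels" for i
    using that unfolding a_kernel_def' by blast
  have well_defined: "e f = e g" if "f \<in> carrier F" "g \<in> carrier F" "proj f = proj g" for f g
  proof -
    have "f \<ominus>\<^bsub>F\<^esub> g \<in> rel_ideal A rels"
      using that F.quotient_eq_iff_same_a_r_cos[OF I.is_ideal] by blast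
    then have "e (f \<ominus>\<^bsub>F\<^esub> g) = \<zero>\<^bsub>R\<^esub>" by (rule ker)
    moreover have "f = (f \<ominus>\<^bsub>F\<^esub> g) \<oplus>\<^bsub>F\<^esub> g"
      using that by (simp add: F.minus_eq F.a_assoc F.l_neg)
    ultimately show ?thesis
      using that e.hom_add[of "f \<ominus>\<^bsub>F\<^esub> g" g] by (metis F.minus_closed R.l_zero e.hom_closed)
  qed
  define h where "h = (\<lambda>x\<in>carrier Q. e (SOME f. f \<in> carrier F \<and> x = proj f))"
  have h_proj: "h (proj f) = e f" if f: "f \<in> carrier F" for f
  proof -
    have "\<exists>g. g \<in> carrier F \<and> proj f = proj g" using f by auto
    then have "(SOME g. g \<in> carrier F \<and> proj f = proj g) \<in> carrier F"
      "proj f = proj (SOME g. g \<in> carrier F \<and> proj f = proj g)"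
      by (rule someI2_ex, simp)+
    from well_defined[OF this(1) f this(2)[symmetric]] show ?thesis
      using proj.hom_closed[OF f] by (simp only: h_def restrict_apply')
  qed
  have "h \<in> ring_hom Q R"
  proof (rule ring_hom_memI)
    fix x y assume "x \<in> carrier Q" "y \<in> carrier Q"
    then obtain f g where fg: "f \<in> carrier F" "x = proj f" "g \<in> carrier F" "y = proj g"
      using proj_surj[of x] proj_surj[of y] by blast
    show "h x \<in> carrier R" using fg by (simp add: h_proj)
    show "h (x \<otimes>\<^bsub>Q\<^esub> y) = h x \<otimes>\<^bsub>R\<^esub> h y"
      using fg h_proj[of "f \<otimes>\<^bsub>F\<^esub> g"] by (simp add: h_proj)
    show "h (x \<oplus>\<^bsub>Q\<^esub> y) = h x \<oplus>\<^bsub>R\<^esub> h y"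
      using fg h_proj[of "f \<oplus>\<^bsub>F\<^esub> g"] by (simp add: h_proj)
  next
    show "h \<one>\<^bsub>Q\<^esub> = \<one>\<^bsub>R\<^esub>" using h_proj[of "\<one>\<^bsub>F\<^esub>"] by simp
  qed
  moreover have "h \<in> extensional (carrier Q)" by (simp add: h_def)
  moreover have "h (presented_gen A rels a) = \<phi> a" if "a \<in> A" for a
    unfolding presented_gen_def using that h_proj[OF free_gen_closed[OF that]] e_gen by simp
  ultimately show ?thesis by blast
qed

end

section \<open>Endomorphism rings, opposite rings and triangular matrices\<close>

lemma end_ring_simps:
  "\<one>\<^bsub>end_ring R\<^esub> = (\<lambda>x\<in>carrier R. x)"
  "\<zero>\<^bsub>end_ring R\<^esub> = (\<lambda>x\<in>carrier R. \<zero>\<^bsub>R\<^esub>)"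
  "f \<oplus>\<^bsub>end_ring R\<^esub> g = (\<lambda>x\<in>carrier R. f x \<oplus>\<^bsub>R\<^esub> g x)"
  "f \<otimes>\<^bsub>end_ring R\<^esub> g = compose (carrier R) f g"
  by (simp_all add: end_ring_def)

lemma end_ring_mem:
  "f \<in> carrier (end_ring R) \<longleftrightarrow> f \<in> extensional (carrier R) \<and> f \<in> carrier R \<rightarrow> carrier R \<and>
     (\<forall>x\<in>carrier R. \<forall>y\<in>carrier R. f (x \<oplus>\<^bsub>R\<^esub> y) = f x \<oplus>\<^bsub>R\<^esub> f y)"
  by (auto simp: end_ring_def hom_def)

context abelian_group begin

lemma end_zero:
  assumes "f \<in> carrier (end_ring G)" shows "f \<zero> = \<zero>"
proof -
  have "f \<zero> \<oplus> f \<zero> = f \<zero>" "f \<zero> \<in> carrier G"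
    using assms zero_closed l_zero[OF zero_closed] unfolding end_ring_mem
    by (metis, blast)
  then show ?thesis by (metis add.l_cancel_one' zero_closed)
qed

lemma end_neg:
  assumes "f \<in> carrier (end_ring G)" "x \<in> carrier G" shows "f (\<ominus> x) = \<ominus> f x"
proof (rule minus_equality[symmetric])
  have "f (\<ominus> x \<oplus> x) = f (\<ominus> x) \<oplus> f x"
    using assms by (auto simp: end_ring_mem)
  then show "f (\<ominus> x) \<oplus> f x = \<zero>" using assms(2) end_zero[OF assms(1)] by (simp add: l_neg)
qed (use assms in \<open>auto simp: end_ring_mem\<close>)

lemma end_ring_ring: "ring (end_ring G)"
proof (rule ringI)
  show "abelian_group (end_ring G)"
  proof (rule abelian_groupI)
    fix f g assume fg: "f \<in> carrier (end_ring G)" "g \<in> carrier (end_ring G)"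
    have "f (x \<oplus> y) \<oplus> g (x \<oplus> y) = (f x \<oplus> g x) \<oplus> (f y \<oplus> g y)"
      if "x \<in> carrier G" "y \<in> carrier G" for x y
    proof -
      have "f x \<in> carrier G" "f y \<in> carrier G" "g x \<in> carrier G" "g y \<in> carrier G"
        "f (x \<oplus> y) = f x \<oplus> f y" "g (x \<oplus> y) = g x \<oplus> g y"
        using that fg by (auto simp: end_ring_mem)
      then show ?thesis by (simp add: a_ac)
    qed
    then show "f \<oplus>\<^bsub>end_ring G\<^esub> g \<in> carrier (end_ring G)"
      using fg unfolding end_ring_mem end_ring_simps by (auto simp: Pi_def)
  next
    fix f assume f: "f \<in> carrier (end_ring G)"
    let ?g = "\<lambda>x\<in>carrier G. \<ominus> f x"
    have fc: "f x \<in> carrier G" "f (x \<oplus> y) = f x \<oplus> f y"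
      if "x \<in> carrier G" "y \<in> carrier G" for x y using f that by (auto simp: end_ring_mem)
    have "?g \<in> carrier (end_ring G)"
      unfolding end_ring_mem using fc by (auto simp: minus_add)
    moreover have "?g \<oplus>\<^bsub>end_ring G\<^esub> f = \<zero>\<^bsub>end_ring G\<^esub>"
      unfolding end_ring_simps using fc by (intro restrict_ext) (simp add: l_neg)
    ultimately show "\<exists>g\<in>carrier (end_ring G). g \<oplus>\<^bsub>end_ring G\<^esub> f = \<zero>\<^bsub>end_ring G\<^esub>" by blast
  next
    fix f g h assume "f \<in> carrier (end_ring G)" "g \<in> carrier (end_ring G)" "h \<in> carrier (end_ring G)"
    then show "f \<oplus>\<^bsub>end_ring G\<^esub> g \<oplus>\<^bsub>end_ring G\<^esub> h = f \<oplus>\<^bsub>end_ring G\<^esub> (g \<oplus>\<^bsub>end_ring G\<^esub> h)"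
      unfolding end_ring_mem by (auto simp: end_ring_simps a_assoc Pi_def intro!: restrict_ext)
  next
    fix f g assume "f \<in> carrier (end_ring G)" "g \<in> carrier (end_ring G)"
    then show "f \<oplus>\<^bsub>end_ring G\<^esub> g = g \<oplus>\<^bsub>end_ring G\<^esub> f"
      unfolding end_ring_mem by (auto simp: end_ring_simps a_comm Pi_def intro!: restrict_ext)
  next
    fix f assume "f \<in> carrier (end_ring G)"
    then show "\<zero>\<^bsub>end_ring G\<^esub> \<oplus>\<^bsub>end_ring G\<^esub> f = f"
      unfolding end_ring_mem by (auto simp: end_ring_simps Pi_def extensional_def)
  qed (auto simp: end_ring_mem end_ring_simps)
  show "Group.monoid (end_ring G)"
  proof (rule monoidI)
    fix f g assume "f \<in> carrier (end_ring G)" "g \<in> carrier (end_ring G)"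
    then show "f \<otimes>\<^bsub>end_ring G\<^esub> g \<in> carrier (end_ring G)"
      unfolding end_ring_mem by (auto simp: end_ring_simps compose_def Pi_def)
  next
    fix f g h assume "f \<in> carrier (end_ring G)" "g \<in> carrier (end_ring G)" "h \<in> carrier (end_ring G)"
    then show "f \<otimes>\<^bsub>end_ring G\<^esub> g \<otimes>\<^bsub>end_ring G\<^esub> h = f \<otimes>\<^bsub>end_ring G\<^esub> (g \<otimes>\<^bsub>end_ring G\<^esub> h)"
      unfolding end_ring_mem by (auto simp: end_ring_simps compose_def Pi_def intro!: restrict_ext)
  next
    fix f assume "f \<in> carrier (end_ring G)"
    then show "\<one>\<^bsub>end_ring G\<^esub> \<otimes>\<^bsub>end_ring G\<^esub> f = f" "f \<otimes>\<^bsub>end_ring G\<^esub> \<one>\<^bsub>end_ring G\<^esub> = f"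
      unfolding end_ring_mem by (auto simp: end_ring_simps compose_def Pi_def extensional_def)
  qed (auto simp: end_ring_mem end_ring_simps)
next
  fix f g h assume "f \<in> carrier (end_ring G)" "g \<in> carrier (end_ring G)" "h \<in> carrier (end_ring G)"
  then show "(f \<oplus>\<^bsub>end_ring G\<^esub> g) \<otimes>\<^bsub>end_ring G\<^esub> h
        = f \<otimes>\<^bsub>end_ring G\<^esub> h \<oplus>\<^bsub>end_ring G\<^esub> g \<otimes>\<^bsub>end_ring G\<^esub> h"
    "h \<otimes>\<^bsub>end_ring G\<^esub> (f \<oplus>\<^bsub>end_ring G\<^esub> g)
        = h \<otimes>\<^bsub>end_ring G\<^esub> f \<oplus>\<^bsub>end_ring G\<^esub> h \<otimes>\<^bsub>end_ring G\<^esub> g"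
    unfolding end_ring_mem by (auto simp: end_ring_simps compose_def Pi_def intro!: restrict_ext)
qed

end

text \<open>Anti-endomorphisms of \<open>R\<close> are homomorphisms into the opposite ring.\<close>

definition opposite_ring :: "('a, 'm) ring_scheme \<Rightarrow> 'a ring" where
  "opposite_ring R = \<lparr>carrier = carrier R, monoid.mult = (\<lambda>x y. y \<otimes>\<^bsub>R\<^esub> x), one = \<one>\<^bsub>R\<^esub>,
     ring.zero = \<zero>\<^bsub>R\<^esub>, add = add R\<rparr>"

lemma opposite_ring_simps:
  "carrier (opposite_ring R) = carrier R" "\<one>\<^bsub>opposite_ring R\<^esub> = \<one>\<^bsub>R\<^esub>"
  "\<zero>\<^bsub>opposite_ring R\<^esub> = \<zero>\<^bsub>R\<^esub>" "x \<oplus>\<^bsub>opposite_ring R\<^esub> y = x \<oplus>\<^bsub>R\<^esub> y"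
  "x \<otimes>\<^bsub>opposite_ring R\<^esub> y = y \<otimes>\<^bsub>R\<^esub> x" "\<ominus>\<^bsub>opposite_ring R\<^esub> x = \<ominus>\<^bsub>R\<^esub> x"
  by (simp_all add: opposite_ring_def a_inv_def m_inv_def)

lemma (in ring) opposite_ring_ring: "ring (opposite_ring R)"
proof (rule ringI)
  show "abelian_group (opposite_ring R)"
    by (rule abelian_groupI) (auto simp: opposite_ring_simps a_ac intro: add.l_inv_ex)
  show "Group.monoid (opposite_ring R)"
    by (rule monoidI) (auto simp: opposite_ring_simps m_assoc)
qed (auto simp: opposite_ring_simps l_distr r_distr)

text \<open>The triple \<open>(a, b, c)\<close> stands for the upper triangular matrix with diagonal \<open>a\<close>, \<open>c\<close> and
  corner \<open>b\<close>. A homomorphism \<open>f \<mapsto> (s f, d f, f)\<close> into this ring is a ring endomorphism \<open>s\<close>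
  together with a map \<open>d\<close> satisfying \<open>d (f g) = s f d g + d f g\<close>.\<close>

definition triangular_ring :: "('a, 'm) ring_scheme \<Rightarrow> ('a \<times> 'a \<times> 'a) ring" where
  "triangular_ring R = \<lparr>carrier = carrier R \<times> carrier R \<times> carrier R,
     monoid.mult = (\<lambda>(a, b, c) (a', b', c').
       (a \<otimes>\<^bsub>R\<^esub> a', a \<otimes>\<^bsub>R\<^esub> b' \<oplus>\<^bsub>R\<^esub> b \<otimes>\<^bsub>R\<^esub> c', c \<otimes>\<^bsub>R\<^esub> c')),
     one = (\<one>\<^bsub>R\<^esub>, \<zero>\<^bsub>R\<^esub>, \<one>\<^bsub>R\<^esub>),
     ring.zero = (\<zero>\<^bsub>R\<^esub>, \<zero>\<^bsub>R\<^esub>, \<zero>\<^bsub>R\<^esub>),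
     add = (\<lambda>(a, b, c) (a', b', c'). (a \<oplus>\<^bsub>R\<^esub> a', b \<oplus>\<^bsub>R\<^esub> b', c \<oplus>\<^bsub>R\<^esub> c'))\<rparr>"

lemma triangular_ring_simps:
  "carrier (triangular_ring R) = carrier R \<times> carrier R \<times> carrier R"
  "\<one>\<^bsub>triangular_ring R\<^esub> = (\<one>\<^bsub>R\<^esub>, \<zero>\<^bsub>R\<^esub>, \<one>\<^bsub>R\<^esub>)"
  "\<zero>\<^bsub>triangular_ring R\<^esub> = (\<zero>\<^bsub>R\<^esub>, \<zero>\<^bsub>R\<^esub>, \<zero>\<^bsub>R\<^esub>)"
  "(a, b, c) \<oplus>\<^bsub>triangular_ring R\<^esub> (a', b', c') = (a \<oplus>\<^bsub>R\<^esub> a', b \<oplus>\<^bsub>R\<^esub> b', c \<oplus>\<^bsub>R\<^esub> c')"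
  "(a, b, c) \<otimes>\<^bsub>triangular_ring R\<^esub> (a', b', c') =
     (a \<otimes>\<^bsub>R\<^esub> a', a \<otimes>\<^bsub>R\<^esub> b' \<oplus>\<^bsub>R\<^esub> b \<otimes>\<^bsub>R\<^esub> c', c \<otimes>\<^bsub>R\<^esub> c')"
  by (simp_all add: triangular_ring_def)

lemma (in ring) triangular_ring_ring: "ring (triangular_ring R)"
proof (rule ringI)
  show "abelian_group (triangular_ring R)"
  proof (rule abelian_groupI)
    fix x assume "x \<in> carrier (triangular_ring R)"
    then show "\<exists>y\<in>carrier (triangular_ring R). y \<oplus>\<^bsub>triangular_ring R\<^esub> x = \<zero>\<^bsub>triangular_ring R\<^esub>"
      by (intro bexI[of _ "(\<ominus> fst x, \<ominus> fst (snd x), \<ominus> snd (snd x))"])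
         (auto simp: triangular_ring_simps l_neg)
  qed (auto simp: triangular_ring_simps a_ac)
  show "Group.monoid (triangular_ring R)"
    by (rule monoidI) (auto simp: triangular_ring_simps ring_simprules)
qed (auto simp: triangular_ring_simps ring_simprules)

section \<open>The Weyl group of type D\<close>

text \<open>In terms of heights \<open>h\<close>, a simple reflection exchanges two adjacent values (and their
  negatives) and fixes all others. So it can change the sign of the sum of two values of distinct
  absolute position only if these two are the exchanged ones.\<close>

lemma swap_heights:
  fixes I N :: int and s h :: "int \<Rightarrow> int"
  assumes I: "1 \<le> I" "I < N"
    and s: "\<And>c. s c = (if c = I then I + 1 else if c = I + 1 then I
      else if c = - I then - I - 1 else if c = - I - 1 then - I else c)"
    and h: "\<And>c. h c = (if 0 < c then N - c else if c < 0 then - N - c else 0)"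
    and a: "1 \<le> \<bar>a\<bar>" "\<bar>a\<bar> \<le> N" and b: "1 \<le> \<bar>b\<bar>" "\<bar>b\<bar> \<le> N" and ab: "\<bar>a\<bar> \<noteq> \<bar>b\<bar>"
    and pos: "0 < h a + h b" "h (s a) + h (s b) \<le> 0"
  shows "(a = I \<and> b = - I - 1) \<or> (b = I \<and> a = - I - 1)"
proof -
  have vals: "s I = I + 1" "s (I + 1) = I" "s (- I) = - I - 1" "s (- I - 1) = - I"
    "h I = N - I" "h (I + 1) = N - I - 1" "h (- I) = I - N" "h (- I - 1) = I + 1 - N"
    using I by (simp_all add: s h)
  have cases: "c = I \<and> h c = N - I \<and> h (s c) = N - I - 1 \<or>
    c = I + 1 \<and> h c = N - I - 1 \<and> h (s c) = N - I \<or>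
    c = - I \<and> h c = I - N \<and> h (s c) = I + 1 - N \<or>
    c = - I - 1 \<and> h c = I + 1 - N \<and> h (s c) = I - N \<or>
    h (s c) = h c \<and> (N - I < h c \<or> \<bar>h c\<bar> < N - I - 1 \<or> h c < I - N)"
    if c: "1 \<le> \<bar>c\<bar>" "\<bar>c\<bar> \<le> N" for c
  proof (cases "c = I \<or> c = I + 1 \<or> c = - I \<or> c = - I - 1")
    case True
    then show ?thesis using vals by metis
  next
    case False
    then have "s c = c" by (simp add: s)
    moreover have "h c = N - c \<and> c > 0 \<or> h c = - N - c \<and> c < 0" using c by (auto simp: h)
    then have "N - I < h c \<or> \<bar>h c\<bar> < N - I - 1 \<or> h c < I - N"
      using False c I by arith
    ultimately show ?thesis by simp
  qed
  show ?thesis using cases[OF a] cases[OF b] ab pos I by (smt (verit))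
qed

text \<open>The last simple reflection exchanges the heights \<open>1\<close> and \<open>0\<close> with \<open>0\<close> and \<open>- 1\<close>, again without
  moving any others.\<close>

lemma last_swap_heights:
  fixes N :: int and s h :: "int \<Rightarrow> int"
  assumes N: "2 \<le> N"
    and s: "\<And>c. s c = (if c = N - 1 then - N else if c = - N then N - 1
      else if c = 1 - N then N else if c = N then 1 - N else c)"
    and h: "\<And>c. h c = (if 0 < c then N - c else if c < 0 then - N - c else 0)"
    and a: "1 \<le> \<bar>a\<bar>" "\<bar>a\<bar> \<le> N" and b: "1 \<le> \<bar>b\<bar>" "\<bar>b\<bar> \<le> N" and ab: "\<bar>a\<bar> \<noteq> \<bar>b\<bar>"
    and pos: "0 < h a + h b" "h (s a) + h (s b) \<le> 0"
  shows "(a = N - 1 \<and> b = N) \<or> (b = N - 1 \<and> a = N)"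
proof -
  have vals: "s (N - 1) = - N" "s (- N) = N - 1" "s (1 - N) = N" "s N = 1 - N"
    "h (N - 1) = 1" "h (- N) = 0" "h (1 - N) = -1" "h N = 0"
    using N by (simp_all add: s h)
  have cases: "c = N - 1 \<and> h c = 1 \<and> h (s c) = 0 \<or> c = - N \<and> h c = 0 \<and> h (s c) = 1 \<or>
    c = 1 - N \<and> h c = - 1 \<and> h (s c) = 0 \<or> c = N \<and> h c = 0 \<and> h (s c) = - 1 \<or>
    h (s c) = h c \<and> (1 < h c \<or> h c < - 1)"
    if c: "1 \<le> \<bar>c\<bar>" "\<bar>c\<bar> \<le> N" for c
  proof (cases "c = N - 1 \<or> c = - N \<or> c = 1 - N \<or> c = N")
    case True
    then show ?thesis using vals by metis
  next
    case False
    then have "s c = c" by (simp add: s)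
    moreover have "h c = N - c \<and> c > 0 \<or> h c = - N - c \<and> c < 0" using c by (auto simp: h)
    then have "1 < h c \<or> h c < - 1" using False c N by arith
    ultimately show ?thesis by simp
  qed
  show ?thesis using cases[OF a] cases[OF b] ab pos N by (smt (verit))
qed
locale type_D =
  fixes n :: nat
  assumes n_ge_2: "n \<ge> 2"
begin

abbreviation "s \<equiv> simple_refl n"
abbreviation "wp \<equiv> word_prod n"

lemma s_lt:
  assumes "1 \<le> i" "i < n"
  shows "s i a = (if a = int i then int i + 1 else if a = int i + 1 then int i
    else if a = - int i then - int i - 1 else if a = - int i - 1 then - int i else a)"
proof -
  have "s i a = transpose (int i) (int i + 1) (transpose (- int i) (- (int i + 1)) a)"
    using assms by (simp only: simple_refl_def if_True comp_apply)
  then show ?thesis using assms unfolding transpose_def by (smt (z3) of_nat_1 of_nat_le_iff)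
qed

lemma s_n: "s n a = (if a = int n - 1 then - int n else if a = - int n then int n - 1
    else if a = 1 - int n then int n else if a = int n then 1 - int n else a)"
proof -
  have "s n a = transpose (int n - 1) (- int n) (transpose (- (int n - 1)) (int n) a)"
    by (simp only: simple_refl_def less_irrefl if_False comp_apply)
  moreover have "2 \<le> int n" using n_ge_2 by simp
  ultimately show ?thesis unfolding transpose_def by (smt (z3))
qed

lemma letter_cases: "i \<in> {1..n} \<Longrightarrow> (1 \<le> i \<and> i < n) \<or> i = n" by auto

lemma s_s: "i \<in> {1..n} \<Longrightarrow> s i (s i a) = a"
  and s_odd: "i \<in> {1..n} \<Longrightarrow> s i (- a) = - s i a"
proof -
  assume i: "i \<in> {1..n}"
  have n2: "2 \<le> int n" using n_ge_2 by simp
  from letter_cases[OF i] have "s i (s i a) = a \<and> s i (- a) = - s i a"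
  proof
    assume i: "1 \<le> i \<and> i < n"
    then have "1 \<le> int i" by auto
    then show ?thesis by (simp only: s_lt[OF conjunct1[OF i] conjunct2[OF i]]) (smt (z3))
  next
    assume "i = n"
    with n2 show ?thesis by (simp only: s_n) (smt (z3))
  qed
  then show "s i (s i a) = a" "s i (- a) = - s i a" by blast+
qed

lemma s_comp_s: "i \<in> {1..n} \<Longrightarrow> s i \<circ> s i = id"
  by (rule ext) (simp add: s_s)

lemma bij_s: "i \<in> {1..n} \<Longrightarrow> bij (s i)"
  by (rule o_bij[of "s i"]) (auto simp: s_comp_s)

lemma wp_Nil [simp]: "wp [] = id" by (simp add: word_prod_def)
lemma wp_Cons [simp]: "wp (i # is) = s i \<circ> wp is" by (simp add: word_prod_def)

lemma wp_append [simp]: "wp (is @ js) = wp is \<circ> wp js"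
  by (induction "is") (auto simp: comp_assoc)

lemma wp_rev: "set is \<subseteq> {1..n} \<Longrightarrow> wp (rev is) \<circ> wp is = id \<and> wp is \<circ> wp (rev is) = id"
proof (induction "is")
  case (Cons i "is")
  then have set: "set is \<subseteq> {1..n}" and "i \<in> {1..n}" by auto
  from Cons.IH[OF set] have IH: "wp (rev is) \<circ> wp is = id" "wp is \<circ> wp (rev is) = id" by blast+
  have i: "s i \<circ> s i = id" by (rule s_comp_s) fact
  have "wp (rev (i # is)) \<circ> wp (i # is) = wp (rev is) \<circ> (s i \<circ> s i) \<circ> wp is"
    "wp (i # is) \<circ> wp (rev (i # is)) = s i \<circ> (wp is \<circ> wp (rev is)) \<circ> s i"
    by (simp_all only: rev.simps wp_append wp_Cons wp_Nil comp_id comp_assoc)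
  then show ?case by (simp only: IH i comp_id id_comp)
qed auto

lemma wp_bij: "set is \<subseteq> {1..n} \<Longrightarrow> bij (wp is)"
  using wp_rev[of "is"] by (blast intro: o_bij)

lemma wp_odd: "set is \<subseteq> {1..n} \<Longrightarrow> wp is (- a) = - wp is a"
  by (induction "is") (auto simp: s_odd)

lemma wp_inv: "set is \<subseteq> {1..n} \<Longrightarrow> inv_into UNIV (wp is) = wp (rev is)"
  using wp_rev by (blast intro: inv_unique_comp)

text \<open>The value at \<open>e\<^sub>a\<close>, where \<open>e\<^bsub>-a\<^esub> = - e\<^sub>a\<close>, of the linear functional that equals \<open>1\<close> on every simple
  root. The root \<open>e\<^sub>a + e\<^sub>b\<close> is represented by the pair \<open>a\<close>, \<open>b\<close> of signed indices; it is positive iff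
  the functional is positive on it.\<close>

definition height :: "int \<Rightarrow> int" where "height a = sgn a * (int n - \<bar>a\<bar>)"

definition is_root :: "int \<Rightarrow> int \<Rightarrow> bool" where
  "is_root a b \<longleftrightarrow> 1 \<le> \<bar>a\<bar> \<and> \<bar>a\<bar> \<le> int n \<and> 1 \<le> \<bar>b\<bar> \<and> \<bar>b\<bar> \<le> int n \<and> \<bar>a\<bar> \<noteq> \<bar>b\<bar>"

definition pos :: "int \<Rightarrow> int \<Rightarrow> bool" where "pos a b \<longleftrightarrow> height a + height b > 0"

text \<open>The simple roots \<open>e\<^sub>i - e\<^bsub>i+1\<^esub>\<close> and \<open>e\<^bsub>n-1\<^esub> + e\<^sub>n\<close> as pairs of signed indices.\<close>

definition \<alpha> :: "nat \<Rightarrow> int \<times> int" where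
  "\<alpha> i = (if i < n then (int i, - (int i + 1)) else (int n - 1, int n))"

text \<open>The reflection in \<open>e\<^sub>a + e\<^sub>b\<close> maps \<open>a\<close> to \<open>- b\<close> and \<open>b\<close> to \<open>- a\<close>.\<close>

definition reflection :: "int \<Rightarrow> int \<Rightarrow> int \<Rightarrow> int" where
  "reflection a b = transpose a (- b) \<circ> transpose (- a) b"

lemma s_reflection: "s i = reflection (fst (\<alpha> i)) (snd (\<alpha> i))"
  by (simp add: reflection_def \<alpha>_def simple_refl_def add.commute)

lemma reflection_sym: "is_root a b \<Longrightarrow> reflection a b = reflection b a"
  unfolding reflection_def is_root_def fun_eq_iff comp_apply transpose_def by (smt (verit))

lemma reflection_conj:
  assumes "bij f" "\<And>c. f (- c) = - f c"
  shows "f \<circ> reflection a b = reflection (f a) (f b) \<circ> f"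
proof
  fix z
  have "inj f" using assms(1) by (rule bij_is_inj)
  then have swap: "f (transpose c d z) = transpose (f c) (f d) (f z)" for c d z
    by (auto simp: transpose_def inj_eq)
  show "(f \<circ> reflection a b) z = (reflection (f a) (f b) \<circ> f) z"
    by (simp add: reflection_def swap assms(2))
qed

lemma \<alpha>_root: "i \<in> {1..n} \<Longrightarrow> is_root (fst (\<alpha> i)) (snd (\<alpha> i))"
  using n_ge_2 by (auto simp: \<alpha>_def is_root_def)

lemma \<alpha>_pos: "i \<in> {1..n} \<Longrightarrow> pos (fst (\<alpha> i)) (snd (\<alpha> i))"
  using n_ge_2 by (auto simp: \<alpha>_def pos_def height_def)

lemma height_odd: "height (- a) = - height a" by (simp add: height_def)

lemma height_if: "height a = (if 0 < a then int n - a else if a < 0 then - int n - a else 0)"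
  by (simp add: height_def)

lemma pos_or_neg: "is_root a b \<Longrightarrow> pos a b \<noteq> pos (- a) (- b)"
  unfolding is_root_def pos_def height_if by (smt (verit))

text \<open>On absolute values the last simple reflection acts like the one before it.\<close>

lemma abs_s:
  assumes "i \<in> {1..n}"
  shows "\<bar>s i c\<bar> = transpose (int (min i (n - 1))) (int (min i (n - 1)) + 1) \<bar>c\<bar>"
  using letter_cases[OF assms]
proof
  assume i: "1 \<le> i \<and> i < n"
  then have "min i (n - 1) = i" by linarith
  then show ?thesis
    unfolding transpose_def s_lt[OF conjunct1[OF i] conjunct2[OF i]] using i by auto
next
  assume i: "i = n"
  then have "int (min i (n - 1)) = int n - 1" using n_ge_2 by linarith
  then show ?thesis unfolding transpose_def i s_n using n_ge_2 by auto
qed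

lemma s_root:
  assumes i: "i \<in> {1..n}" and "is_root a b"
  shows "is_root (s i a) (s i b)"
proof -
  let ?k = "int (min i (n - 1))"
  have k: "1 \<le> ?k" "?k + 1 \<le> int n" using i n_ge_2 by (auto simp: min_def)
  have "1 \<le> transpose ?k (?k + 1) x \<and> transpose ?k (?k + 1) x \<le> int n" if "1 \<le> x" "x \<le> int n" for x
    using that k by (simp add: transpose_def)
  then show ?thesis using assms(2) unfolding is_root_def abs_s[OF i] by (metis transpose_eq_iff)
qed

lemma wp_root: "set is \<subseteq> {1..n} \<Longrightarrow> is_root a b \<Longrightarrow> is_root (wp is a) (wp is b)"
  by (induction "is") (auto simp: s_root)

text \<open>A simple reflection permutes the positive roots other than its own simple root. This is the
  only property of the root system on which the exchange condition rests.\<close>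

lemma s_pos:
  assumes i: "i \<in> {1..n}" and root: "is_root a b" and pos: "pos a b" and neg: "\<not> pos (s i a) (s i b)"
  shows "(a, b) = \<alpha> i \<or> (b, a) = \<alpha> i"
  using letter_cases[OF i]
proof
  note hyps = root[unfolded is_root_def] pos[unfolded pos_def] neg[unfolded pos_def not_less]
  assume i: "1 \<le> i \<and> i < n"
  then have "1 \<le> int i" "int i < int n" by auto
  from swap_heights[OF this s_lt[OF conjunct1[OF i] conjunct2[OF i]] height_if] hyps
  have "(a = int i \<and> b = - int i - 1) \<or> (b = int i \<and> a = - int i - 1)" by blast
  then show ?thesis using i by (auto simp: \<alpha>_def)
next
  note hyps = root[unfolded is_root_def] pos[unfolded pos_def] neg[unfolded pos_def not_less]
  assume i: "i = n"
  have "2 \<le> int n" using n_ge_2 by simp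
  from last_swap_heights[OF this s_n height_if] hyps
  have "(a = int n - 1 \<and> b = int n) \<or> (b = int n - 1 \<and> a = int n)" unfolding i by blast
  then show ?thesis using i by (auto simp: \<alpha>_def)
qed

text \<open>Applying the letters of the word one by one, from the right, the root turns negative at some
  letter \<open>j\<close>. Just before, it is the simple root of \<open>j\<close> by \<open>s_pos\<close>; conjugating the reflection
  through the letters \<open>vs\<close> therefore turns it into the letter \<open>j\<close>, which cancels.\<close>

lemma exchange_root:
  assumes "set is \<subseteq> {1..n}" "is_root a b" "pos a b" "\<not> pos (wp is a) (wp is b)"
  shows "\<exists>us j vs. is = us @ j # vs \<and> wp is \<circ> reflection a b = wp (us @ vs)"
  using assms(1,4)
proof (induction "is")
  case (Cons i "is")
  then have i: "i \<in> {1..n}" and is_set: "set is \<subseteq> {1..n}" by auto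
  show ?case
  proof (cases "pos (wp is a) (wp is b)")
    case False
    then obtain us j vs where "is = us @ j # vs" "wp is \<circ> reflection a b = wp (us @ vs)"
      using Cons.IH[OF is_set] by blast
    then have "i # is = (i # us) @ j # vs"
      "wp (i # is) \<circ> reflection a b = wp ((i # us) @ vs)"
      by (simp_all add: comp_assoc)
    then show ?thesis by blast
  next
    case True
    note root = wp_root[OF is_set assms(2)]
    have "(wp is a, wp is b) = \<alpha> i \<or> (wp is b, wp is a) = \<alpha> i"
      using s_pos[OF i root True] Cons.prems by simp
    then have "reflection (wp is a) (wp is b) = s i"
      using s_reflection[of i] reflection_sym[OF root] by (auto simp: prod_eq_iff)
    then have "wp is \<circ> reflection a b = s i \<circ> wp is"
      using reflection_conj[OF wp_bij[OF is_set] wp_odd[OF is_set]] by simp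
    then have "wp (i # is) \<circ> reflection a b = (s i \<circ> s i) \<circ> wp is"
      by (simp add: comp_assoc)
    then have "wp (i # is) \<circ> reflection a b = wp ([] @ is)"
      by (simp add: s_comp_s[OF i])
    then show ?thesis by blast
  qed
qed (use assms(3) in simp)

text \<open>A right descent of the group element: the simple root is sent to a negative root.\<close>

definition descent :: "nat list \<Rightarrow> nat \<Rightarrow> bool" where
  "descent is t \<longleftrightarrow> \<not> pos (wp is (fst (\<alpha> t))) (wp is (snd (\<alpha> t)))"

lemma exchange:
  assumes "set is \<subseteq> {1..n}" "t \<in> {1..n}" "descent is t"
  shows "\<exists>us j vs. is = us @ j # vs \<and> wp (is @ [t]) = wp (us @ vs)"
  using exchange_root[OF assms(1) \<alpha>_root[OF assms(2)] \<alpha>_pos[OF assms(2)]] assms(3)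
  by (simp add: descent_def s_reflection)

lemma s_\<alpha>: "i \<in> {1..n} \<Longrightarrow> s i (fst (\<alpha> i)) = - snd (\<alpha> i) \<and> s i (snd (\<alpha> i)) = - fst (\<alpha> i)"
  using letter_cases[of i] n_ge_2 by (auto simp: \<alpha>_def s_lt s_n)

lemma descent_snoc:
  assumes "set is \<subseteq> {1..n}" "t \<in> {1..n}"
  shows "descent (is @ [t]) t \<longleftrightarrow> \<not> descent is t"
proof -
  have "is_root (wp is (snd (\<alpha> t))) (wp is (fst (\<alpha> t)))"
    using wp_root[OF assms(1) \<alpha>_root[OF assms(2)]] by (auto simp: is_root_def)
  from pos_or_neg[OF this] show ?thesis
    by (simp add: descent_def s_\<alpha>[OF assms(2)] wp_odd[OF assms(1)] pos_def add.commute)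
qed

lemma descent_cong: "wp is = wp js \<Longrightarrow> descent is t = descent js t"
  by (simp add: descent_def)

definition reduced :: "nat list \<Rightarrow> bool" where
  "reduced is \<longleftrightarrow> set is \<subseteq> {1..n} \<and>
     (\<forall>js. set js \<subseteq> {1..n} \<and> wp js = wp is \<longrightarrow> length is \<le> length js)"

lemma reduced_letters: "reduced is \<Longrightarrow> set is \<subseteq> {1..n}" by (simp add: reduced_def)

lemma reduced_le:
  "reduced is \<Longrightarrow> set js \<subseteq> {1..n} \<Longrightarrow> wp js = wp is \<Longrightarrow> length is \<le> length js"
  by (simp add: reduced_def)

lemma reduced_expr_iff: "reduced_expr n w is \<longleftrightarrow> reduced is \<and> wp is = w"
  by (auto simp: reduced_expr_def reduced_def)

lemma reduced_exists:
  assumes "set is \<subseteq> {1..n}" shows "\<exists>js. reduced js \<and> wp js = wp is"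
proof -
  have "\<exists>js. (set js \<subseteq> {1..n} \<and> wp js = wp is) \<and>
      (\<forall>ks. set ks \<subseteq> {1..n} \<and> wp ks = wp is \<longrightarrow> length js \<le> length ks)"
    using assms by (intro ex_has_least_nat[of _ "is"]) simp
  then show ?thesis unfolding reduced_def by force
qed

lemma reduced_length_eq: "reduced is \<Longrightarrow> reduced js \<Longrightarrow> wp is = wp js \<Longrightarrow> length is = length js"
  by (simp add: reduced_def le_antisym)

lemma reduced_cong:
  "reduced is \<Longrightarrow> set js \<subseteq> {1..n} \<Longrightarrow> wp js = wp is \<Longrightarrow> length js = length is \<Longrightarrow> reduced js"
  by (simp add: reduced_def)

lemma reduced_append1:
  assumes "reduced (us @ vs)" shows "reduced us"
  unfolding reduced_def
proof (intro conjI allI impI)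
  show "set us \<subseteq> {1..n}" using reduced_letters[OF assms] by auto
  fix js assume js: "set js \<subseteq> {1..n} \<and> wp js = wp us"
  have "length (us @ vs) \<le> length (js @ vs)"
    using js reduced_letters[OF assms] by (intro reduced_le[OF assms]) auto
  then show "length us \<le> length js" by simp
qed

lemma wp_snoc_cancel: "t \<in> {1..n} \<Longrightarrow> wp (is @ [t]) = wp (js @ [t]) \<Longrightarrow> wp is = wp js"
  by (metis bij_s bij_is_surj wp_append wp_Cons wp_Nil comp_id surj_fun_eq)

text \<open>If \<open>t\<close> is a descent, the exchange condition shortens the word. If not, then \<open>t\<close> is a descent of
  the longer element, and the exchange condition applied there bounds its length from below.\<close>

lemma reduced_snoc_iff:
  assumes red: "reduced is" and t: "t \<in> {1..n}"
  shows "reduced (is @ [t]) \<longleftrightarrow> \<not> descent is t"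
proof
  note is_set = reduced_letters[OF red]
  assume "reduced (is @ [t])"
  show "\<not> descent is t"
  proof
    assume "descent is t"
    then obtain us j vs where "is = us @ j # vs" "wp (is @ [t]) = wp (us @ vs)"
      using exchange[OF is_set t] by blast
    then show False
      using reduced_le[OF \<open>reduced (is @ [t])\<close>, of "us @ vs"] is_set by simp
  qed
next
  note is_set = reduced_letters[OF red]
  assume nd: "\<not> descent is t"
  obtain js where js: "reduced js" "wp js = wp (is @ [t])"
    using reduced_exists[of "is @ [t]"] is_set t by auto
  then have "descent js t"
    using nd descent_snoc[OF is_set t] descent_cong[OF js(2)] by simp
  then obtain us j vs where ex: "js = us @ j # vs" "wp (js @ [t]) = wp (us @ vs)"
    using exchange[OF reduced_letters[OF js(1)] t] by blast
  have "wp (js @ [t]) = wp (is @ [t] @ [t])" using js(2) by (simp only: wp_append comp_assoc)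
  then have "wp (us @ vs) = wp is" using ex(2) s_comp_s[OF t] by (simp add: comp_assoc)
  then have "length is \<le> length (us @ vs)"
    using reduced_letters[OF js(1)] ex(1) by (intro reduced_le[OF red]) auto
  then have "length (is @ [t]) \<le> length js" using ex(1) by simp
  then show "reduced (is @ [t])"
    using js is_set t unfolding reduced_def by auto
qed

definition wlen :: "(int \<Rightarrow> int) \<Rightarrow> nat" where
  "wlen w = length (SOME is. reduced is \<and> wp is = w)"

lemma wlen_eq: assumes "reduced is" shows "wlen (wp is) = length is"
proof -
  have "reduced (SOME js. reduced js \<and> wp js = wp is) \<and> wp (SOME js. reduced js \<and> wp js = wp is) = wp is"
    by (rule someI[where x = "is"]) (use assms in simp)
  then show ?thesis using reduced_length_eq[OF _ assms] by (simp add: wlen_def)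
qed

lemma wlen_snoc:
  assumes "set is \<subseteq> {1..n}" and t: "t \<in> {1..n}"
  shows "if descent is t then wlen (wp is) = Suc (wlen (wp (is @ [t])))
         else wlen (wp (is @ [t])) = Suc (wlen (wp is))"
proof -
  have up: "wlen (wp (is @ [t])) = Suc (wlen (wp is))"
    if set: "set is \<subseteq> {1..n}" and nd: "\<not> descent is t" for "is"
  proof -
    obtain js where js: "reduced js" "wp js = wp is" using reduced_exists[OF set] by blast
    then have "reduced (js @ [t])"
      using nd descent_cong[OF js(2)] by (simp add: reduced_snoc_iff[OF js(1) t])
    from wlen_eq[OF this] wlen_eq[OF js(1)] js(2) show ?thesis by simp
  qed
  show ?thesis
  proof (cases "descent is t")
    case True
    then have "\<not> descent (is @ [t]) t" using descent_snoc[OF assms] by simp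
    then have "wlen (wp ((is @ [t]) @ [t])) = Suc (wlen (wp (is @ [t])))"
      using assms by (intro up) auto
    moreover have "wp ((is @ [t]) @ [t]) = wp is"
      using s_comp_s[OF t] by (simp add: comp_assoc)
    ultimately show ?thesis using True by simp
  qed (use up[OF assms(1)] in simp)
qed

lemma reduced_rev: assumes "reduced is" shows "reduced (rev is)"
  unfolding reduced_def
proof safe
  show "x \<in> {1..n}" if "x \<in> set (rev is)" for x using that reduced_letters[OF assms] by auto
  fix js assume js: "set js \<subseteq> {1..n}" "wp js = wp (rev is)"
  have "wp (rev js) = wp is"
    using wp_inv[OF js(1)] wp_inv[of "rev is"] reduced_letters[OF assms] js(2) by simp
  then have "length is \<le> length (rev js)" using js(1) by (intro reduced_le[OF assms]) auto
  then show "length (rev is) \<le> length js" by simp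
qed

lemma wlen_rev: assumes "set is \<subseteq> {1..n}" shows "wlen (wp (rev is)) = wlen (wp is)"
proof -
  obtain js where js: "reduced js" "wp js = wp is" using reduced_exists[OF assms] by blast
  have "wp (rev js) = wp (rev is)"
    using js wp_inv[OF assms] wp_inv[OF reduced_letters[OF js(1)]] by simp
  then show ?thesis using wlen_eq[OF js(1)] wlen_eq[OF reduced_rev[OF js(1)]] js(2) by simp
qed

text \<open>The element \<open>w0\<close> reverses all signs, so each letter appended to \<open>is\<close> is a descent on exactly one
  of the two sides. Each step thus raises one of the two lengths by one and lowers the other, and the
  sum keeps the value that it has for the empty word.\<close>

lemma length_complement:
  assumes w0: "set w0 \<subseteq> {1..n}" "\<And>a. 1 \<le> \<bar>a\<bar> \<Longrightarrow> \<bar>a\<bar> \<le> int n \<Longrightarrow> height (wp w0 a) = - height a"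
    and "set is \<subseteq> {1..n}"
  shows "wlen (wp is) + wlen (wp (rev w0 @ is)) = wlen (wp w0)"
  using assms(3)
proof (induction "is" rule: rev_induct)
  case Nil
  have "reduced []" by (simp add: reduced_def)
  from wlen_eq[OF this] show ?case using wlen_rev[OF w0(1)] by (simp add: id_def)
next
  case (snoc t "is")
  then have t: "t \<in> {1..n}" and set: "set is \<subseteq> {1..n}" and set': "set (rev w0 @ is) \<subseteq> {1..n}"
    using w0(1) by auto
  have "height (wp (rev w0) b) = - height b" if b: "1 \<le> \<bar>b\<bar>" "\<bar>b\<bar> \<le> int n" for b
  proof -
    have "is_root b (if \<bar>b\<bar> = 1 then 2 else 1)" using b n_ge_2 by (auto simp: is_root_def)
    from wp_root[OF _ this, of "rev w0"] w0(1)
    have "1 \<le> \<bar>wp (rev w0) b\<bar>" "\<bar>wp (rev w0) b\<bar> \<le> int n" by (auto simp: is_root_def)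
    from w0(2)[OF this] wp_rev[OF w0(1)] show ?thesis
      by (metis comp_apply id_apply minus_minus)
  qed
  then have "pos (wp (rev w0) a) (wp (rev w0) b) \<longleftrightarrow> \<not> pos a b" if "is_root a b" for a b
    using pos_or_neg[OF that] that by (simp add: is_root_def pos_def height_odd)
  then have "descent (rev w0 @ is) t \<longleftrightarrow> \<not> descent is t"
    using wp_root[OF set \<alpha>_root[OF t]] by (simp add: descent_def)
  then show ?case
    using wlen_snoc[OF set t] wlen_snoc[OF set' t] snoc.IH[OF set]
    by (auto simp del: wp_append split: if_splits)
qed

text \<open>Any \<open>js @ us\<close> that is reduced with \<open>js\<close> at least as long as \<open>is\<close> has at least the length of
  \<open>w0\<close>. By \<open>length_complement\<close> it differs from \<open>w0\<close> by an element of length zero.\<close>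

lemma complement_word:
  assumes w0: "set w0 \<subseteq> {1..n}" "\<And>a. 1 \<le> \<bar>a\<bar> \<Longrightarrow> \<bar>a\<bar> \<le> int n \<Longrightarrow> height (wp w0 a) = - height a"
    and red: "reduced is"
  obtains us where "reduced us" "wp (is @ us) = wp w0" "reduced (is @ us)"
    "\<And>js. reduced (js @ us) \<Longrightarrow> length is \<le> length js \<Longrightarrow> wp js = wp is"
proof -
  note compl = length_complement[OF w0(1), OF w0(2)]
  have set: "set is \<subseteq> {1..n}" "set (rev is @ w0) \<subseteq> {1..n}"
    using reduced_letters[OF red] w0(1) by auto
  obtain us where us: "reduced us" "wp us = wp (rev is @ w0)" using reduced_exists[OF set(2)] by blast
  have prod: "wp (is @ us) = wp w0"
    using wp_rev[OF set(1)] us(2) by (simp add: comp_assoc[symmetric])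
  have "wlen (wp (rev w0 @ is)) = wlen (wp (rev is @ w0))"
    using wlen_rev[OF set(2)] by simp
  then have len: "length is + length us = wlen (wp w0)"
    using compl[OF _ _ set(1)] wlen_eq[OF red] wlen_eq[OF us(1)] us(2) by simp
  have "length (is @ us) \<le> length js" if "set js \<subseteq> {1..n}" "wp js = wp (is @ us)" for js
  proof -
    obtain ks where ks: "reduced ks" "wp ks = wp js" using reduced_exists[OF \<open>set js \<subseteq> {1..n}\<close>] by blast
    have "length ks \<le> length js" using ks that(1) by (simp add: reduced_def)
    moreover have "length ks = wlen (wp w0)" using wlen_eq[OF ks(1)] ks(2) that(2) prod by simp
    ultimately show ?thesis using len by simp
  qed
  then have red_app: "reduced (is @ us)"
    using set(1) reduced_letters[OF us(1)] by (auto simp: reduced_def)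
  have "wp js = wp is" if js: "reduced (js @ us)" "length is \<le> length js" for js
  proof -
    have set_js: "set (js @ us) \<subseteq> {1..n}" using reduced_letters[OF js(1)] .
    have "wlen (wp (rev w0 @ js @ us)) = 0"
      using compl[OF _ _ set_js] wlen_eq[OF js(1)] js(2) len by simp
    moreover have "set (rev w0 @ js @ us) \<subseteq> {1..n}" using set_js w0(1) by auto
    ultimately have "wp (rev w0 @ js @ us) = id"
      using reduced_exists[of "rev w0 @ js @ us"] wlen_eq by (metis length_0_conv wp_Nil)
    then have "wp w0 \<circ> wp (rev w0) \<circ> wp (js @ us) = wp w0" by (simp add: comp_assoc)
    then have "wp (js @ us) = wp (is @ us)" using wp_rev[OF w0(1)] prod by simp
    then have "wp js \<circ> wp us \<circ> wp (rev us) = wp is \<circ> wp us \<circ> wp (rev us)" by simp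
    then show ?thesis using wp_rev[OF reduced_letters[OF us(1)]] by (simp only: comp_assoc comp_id)
  qed
  then show ?thesis using that[OF us(1) prod red_app] by blast
qed

text \<open>The word \<open>block m\<close> is palindromic except for its two commuting middle letters; with
  \<open>k = n - 1 - m\<close> it represents the element that changes the signs of \<open>e\<^sub>k\<close> and \<open>e\<^sub>n\<close>.\<close>

fun block :: "nat \<Rightarrow> nat list" where
  "block 0 = [n - 1, n]"
| "block (Suc m) = (n - 2 - m) # block m @ [n - 2 - m]"

fun longest_word :: "nat \<Rightarrow> nat list" where
  "longest_word 0 = block 0"
| "longest_word (Suc m) = block (Suc m) @ longest_word m"

lemma block_letters: "m \<le> n - 2 \<Longrightarrow> set (block m) \<subseteq> {n - 1 - m..n}"
  using n_ge_2 by (induction m) fastforce+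

lemma longest_word_letters: "m \<le> n - 2 \<Longrightarrow> set (longest_word m) \<subseteq> {n - 1 - m..n}"
proof (induction m)
  case 0 then show ?case using block_letters[of 0] by simp
next
  case (Suc m)
  then show ?case using block_letters[of "Suc m"] by fastforce
qed

lemma wp_block:
  "m \<le> n - 2 \<Longrightarrow> wp (block m) a = (if \<bar>a\<bar> = int (n - 1 - m) \<or> \<bar>a\<bar> = int n then - a else a)"
proof (induction m arbitrary: a)
  case 0
  show ?case using n_ge_2 by (auto simp: s_lt s_n)
next
  case (Suc m)
  define K where "K = n - 2 - m"
  have K: "1 \<le> K" "K < n" "int (n - 1 - m) = int K + 1" "int (n - 1 - Suc m) = int K" "int K + 1 < int n"
    using Suc.prems by (auto simp: K_def)
  have IH: "wp (block m) b = (if \<bar>b\<bar> = int K + 1 \<or> \<bar>b\<bar> = int n then - b else b)" for b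
    using Suc K(3) by simp
  have step: "wp (block (Suc m)) b = s K (wp (block m) (s K b))" for b
    by (simp add: K_def)
  have vals: "s K (int K) = int K + 1" "s K (int K + 1) = int K" "s K (1 + int K) = int K"
    "s K (- int K) = - int K - 1" "s K (- int K - 1) = - int K"
    using K(1,2) by (simp_all add: s_lt)
  have other: "s K b = b" if "\<bar>b\<bar> \<noteq> int K" "\<bar>b\<bar> \<noteq> int K + 1" for b
    using that K(1,2) by (auto simp: s_lt)
  consider "a = int K" | "a = int K + 1" | "a = - int K" | "a = - int K - 1"
    | "\<bar>a\<bar> \<noteq> int K" "\<bar>a\<bar> \<noteq> int K + 1" by linarith
  then have "wp (block (Suc m)) a = (if \<bar>a\<bar> = int K \<or> \<bar>a\<bar> = int n then - a else a)"
  proof cases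
    case 5
    then show ?thesis unfolding step other[OF 5] IH using other[of a] other[of "- a"] K(5) by auto
  qed (use K vals IH in \<open>simp_all add: step del: block.simps\<close>)
  then show ?case by (simp only: K(4))
qed

lemma wp_longest:
  "m \<le> n - 2 \<Longrightarrow> \<bar>wp (longest_word m) a\<bar> = \<bar>a\<bar> \<and>
     (\<bar>a\<bar> < int (n - 1 - m) \<longrightarrow> wp (longest_word m) a = a) \<and>
     (int (n - 1 - m) \<le> \<bar>a\<bar> \<and> \<bar>a\<bar> < int n \<longrightarrow> wp (longest_word m) a = - a)"
proof (induction m)
  case 0
  show ?case using n_ge_2 wp_block[of 0 a] by (auto simp del: block.simps)
next
  case (Suc m)
  have k: "int (n - Suc m) = int n - 1 - int m" "int (n - Suc (Suc m)) = int n - 2 - int m"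
    using Suc.prems by auto
  have IH: "\<bar>wp (longest_word m) a\<bar> = \<bar>a\<bar>"
     "\<bar>a\<bar> < int n - 1 - int m \<Longrightarrow> wp (longest_word m) a = a"
     "int n - 1 - int m \<le> \<bar>a\<bar> \<Longrightarrow> \<bar>a\<bar> < int n \<Longrightarrow> wp (longest_word m) a = - a"
    using Suc by (auto simp: k)
  show ?case
    using IH wp_block[OF Suc.prems, of "wp (longest_word m) a"]
    by (auto simp: k simp del: block.simps)
qed

text \<open>The sign of \<open>e\<^sub>n\<close> may or may not change, depending on the parity of \<open>n\<close>, but its height is zero.\<close>

lemma longest_height:
  assumes "1 \<le> \<bar>a\<bar>" "\<bar>a\<bar> \<le> int n"
  shows "height (wp (longest_word (n - 2)) a) = - height a"
proof (cases "\<bar>a\<bar> < int n")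
  case True
  then have "wp (longest_word (n - 2)) a = - a"
    using wp_longest[of "n - 2" a] assms n_ge_2 by auto
  then show ?thesis by (simp add: height_odd)
next
  case False
  then show ?thesis using wp_longest[of "n - 2" a] assms by (simp add: height_def)
qed

text \<open>The edges of the Dynkin diagram; \<open>n\<close> is joined to \<open>n - 2\<close> only.\<close>

definition adjacent :: "nat \<Rightarrow> nat \<Rightarrow> bool" where
  "adjacent i j \<longleftrightarrow> i < n \<and> j < n \<and> (j = Suc i \<or> i = Suc j) \<or> i = n \<and> j + 2 = n \<or> j = n \<and> i + 2 = n"

text \<open>Writing one of two simple reflections as a reflection in its root reduces the commutation and
  braid relations to the effect of the other one on that root.\<close>

lemma s_conj:
  assumes "i \<in> {1..n}"
  shows "s i \<circ> s j = reflection (s i (fst (\<alpha> j))) (s i (snd (\<alpha> j))) \<circ> s i"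
  unfolding s_reflection[of j] by (rule reflection_conj[OF bij_s[OF assms] s_odd[OF assms]])

end

context type_D begin
lemma s_commute:
  assumes i: "i \<in> {1..n}" and j: "j \<in> {1..n}" and ij: "\<not> adjacent i j"
  shows "s i \<circ> s j = s j \<circ> s i"
proof -
  have fixed: "s i \<circ> s j = s j \<circ> s i"
    if "i \<in> {1..n}" "s i (fst (\<alpha> j)) = fst (\<alpha> j)" "s i (snd (\<alpha> j)) = snd (\<alpha> j)" for i j
    using s_conj[OF that(1), of j] that(2,3) s_reflection[of j] by simp
  have last: "s n \<circ> s (n - 1) = s (n - 1) \<circ> s n"
  proof -
    have m: "n - 1 \<in> {1..n}" "n \<in> {1..n}" using n_ge_2 by auto
    have "s n (fst (\<alpha> (n - 1))) = snd (\<alpha> (n - 1))" "s n (snd (\<alpha> (n - 1))) = fst (\<alpha> (n - 1))"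
      using n_ge_2 by (simp_all add: \<alpha>_def s_n of_nat_diff)
    then show ?thesis
      using s_conj[OF m(2), of "n - 1"] reflection_sym[OF \<alpha>_root[OF m(1)]] s_reflection[of "n - 1"] by simp
  qed
  have far: "s i \<circ> s j = s j \<circ> s i"
    if "i \<in> {1..n}" "j \<in> {1..n}" "i < n \<and> j < n \<and> Suc i < j" for i j
  proof (rule fixed)
    have ij: "1 \<le> i" "i < n" "j < n" "int i + 1 < int j" using that by auto
    have fixed: "s i a = a" if "int i + 1 < \<bar>a\<bar>" for a
      using that unfolding s_lt[OF ij(1,2)] by auto
    show "s i (fst (\<alpha> j)) = fst (\<alpha> j)" "s i (snd (\<alpha> j)) = snd (\<alpha> j)"
      using ij(3,4) by (intro fixed, simp add: \<alpha>_def)+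
  qed fact
  have far_n: "s n \<circ> s j = s j \<circ> s n" if "j \<in> {1..n}" "Suc (Suc j) < n" for j
  proof (rule fixed)
    have j: "1 \<le> int j" "int j + 2 < int n" "j < n" using that by auto
    have fixed: "s n a = a" if "\<bar>a\<bar> < int n - 1" for a using that unfolding s_n by auto
    show "s n (fst (\<alpha> j)) = fst (\<alpha> j)" "s n (snd (\<alpha> j)) = snd (\<alpha> j)"
      using j by (intro fixed, simp add: \<alpha>_def)+
  qed (use n_ge_2 in simp)
  show ?thesis
  proof (cases "i < n")
    case i_lt: True
    show ?thesis
    proof (cases "j < n")
      case True
      then have "i = j \<or> Suc i < j \<or> Suc j < i" using ij i_lt by (auto simp: adjacent_def)
      then show ?thesis using far[OF i j] far[OF j i] i_lt True by metis
    next
      case False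
      then have "j = n" using j by simp
      moreover from this have "i = n - 1 \<or> Suc (Suc i) < n" using ij i_lt by (auto simp: adjacent_def)
      ultimately show ?thesis using far_n[OF i] last by metis
    qed
  next
    case False
    then have "i = n" using i by simp
    moreover from this have "j = n \<or> j = n - 1 \<or> Suc (Suc j) < n" using ij j by (auto simp: adjacent_def)
    ultimately show ?thesis using far_n[OF j] last by metis
  qed
qed

lemma s_braid:
  assumes i: "i \<in> {1..n}" and j: "j \<in> {1..n}" and ij: "adjacent i j"
  shows "s i \<circ> s j \<circ> s i = s j \<circ> s i \<circ> s j" "s i \<circ> s j \<noteq> s j \<circ> s i"
proof -
  have conj: "s i \<circ> s j \<circ> s i = reflection (s i (fst (\<alpha> j))) (s i (snd (\<alpha> j)))"
    if "i \<in> {1..n}" for i j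
    using s_conj[OF that, of j] s_comp_s[OF that] by (simp add: comp_assoc)
  have braid: "s i \<circ> s j \<circ> s i = s j \<circ> s i \<circ> s j \<and> s i \<circ> s j \<noteq> s j \<circ> s i"
    if "i \<in> {1..n}" "j \<in> {1..n}" "s i (fst (\<alpha> j)) = s j (fst (\<alpha> i))" "s i (snd (\<alpha> j)) = s j (snd (\<alpha> i))"
      "s i (s j (fst (\<alpha> i))) \<noteq> s j (s i (fst (\<alpha> i)))" for i j
    using conj[OF that(1), of j] conj[OF that(2), of i] that(3-5) by (metis comp_apply)
  have "s i \<circ> s j \<circ> s i = s j \<circ> s i \<circ> s j \<and> s i \<circ> s j \<noteq> s j \<circ> s i"
    if "i \<in> {1..n}" "j \<in> {1..n}" "j < n \<and> j = Suc i \<or> j = n \<and> i + 2 = n" for i j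
    using that(3)
  proof
    assume "j < n \<and> j = Suc i"
    then have "i < n" "j < n" "1 \<le> i" "1 \<le> j" "int j = int i + 1" using that by auto
    then show ?thesis by (intro braid that(1,2)) (simp_all add: \<alpha>_def s_lt)
  next
    assume "j = n \<and> i + 2 = n"
    then have "i < n" "1 \<le> i" "int n = int i + 2" "j = n" using that(1) by auto
    then show ?thesis by (intro braid that(1,2)) (simp_all add: \<alpha>_def s_lt s_n)
  qed
  from this[of i j] this[of j i] i j ij
  have "s i \<circ> s j \<circ> s i = s j \<circ> s i \<circ> s j \<and> s i \<circ> s j \<noteq> s j \<circ> s i"
    unfolding adjacent_def by metis
  then show "s i \<circ> s j \<circ> s i = s j \<circ> s i \<circ> s j" "s i \<circ> s j \<noteq> s j \<circ> s i" by blast+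
qed

end

section \<open>NilCoxeter relations up to sign\<close>

definition eq_upto_sign :: "('a, 'm) ring_scheme \<Rightarrow> 'a \<Rightarrow> 'a \<Rightarrow> bool" where
  "eq_upto_sign R a b \<longleftrightarrow> a = b \<or> a = \<ominus>\<^bsub>R\<^esub> b"

context ring begin

lemma eq_upto_sign_refl: "eq_upto_sign R a a"
  by (simp add: eq_upto_sign_def)

lemma eq_upto_sign_sym: "b \<in> carrier R \<Longrightarrow> eq_upto_sign R a b \<Longrightarrow> eq_upto_sign R b a"
  by (auto simp: eq_upto_sign_def)

lemma eq_upto_sign_trans:
  "c \<in> carrier R \<Longrightarrow> eq_upto_sign R a b \<Longrightarrow> eq_upto_sign R b c \<Longrightarrow> eq_upto_sign R a c"
  by (auto simp: eq_upto_sign_def)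

lemma eq_upto_sign_mult:
  "a' \<in> carrier R \<Longrightarrow> b' \<in> carrier R \<Longrightarrow> eq_upto_sign R a a' \<Longrightarrow> eq_upto_sign R b b'
    \<Longrightarrow> eq_upto_sign R (a \<otimes> b) (a' \<otimes> b')"
  by (auto simp: eq_upto_sign_def l_minus r_minus)

lemma eq_upto_sign_zero: "eq_upto_sign R a \<zero> \<Longrightarrow> a = \<zero>"
  by (auto simp: eq_upto_sign_def)

end

context type_D begin

lemma s_inj:
  assumes "a \<in> {1..n}" "b \<in> {1..n}" "s a = s b" shows "a = b"
proof -
  have "s a (int a) \<noteq> s b (int a)" if "a \<in> {1..n}" "b \<in> {1..n}" "a < b" for a b
  proof -
    have a: "1 \<le> a" "a < n" using that by auto
    then have sa: "s a (int a) = int a + 1" by (simp add: s_lt)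
    from letter_cases[OF that(2)] show ?thesis
    proof
      assume "1 \<le> b \<and> b < n"
      then have "s b (int a) = int a" using that(3) by (simp add: s_lt)
      then show ?thesis using sa by simp
    next
      assume "b = n"
      moreover have "s n (int a) \<noteq> int a + 1" using a unfolding s_n by auto
      ultimately show ?thesis using sa by simp
    qed
  qed
  from this[OF assms(1,2)] this[OF assms(2,1)] assms(3) show ?thesis
    by (metis linorder_neqE_nat)
qed

lemma wp_cancel: "set us \<subseteq> {1..n} \<Longrightarrow> wp (us @ ps) = wp (us @ qs) \<Longrightarrow> wp ps = wp qs"
  by (metis wp_append wp_rev comp_assoc id_comp)

text \<open>If an element has reduced words ending in \<open>a\<close> and in \<open>b\<close>, then \<open>b\<close> is a descent, so it may be
  exchanged for an earlier letter of the first word. The deleted letter is not the final \<open>a\<close>, since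
  distinct letters are distinct reflections.\<close>

lemma swap_last:
  assumes red: "reduced (us @ [a])" "reduced (vs @ [b])" "wp (us @ [a]) = wp (vs @ [b])" and ab: "a \<noteq> b"
  obtains us1 j us2 where "us = us1 @ j # us2" "reduced (us1 @ us2 @ [a, b])"
    "wp (us1 @ us2 @ [a, b]) = wp (us @ [a])"
proof -
  have letters: "set us \<subseteq> {1..n}" "set vs \<subseteq> {1..n}" "a \<in> {1..n}" "b \<in> {1..n}"
    using reduced_letters[OF red(1)] reduced_letters[OF red(2)] by auto
  have "\<not> descent vs b" using reduced_snoc_iff[OF reduced_append1[OF red(2)] letters(4)] red(2) by simp
  then have "descent (us @ [a]) b"
    using descent_snoc[OF letters(2,4)] descent_cong[OF red(3)] by simp
  then obtain p j q where ex: "us @ [a] = p @ j # q" "wp ((us @ [a]) @ [b]) = wp (p @ q)"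
    using exchange[OF reduced_letters[OF red(1)] letters(4)] by blast
  have w_eq: "wp (us @ [a]) = wp (p @ q @ [b])"
  proof -
    have "wp (us @ [a]) = wp ((us @ [a]) @ [b]) \<circ> s b"
      using s_comp_s[OF letters(4)] by (simp add: comp_assoc)
    then show ?thesis unfolding ex(2) by (simp add: comp_assoc)
  qed
  show ?thesis
  proof (cases q rule: rev_cases)
    case Nil
    then have "wp (us @ [a]) = wp (us @ [b])" using ex(1) w_eq by simp
    from wp_cancel[OF letters(1) this] have "s a = s b" by simp
    then show ?thesis using s_inj[OF letters(3,4)] ab by simp
  next
    case (snoc q' c)
    then have us: "us = p @ j # q'" "c = a" using ex(1) by auto
    have prod: "wp (p @ q' @ [a, b]) = wp (us @ [a])" using w_eq snoc us(2) by (simp add: comp_assoc)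
    moreover have "reduced (p @ q' @ [a, b])"
      using letters us(1) by (intro reduced_cong[OF red(1) _ prod]) auto
    ultimately show ?thesis using that us(1) by blast
  qed
qed

end

locale nil_coxeter = type_D n + ring R for n :: nat and R (structure) +
  fixes d :: "nat \<Rightarrow> 'a"
  assumes d_closed: "i \<in> {1..n} \<Longrightarrow> d i \<in> carrier R"
    and d_square: "i \<in> {1..n} \<Longrightarrow> d i \<otimes> d i = \<zero>"
    and d_commute: "i \<in> {1..n} \<Longrightarrow> j \<in> {1..n} \<Longrightarrow> i \<noteq> j \<Longrightarrow> \<not> adjacent i j
      \<Longrightarrow> eq_upto_sign R (d i \<otimes> d j) (d j \<otimes> d i)"
    and d_braid: "i \<in> {1..n} \<Longrightarrow> j \<in> {1..n} \<Longrightarrow> adjacent i j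
      \<Longrightarrow> d i \<otimes> (d j \<otimes> d i) = d j \<otimes> (d i \<otimes> d j)"
begin

definition d_word :: "nat list \<Rightarrow> 'a" where
  "d_word is = foldr (\<lambda>i a. d i \<otimes> a) is \<one>"

lemma d_word_simps [simp]: "d_word [] = \<one>" "d_word (i # is) = d i \<otimes> d_word is"
  by (simp_all add: d_word_def)

lemma d_word_closed: "set is \<subseteq> {1..n} \<Longrightarrow> d_word is \<in> carrier R"
  by (induction "is") (auto simp: d_closed)

lemma d_word_append:
  "set is \<subseteq> {1..n} \<Longrightarrow> set js \<subseteq> {1..n} \<Longrightarrow> d_word (is @ js) = d_word is \<otimes> d_word js"
proof (induction "is")
  case (Cons i "is")
  then show ?case by (simp add: d_closed d_word_closed m_assoc)
qed (simp add: d_word_closed)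

lemma d_word_append_cong:
  assumes "eq_upto_sign R (d_word us) (d_word vs)" "set us \<subseteq> {1..n}" "set vs \<subseteq> {1..n}" "set ws \<subseteq> {1..n}"
  shows "eq_upto_sign R (d_word (us @ ws)) (d_word (vs @ ws))"
    "eq_upto_sign R (d_word (ws @ us)) (d_word (ws @ vs))"
  using assms eq_upto_sign_mult[OF _ _ assms(1) eq_upto_sign_refl, of "d_word ws"]
    eq_upto_sign_mult[OF _ _ eq_upto_sign_refl assms(1), of "d_word ws"]
  by (simp_all add: d_word_append d_word_closed)

text \<open>Induction on the length. Two words with the same last letter are compared after deleting it. If
  the last letters \<open>a\<close> and \<open>b\<close> differ, repeated use of \<open>swap_last\<close> produces reduced words of the same
  element that end in the two sides of the relation between \<open>a\<close> and \<open>b\<close>; each of them shares its last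
  letter with one of the given words.\<close>

lemma matsumoto:
  assumes "reduced is" "reduced js" "wp is = wp js"
  shows "eq_upto_sign R (d_word is) (d_word js)"
  using assms
proof (induction "length is" arbitrary: "is" js rule: less_induct)
  case less
  note red_is = less.prems(1) and red_js = less.prems(2) and prod = less.prems(3)
  note len = reduced_length_eq[OF red_is red_js prod]
  show ?case
  proof (cases "is" rule: rev_cases)
    case Nil
    then show ?thesis using len by (simp add: eq_upto_sign_refl)
  next
    case (snoc us a)
    then obtain vs b where js: "js = vs @ [b]" using len by (cases js rule: rev_cases) auto
    note is_eq = snoc
    have letters: "a \<in> {1..n}" "b \<in> {1..n}" "set us \<subseteq> {1..n}" "set vs \<subseteq> {1..n}"
      using reduced_letters[OF red_is] reduced_letters[OF red_js] is_eq js by auto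
    note closed = d_word_closed[OF reduced_letters]
    have same_end: "eq_upto_sign R (d_word (ps @ [c])) (d_word (qs @ [c]))"
      if "reduced (ps @ [c])" "reduced (qs @ [c])" "wp (ps @ [c]) = wp (qs @ [c])"
        "length ps < length is" for ps qs c
    proof -
      have c: "c \<in> {1..n}" "set ps \<subseteq> {1..n}" "set qs \<subseteq> {1..n}"
        using reduced_letters[OF that(1)] reduced_letters[OF that(2)] by auto
      have "wp ps = wp qs" using wp_snoc_cancel[OF c(1) that(3)] .
      then have "eq_upto_sign R (d_word ps) (d_word qs)"
        using less.hyps that reduced_append1 by blast
      then show ?thesis using d_word_append_cong(1)[OF _ c(2,3), of "[c]"] c(1) by simp
    qed
    show ?thesis
    proof (cases "a = b")
      case True
      then show ?thesis using same_end[of us b vs] red_is red_js prod is_eq js by simp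
    next
      case False
      obtain p j q where pq: "us = p @ j # q" "reduced (p @ q @ [a, b])"
        "wp (p @ q @ [a, b]) = wp (us @ [a])"
        using swap_last[of us a vs b] red_is red_js prod is_eq js False by auto
      have letters': "set p \<subseteq> {1..n}" "set q \<subseteq> {1..n}" using letters(3) pq(1) by auto
      show ?thesis
      proof (cases "adjacent a b")
        case False
        have comm: "s a \<circ> s b = s b \<circ> s a" using s_commute[OF letters(1,2) False] .
        have prod': "wp (p @ q @ [b, a]) = wp (p @ q @ [a, b])"
          using comm by (simp add: comp_assoc)
        have red': "reduced (p @ q @ [b, a])"
          using letters letters' prod' by (intro reduced_cong[OF pq(2)]) auto
        have "eq_upto_sign R (d_word is) (d_word ((p @ q @ [b]) @ [a]))"
          unfolding is_eq using red_is red' prod' pq is_eq by (intro same_end) auto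
        moreover have "eq_upto_sign R (d_word ((p @ q) @ [b, a])) (d_word ((p @ q) @ [a, b]))"
          using d_commute[OF letters(2,1)] False \<open>a \<noteq> b\<close> letters letters'
          by (intro d_word_append_cong(2)) (auto simp: d_closed adjacent_def)
        moreover have "eq_upto_sign R (d_word ((p @ q @ [a]) @ [b])) (d_word js)"
          unfolding js using pq red_js prod is_eq js by (intro same_end) auto
        ultimately show ?thesis
          using eq_upto_sign_trans closed[OF red_js] closed[OF pq(2)] by (metis append_assoc append_Cons append_Nil)
      next
        case True
        \<comment> \<open>a second exchange, now for the letter a, completes the suffix a b to a b a\<close>
        obtain p' j' q' where pq': "p @ q @ [a] = p' @ j' # q'" "reduced (p' @ q' @ [b, a])"
          "wp (p' @ q' @ [b, a]) = wp (p @ q @ [a, b])"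
        proof -
          have prems: "reduced ((p @ q @ [a]) @ [b])" "reduced (us @ [a])"
            "wp ((p @ q @ [a]) @ [b]) = wp (us @ [a])" "b \<noteq> a"
            using pq(2,3) red_is is_eq \<open>a \<noteq> b\<close> by (simp_all only: append_assoc append_Cons append_Nil not_sym)
          obtain p' j' q' where *: "p @ q @ [a] = p' @ j' # q'" "reduced (p' @ q' @ [b, a])"
            "wp (p' @ q' @ [b, a]) = wp ((p @ q @ [a]) @ [b])"
            using swap_last[OF prems] by blast
          have "(p @ q @ [a]) @ [b] = p @ q @ [a, b]" by simp
          with *(3) have "wp (p' @ q' @ [b, a]) = wp (p @ q @ [a, b])" by (simp only:)
          then show ?thesis using that[OF *(1,2)] by blast
        qed
        have "q' \<noteq> []"
        proof
          assume "q' = []"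
          then have "p' = p @ q" using pq'(1) by simp
          with \<open>q' = []\<close> have "wp ((p @ q) @ [b, a]) = wp ((p @ q) @ [a, b])"
            using pq'(3) by (simp add: comp_assoc)
          then have "s b \<circ> s a = s a \<circ> s b" using wp_cancel[of "p @ q" "[b, a]" "[a, b]"] letters' by simp
          then show False using s_braid(2)[OF letters(1,2) True] by simp
        qed
        then obtain r where r: "q' = r @ [a]" using pq'(1) by (cases q' rule: rev_cases) auto
        define t where "t = p' @ r"
        have t: "reduced (t @ [a, b, a])" "wp (t @ [a, b, a]) = wp (us @ [a])" "set t \<subseteq> {1..n}"
          using pq' pq(3) r reduced_letters[OF pq'(2)] by (auto simp: t_def)
        have prod': "wp (t @ [b, a, b]) = wp (t @ [a, b, a])"
          using s_braid(1)[OF letters(1,2) True] by (simp add: comp_assoc)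
        have red': "reduced (t @ [b, a, b])"
          using letters t(3) prod' by (intro reduced_cong[OF t(1)]) auto
        have "eq_upto_sign R (d_word is) (d_word ((t @ [a, b]) @ [a]))"
          unfolding is_eq using red_is t is_eq by (intro same_end) auto
        moreover have "d_word (t @ [a, b, a]) = d_word (t @ [b, a, b])"
          using letters t(3) d_braid[OF letters(1,2) True] by (simp add: d_word_append d_closed)
        moreover have "eq_upto_sign R (d_word ((t @ [b, a]) @ [b])) (d_word js)"
          unfolding js using red' prod' t red_js prod is_eq js len
            reduced_length_eq[OF red' red_js] by (intro same_end) auto
        ultimately show ?thesis
          using eq_upto_sign_trans closed[OF red_js] by (metis append_assoc append_Cons append_Nil)
      qed
    qed
  qed
qed

text \<open>At the first letter that makes the word non-reduced, the prefix has another reduced word that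
  ends in this letter, and the square of a generator is zero.\<close>

lemma d_word_not_reduced:
  assumes "set is \<subseteq> {1..n}" "\<not> reduced is"
  shows "d_word is = \<zero>"
  using assms
proof (induction "is" rule: rev_induct)
  case Nil
  then show ?case by (simp add: reduced_def)
next
  case (snoc i "is")
  then have letters: "set is \<subseteq> {1..n}" "i \<in> {1..n}" by auto
  show ?case
  proof (cases "reduced is")
    case False
    then show ?thesis using snoc.IH letters by (simp add: d_word_append d_closed)
  next
    case True
    then have "descent is i" using reduced_snoc_iff[OF True letters(2)] snoc.prems(2) by simp
    then obtain us j vs where ex: "is = us @ j # vs" "wp (is @ [i]) = wp (us @ vs)"
      using exchange[OF letters] by blast
    have prod: "wp ((us @ vs) @ [i]) = wp is"
    proof -
      have "wp is = wp (is @ [i]) \<circ> s i" using s_comp_s[OF letters(2)] by (simp add: comp_assoc)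
      then show ?thesis unfolding ex(2) by (simp add: comp_assoc)
    qed
    have letters': "set (us @ vs) \<subseteq> {1..n}" using letters(1) ex(1) by auto
    have "reduced ((us @ vs) @ [i])"
      using letters letters' ex(1) by (intro reduced_cong[OF True _ prod]) auto
    from matsumoto[OF True this prod[symmetric]]
    have "eq_upto_sign R (d_word (is @ [i])) (d_word (((us @ vs) @ [i]) @ [i]))"
      using letters letters' by (intro d_word_append_cong(1)) auto
    moreover have "d_word (((us @ vs) @ [i]) @ [i]) = d_word (us @ vs) \<otimes> (d i \<otimes> d i)"
      using letters letters' d_word_append[OF letters', of "[i, i]"] by (simp add: d_closed)
    ultimately show ?thesis
      using d_square[OF letters(2)] d_word_closed[OF letters'] by (simp add: eq_upto_sign_zero)
  qed
qed

lemma d_word_product: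
  assumes "reduced is" "reduced js" "wp js = s i \<circ> wp is" "i \<in> {1..n}"
  shows "d i \<otimes> d_word is = \<zero> \<or> eq_upto_sign R (d i \<otimes> d_word is) (d_word js)"
proof (cases "reduced (i # is)")
  case True
  then show ?thesis using matsumoto[OF True assms(2)] assms(3) by simp
next
  case False
  then show ?thesis using d_word_not_reduced[OF _ False] reduced_letters[OF assms(1)] assms(4) by simp
qed

end

section \<open>Skew polynomials and odd Demazure operators\<close>

text \<open>The index set \<open>{1..n}\<close> occurs inside the rings below; it should not be rewritten to
  \<open>{Suc 0..n}\<close> in one place and not in another.\<close>

declare One_nat_def [simp del]

lemma pol_presentation: "presentation {1..n} (pol_rels n)"
proof (unfold_locales)
  interpret F: ring "free_alg {1..n}" by (rule free_alg_ring)
  fix l r assume "(l, r) \<in> pol_rels n"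
  then show "l \<in> carrier (free_alg {1..n}) \<and> r \<in> carrier (free_alg {1..n})"
    unfolding pol_rels_def Let_def by (auto simp: free_gen_closed)
qed

lemma Pol_ring: "ring (Pol n)"
proof -
  interpret presentation "{1..n}" "pol_rels n" by (rule pol_presentation)
  show ?thesis unfolding Pol_def by (rule proj.S.ring_axioms)
qed

locale skew_polynomials = type_D n + ring P
  for n :: nat and P :: "(nat list \<Rightarrow> int) set ring" (structure) +
  assumes P_Pol: "P = Pol n"
begin

abbreviation "x \<equiv> pol_x n"

lemma x_closed [simp]: "i \<in> {1..n} \<Longrightarrow> x i \<in> carrier P"
proof -
  interpret presentation "{1..n}" "pol_rels n" by (rule pol_presentation)
  assume "i \<in> {1..n}"
  then show ?thesis unfolding P_Pol Pol_def pol_x_def by (rule gen_closed)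
qed

lemma x_anticommute:
  assumes "i \<in> {1..n}" "j \<in> {1..n}" "i \<noteq> j"
  shows "x i \<otimes> x j \<oplus> x j \<otimes> x i = \<zero>"
proof -
  interpret presentation "{1..n}" "pol_rels n" by (rule pol_presentation)
  let ?g = "free_gen :: nat \<Rightarrow> nat list \<Rightarrow> int"
  have g: "?g i \<in> carrier F" "?g j \<in> carrier F" using assms by (auto intro: free_gen_closed)
  have "(?g i \<otimes>\<^bsub>F\<^esub> ?g j \<oplus>\<^bsub>F\<^esub> ?g j \<otimes>\<^bsub>F\<^esub> ?g i, \<zero>\<^bsub>F\<^esub>) \<in> pol_rels n"
    unfolding pol_rels_def Let_def using assms by blast
  from proj_rel[OF this] show ?thesis
    using g by (simp add: P_Pol Pol_def pol_x_def presented_gen_def)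
qed

lemma P_induct [consumes 1, case_names one gen add neg]:
  assumes "f \<in> carrier P"
    and "Q \<one>"
    and "\<And>i f. i \<in> {1..n} \<Longrightarrow> f \<in> carrier P \<Longrightarrow> Q f \<Longrightarrow> Q (x i \<otimes> f)"
    and "\<And>f g. f \<in> carrier P \<Longrightarrow> g \<in> carrier P \<Longrightarrow> Q f \<Longrightarrow> Q g \<Longrightarrow> Q (f \<oplus> g)"
    and "\<And>f. f \<in> carrier P \<Longrightarrow> Q f \<Longrightarrow> Q (\<ominus> f)"
  shows "Q f"
proof -
  interpret presentation "{1..n}" "pol_rels n" by (rule pol_presentation)
  show ?thesis
    by (rule presented_induct[of f Q]) (use assms in \<open>unfold P_Pol Pol_def pol_x_def, blast+\<close>)
qed

lemma P_hom_exists: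
  assumes R: "ring R" and \<phi>: "\<phi> \<in> {1..n} \<rightarrow> carrier R"
    and anti: "\<And>i j. i \<in> {1..n} \<Longrightarrow> j \<in> {1..n} \<Longrightarrow> i \<noteq> j \<Longrightarrow>
      \<phi> i \<otimes>\<^bsub>R\<^esub> \<phi> j \<oplus>\<^bsub>R\<^esub> \<phi> j \<otimes>\<^bsub>R\<^esub> \<phi> i = \<zero>\<^bsub>R\<^esub>"
  shows "\<exists>h. h \<in> ring_hom P R \<inter> extensional (carrier P) \<and> (\<forall>i\<in>{1..n}. h (x i) = \<phi> i)"
proof -
  interpret presentation "{1..n}" "pol_rels n" by (rule pol_presentation)
  show ?thesis unfolding P_Pol Pol_def pol_x_def
  proof (rule hom_exists[OF R \<phi>])
    fix e l r
    assume "ring_hom_ring F R e" and e: "\<And>a. a \<in> {1..n} \<Longrightarrow> e (free_gen a) = \<phi> a"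
      and lr: "(l, r) \<in> pol_rels n"
    then interpret e: ring_hom_ring F R e by simp
    show "e l = e r"
      using lr anti unfolding pol_rels_def Let_def by (auto simp: free_gen_closed e)
  qed
qed

lemma P_hom_unique:
  assumes "ring R"
    and "h \<in> ring_hom P R \<inter> extensional (carrier P)" "h' \<in> ring_hom P R \<inter> extensional (carrier P)"
    and "\<And>i. i \<in> {1..n} \<Longrightarrow> h (x i) = h' (x i)"
  shows "h = h'"
proof -
  interpret presentation "{1..n}" "pol_rels n" by (rule pol_presentation)
  show ?thesis
    using assms unfolding P_Pol Pol_def pol_x_def by (rule hom_unique)
qed

text \<open>The values of the twist and of the odd Demazure operator on the variable \<open>x\<^sub>j\<close>.\<close>

definition \<sigma> :: "nat \<Rightarrow> nat \<Rightarrow> (nat list \<Rightarrow> int) set" where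
  "\<sigma> i j = (if i < n then
      (if j = i then \<ominus> x (i + 1) else if j = i + 1 then \<ominus> x i else \<ominus> x j)
    else (if j = n then x (n - 1) else if j = n - 1 then x n else \<ominus> x j))"

definition \<kappa> :: "nat \<Rightarrow> nat \<Rightarrow> (nat list \<Rightarrow> int) set" where
  "\<kappa> i j = (if i < n then (if j = i \<or> j = i + 1 then \<one> else \<zero>)
    else (if j = n then \<ominus> \<one> else if j = n - 1 then \<one> else \<zero>))"

abbreviation "S \<equiv> odd_refl n"
abbreviation "D \<equiv> odd_demazure n"

lemma \<sigma>_closed [simp]: "i \<in> {1..n} \<Longrightarrow> j \<in> {1..n} \<Longrightarrow> \<sigma> i j \<in> carrier P"
proof -
  assume ij: "i \<in> {1..n}" "j \<in> {1..n}"
  have last: "n - 1 \<in> {1..n}" "n \<in> {1..n}" using n_ge_2 by auto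
  have "i < n \<longrightarrow> x (i + 1) \<in> carrier P" by (intro impI x_closed) simp
  moreover note ij[THEN x_closed] last[THEN x_closed]
  ultimately show ?thesis unfolding \<sigma>_def by (simp only: split: if_split) (blast intro: a_inv_closed)
qed

lemma \<kappa>_closed [simp]: "\<kappa> i j \<in> carrier P"
  by (auto simp: \<kappa>_def)

lemma x_anticommute': "i \<in> {1..n} \<Longrightarrow> j \<in> {1..n} \<Longrightarrow> i \<noteq> j \<Longrightarrow> x i \<otimes> x j = \<ominus> (x j \<otimes> x i)"
  using minus_equality[OF x_anticommute] by simp

lemma \<sigma>_anticommute:
  assumes "i \<in> {1..n}" "j \<in> {1..n}" "k \<in> {1..n}" "j \<noteq> k"
  shows "\<sigma> i j \<otimes> \<sigma> i k \<oplus> \<sigma> i k \<otimes> \<sigma> i j = \<zero>"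
proof -
  define p where "p = transpose (min i (n - 1)) (min i (n - 1) + 1)"
  have p: "p j \<in> {1..n}" if "j \<in> {1..n}" for j
    using that assms(1) n_ge_2 by (auto simp: p_def transpose_def min_def)
  have sign: "\<sigma> i j = x (p j) \<or> \<sigma> i j = \<ominus> x (p j)" if "j \<in> {1..n}" for j
    using that assms(1) n_ge_2 by (auto simp: \<sigma>_def p_def transpose_def min_def)
  have "p j \<noteq> p k" using assms(4) unfolding p_def by (metis transpose_involutory)
  from x_anticommute[OF p[OF assms(2)] p[OF assms(3)] this] sign[OF assms(2)] sign[OF assms(3)]
    p[OF assms(2)] p[OF assms(3)]
  show ?thesis by (auto simp: l_minus r_minus minus_add[symmetric])
qed

text \<open>The corner entry of the skew commutator of the two triangular matrices belonging to \<open>x\<^sub>j\<close> and \<open>x\<^sub>k\<close>.\<close>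

lemma \<kappa>_compatible:
  assumes "i \<in> {1..n}" "j \<in> {1..n}" "k \<in> {1..n}" "j \<noteq> k"
  shows "(\<sigma> i j \<otimes> \<kappa> i k \<oplus> \<kappa> i j \<otimes> x k) \<oplus> (\<sigma> i k \<otimes> \<kappa> i j \<oplus> \<kappa> i k \<otimes> x j) = \<zero>"
proof -
  have last: "n - 1 \<in> {1..n}" "n \<in> {1..n}" "n - 1 \<noteq> n" using n_ge_2 by auto
  note [simp] = l_minus r_minus l_neg r_neg
  consider (lt) "i < n" "j = i" "k = i + 1" | (lt') "i < n" "k = i" "j = i + 1"
    | (lt_j) "i < n" "j = i \<or> j = i + 1" "k \<noteq> i" "k \<noteq> i + 1"
    | (lt_k) "i < n" "k = i \<or> k = i + 1" "j \<noteq> i" "j \<noteq> i + 1"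
    | (lt_0) "i < n" "j \<noteq> i" "j \<noteq> i + 1" "k \<noteq> i" "k \<noteq> i + 1"
    | (eq) "\<not> i < n" "j = n" "k = n - 1" | (eq') "\<not> i < n" "k = n" "j = n - 1"
    | (eq_j) "\<not> i < n" "j = n \<or> j = n - 1" "k \<noteq> n" "k \<noteq> n - 1"
    | (eq_k) "\<not> i < n" "k = n \<or> k = n - 1" "j \<noteq> n" "j \<noteq> n - 1"
    | (eq_0) "\<not> i < n" "j \<noteq> n" "j \<noteq> n - 1" "k \<noteq> n" "k \<noteq> n - 1"
    using assms(4) by metis
  then show ?thesis
  proof cases
    case lt
    then have "\<sigma> i j = \<ominus> x k" "\<sigma> i k = \<ominus> x j" "\<kappa> i j = \<one>" "\<kappa> i k = \<one>" by (simp_all add: \<sigma>_def \<kappa>_def)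
    then show ?thesis using assms by simp
  next
    case lt'
    then have "\<sigma> i j = \<ominus> x k" "\<sigma> i k = \<ominus> x j" "\<kappa> i j = \<one>" "\<kappa> i k = \<one>" by (simp_all add: \<sigma>_def \<kappa>_def)
    then show ?thesis using assms by simp
  next
    case lt_j
    then have "\<sigma> i k = \<ominus> x k" "\<kappa> i j = \<one>" "\<kappa> i k = \<zero>" by (auto simp: \<sigma>_def \<kappa>_def)
    then show ?thesis using assms by simp
  next
    case lt_k
    then have "\<sigma> i j = \<ominus> x j" "\<kappa> i k = \<one>" "\<kappa> i j = \<zero>" by (auto simp: \<sigma>_def \<kappa>_def)
    then show ?thesis using assms by simp
  next
    case eq
    then have "\<sigma> i j = x k" "\<sigma> i k = x j" "\<kappa> i j = \<ominus> \<one>" "\<kappa> i k = \<one>"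
      using last by (simp_all add: \<sigma>_def \<kappa>_def)
    then show ?thesis using assms by simp
  next
    case eq'
    then have "\<sigma> i j = x k" "\<sigma> i k = x j" "\<kappa> i k = \<ominus> \<one>" "\<kappa> i j = \<one>"
      using last by (simp_all add: \<sigma>_def \<kappa>_def)
    then show ?thesis using assms by simp
  next
    case eq_j
    then have "\<sigma> i k = \<ominus> x k" "\<kappa> i j = \<one> \<or> \<kappa> i j = \<ominus> \<one>" "\<kappa> i k = \<zero>"
      by (auto simp: \<sigma>_def \<kappa>_def)
    then show ?thesis using assms by auto
  next
    case eq_k
    then have "\<sigma> i j = \<ominus> x j" "\<kappa> i k = \<one> \<or> \<kappa> i k = \<ominus> \<one>" "\<kappa> i j = \<zero>"
      by (auto simp: \<sigma>_def \<kappa>_def)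
    then show ?thesis using assms by auto
  qed (use assms in \<open>simp_all add: \<kappa>_def\<close>)
qed

text \<open>Since the triangular matrices of the variables skew commute, they define a homomorphism, which
  contains both the twist and the odd Demazure operator.\<close>

lemma triangular_hom:
  assumes i: "i \<in> {1..n}"
  obtains H where "H \<in> ring_hom P (triangular_ring P)" "\<And>j. j \<in> {1..n} \<Longrightarrow> H (x j) = (\<sigma> i j, \<kappa> i j, x j)"
    "\<And>f. f \<in> carrier P \<Longrightarrow> snd (snd (H f)) = f"
proof -
  have "\<exists>h. h \<in> ring_hom P (triangular_ring P) \<inter> extensional (carrier P) \<and>
      (\<forall>j\<in>{1..n}. h (x j) = (\<sigma> i j, \<kappa> i j, x j))"
  proof (rule P_hom_exists[OF triangular_ring_ring])
    fix j k assume "j \<in> {1..n}" "k \<in> {1..n}" "j \<noteq> k"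
    then show "(\<sigma> i j, \<kappa> i j, x j) \<otimes>\<^bsub>triangular_ring P\<^esub> (\<sigma> i k, \<kappa> i k, x k) \<oplus>\<^bsub>triangular_ring P\<^esub>
        (\<sigma> i k, \<kappa> i k, x k) \<otimes>\<^bsub>triangular_ring P\<^esub> (\<sigma> i j, \<kappa> i j, x j) = \<zero>\<^bsub>triangular_ring P\<^esub>"
      using i by (simp add: triangular_ring_simps \<sigma>_anticommute \<kappa>_compatible x_anticommute)
  qed (use i in \<open>auto simp: triangular_ring_simps\<close>)
  then obtain H where H: "H \<in> ring_hom P (triangular_ring P)"
    "\<forall>j\<in>{1..n}. H (x j) = (\<sigma> i j, \<kappa> i j, x j)" by blast
  have "snd (snd (H f)) = f \<and> H f \<in> carrier (triangular_ring P)" if "f \<in> carrier P" for f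
    using that
  proof (induction rule: P_induct)
    case one
    then show ?case using ring_hom_one[OF H(1)] by (simp add: triangular_ring_simps)
  next
    case (gen j f)
    then show ?case
      using ring_hom_mult[OF H(1) x_closed[OF gen(1)] gen(2)] H(2) i
      by (cases "H f") (simp add: triangular_ring_simps)
  next
    case (add f g)
    then show ?case
      using ring_hom_add[OF H(1) add(1,2)]
      by (cases "H f"; cases "H g") (simp add: triangular_ring_simps)
  next
    case (neg f)
    interpret H: ring_hom_ring P "triangular_ring P" H
      by (rule ring_hom_ringI2[OF ring_axioms triangular_ring_ring H(1)])
    obtain a b c where abc: "H (\<ominus> f) = (a, b, c)" by (cases "H (\<ominus> f)")
    have "H (\<ominus> f) \<in> carrier (triangular_ring P)" using neg by simp
    moreover have "H (\<ominus> f) \<oplus>\<^bsub>triangular_ring P\<^esub> H f = \<zero>\<^bsub>triangular_ring P\<^esub>"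
      using neg(1) H.hom_add[of "\<ominus> f" f] by (simp add: l_neg del: H.hom_a_inv)
    then have "c \<oplus> f = \<zero>" using abc neg(2) by (cases "H f") (simp add: triangular_ring_simps)
    ultimately show ?case using abc neg(1) minus_equality[of c f] by (simp add: triangular_ring_simps)
  qed
  then show ?thesis using that[OF H(1)] H(2) by blast
qed

text \<open>The entries of \<open>triangular_hom\<close> satisfy the characterizations of the twist and of the operator;
  uniqueness holds because the polynomial ring is generated by the variables.\<close>

lemma odd_refl_props:
  assumes i: "i \<in> {1..n}"
  shows "S i \<in> ring_hom P P" "\<And>j. j \<in> {1..n} \<Longrightarrow> S i (x j) = \<sigma> i j"
    and demazure_props: "D i \<in> carrier (end_ring P)" "D i \<one> = \<zero>"
      "\<And>j. j \<in> {1..n} \<Longrightarrow> D i (x j) = \<kappa> i j"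
      "\<And>f g. f \<in> carrier P \<Longrightarrow> g \<in> carrier P \<Longrightarrow> D i (f \<otimes> g) = D i f \<otimes> g \<oplus> S i f \<otimes> D i g"
proof -
  obtain H where H: "H \<in> ring_hom P (triangular_ring P)"
    "\<And>j. j \<in> {1..n} \<Longrightarrow> H (x j) = (\<sigma> i j, \<kappa> i j, x j)" "\<And>f. f \<in> carrier P \<Longrightarrow> snd (snd (H f)) = f"
    using triangular_hom[OF i] by blast
  define s' where "s' = (\<lambda>f\<in>carrier P. fst (H f))"
  define d' where "d' = (\<lambda>f\<in>carrier P. fst (snd (H f)))"
  have H_eq: "H f = (s' f, d' f, f)" "s' f \<in> carrier P" "d' f \<in> carrier P" if "f \<in> carrier P" for f
    using that H(3)[OF that] ring_hom_closed[OF H(1) that]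
    by (cases "H f"; auto simp: s'_def d'_def triangular_ring_simps)+
  have mult: "s' (f \<otimes> g) = s' f \<otimes> s' g" "d' (f \<otimes> g) = s' f \<otimes> d' g \<oplus> d' f \<otimes> g"
    if "f \<in> carrier P" "g \<in> carrier P" for f g
    using ring_hom_mult[OF H(1) that] that by (simp_all add: H_eq triangular_ring_simps)
  have add: "s' (f \<oplus> g) = s' f \<oplus> s' g" "d' (f \<oplus> g) = d' f \<oplus> d' g"
    if "f \<in> carrier P" "g \<in> carrier P" for f g
    using ring_hom_add[OF H(1) that] that by (simp_all add: H_eq triangular_ring_simps)
  have ones: "s' \<one> = \<one>" "d' \<one> = \<zero>"
    using ring_hom_one[OF H(1)] by (simp_all add: H_eq triangular_ring_simps)
  have x: "s' (x j) = \<sigma> i j" "d' (x j) = \<kappa> i j" if "j \<in> {1..n}" for j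
    using H(2)[OF that] that by (simp_all add: H_eq)
  have s': "s' \<in> ring_hom P P \<inter> extensional (carrier P)"
    by (auto intro!: ring_hom_memI simp: H_eq mult add ones) (simp add: s'_def)
  have S_eq: "S i = s'"
    unfolding odd_refl_def P_Pol[symmetric]
  proof (rule the_equality, intro conjI ballI)
    fix t assume t: "t \<in> ring_hom P P \<inter> extensional (carrier P) \<and> (\<forall>j\<in>{1..n}. t (x j) =
         (if i < n then
            (if j = i then \<ominus> x (i + 1) else if j = i + 1 then \<ominus> x i else \<ominus> x j)
          else
            (if j = n then x (n - 1) else if j = n - 1 then x n else \<ominus> x j)))"
    show "t = s'"
    proof (rule P_hom_unique[OF ring_axioms _ s'])
      fix j assume "j \<in> {1..n}"
      with t show "t (x j) = s' (x j)" by (simp only: x \<sigma>_def)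
    qed (use t in blast)
  qed (use s' in \<open>simp_all only: x \<sigma>_def\<close>)
  show "S i \<in> ring_hom P P" "\<And>j. j \<in> {1..n} \<Longrightarrow> S i (x j) = \<sigma> i j"
    using s' x by (auto simp: S_eq)
  have d': "d' \<in> carrier (end_ring P)"
    unfolding end_ring_mem by (auto simp: H_eq add) (simp add: d'_def)
  have D_eq: "D i = d'"
    unfolding odd_demazure_def P_Pol[symmetric] S_eq
  proof (rule the_equality, intro conjI ballI)
    fix f g assume "f \<in> carrier P" "g \<in> carrier P"
    then show "d' (f \<otimes> g) = d' f \<otimes> g \<oplus> s' f \<otimes> d' g" by (simp add: mult a_comm H_eq)
  next
    fix t assume t: "t \<in> carrier (end_ring P) \<and> t \<one> = \<zero> \<and>
      (\<forall>j\<in>{1..n}. t (x j) =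
         (if i < n then (if j = i \<or> j = i + 1 then \<one> else \<zero>)
          else (if j = n then \<ominus> \<one> else if j = n - 1 then \<one> else \<zero>))) \<and>
      (\<forall>f\<in>carrier P. \<forall>g\<in>carrier P. t (f \<otimes> g) = t f \<otimes> g \<oplus> s' f \<otimes> t g)"
    then have t_end: "t \<in> carrier (end_ring P)" and t_x: "t (x j) = \<kappa> i j" if "j \<in> {1..n}" for j
      using that by (simp_all only: \<kappa>_def)
    have t_end: "t \<in> carrier (end_ring P)" using t by blast
    show "t = d'"
    proof (rule extensionalityI[of _ "carrier P"])
      show "t \<in> extensional (carrier P)" "d' \<in> extensional (carrier P)"
        using t_end d' by (auto simp: end_ring_mem)
      fix f assume "f \<in> carrier P"
      then show "t f = d' f"
      proof (induction rule: P_induct)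
        case one
        then show ?case using t ones by simp
      next
        case (gen j f)
        have "t (x j \<otimes> f) = t (x j) \<otimes> f \<oplus> s' (x j) \<otimes> t f"
          using t gen(1,2) x_closed by blast
        then show ?case using gen i by (simp add: mult t_x x a_comm H_eq)
      next
        case (add f g)
        then show ?case using t_end d' by (simp add: end_ring_mem)
      next
        case (neg f)
        then show ?case using end_neg[OF t_end] end_neg[OF d'] by simp
      qed
    qed
  qed (use d' ones x in \<open>simp_all only: \<kappa>_def\<close>)
  show "D i \<in> carrier (end_ring P)" "D i \<one> = \<zero>" "\<And>j. j \<in> {1..n} \<Longrightarrow> D i (x j) = \<kappa> i j"
    "\<And>f g. f \<in> carrier P \<Longrightarrow> g \<in> carrier P \<Longrightarrow> D i (f \<otimes> g) = D i f \<otimes> g \<oplus> S i f \<otimes> D i g"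
    using d' ones x by (auto simp: S_eq D_eq mult a_comm H_eq)
qed

end

section \<open>Relations between the odd Demazure operators\<close>

context abelian_group begin

lemma end_int_mult:
  assumes "f \<in> carrier (end_ring G)" "x \<in> carrier G"
  shows "f ([(k::int)] \<cdot> x) = [k] \<cdot> f x"
proof -
  have "f \<in> hom (add_monoid G) (add_monoid G)" using assms(1) by (simp add: end_ring_def)
  from hom_int_pow[OF this _ a_group a_group] show ?thesis
    using assms(2) by (simp add: add_pow_def)
qed

end

context skew_polynomials begin

lemma D_closed [simp]: "i \<in> {1..n} \<Longrightarrow> f \<in> carrier P \<Longrightarrow> D i f \<in> carrier P"
  using demazure_props(1)[of i] by (auto simp: end_ring_mem)

lemma D_add: "i \<in> {1..n} \<Longrightarrow> f \<in> carrier P \<Longrightarrow> g \<in> carrier P \<Longrightarrow> D i (f \<oplus> g) = D i f \<oplus> D i g"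
  using demazure_props(1)[of i] by (auto simp: end_ring_mem)

lemma D_zero: "i \<in> {1..n} \<Longrightarrow> D i \<zero> = \<zero>"
  using end_zero[OF demazure_props(1)] .

lemma D_neg: "i \<in> {1..n} \<Longrightarrow> f \<in> carrier P \<Longrightarrow> D i (\<ominus> f) = \<ominus> D i f"
  using end_neg[OF demazure_props(1)] .

lemma D_int: "i \<in> {1..n} \<Longrightarrow> f \<in> carrier P \<Longrightarrow> D i ([(k::int)] \<cdot> f) = [k] \<cdot> D i f"
  using end_int_mult[OF demazure_props(1)] .

text \<open>All operators have one shape: \<open>D i\<close> affects the variables \<open>lower i\<close> and \<open>lower i + 1\<close>, and the
  sign \<open>\<eta> i\<close> tells the last operator from the others. With these parameters a relation between
  operators becomes a few identities between integers and between permutations of the indices.\<close>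

definition lower :: "nat \<Rightarrow> nat" where "lower i = (if i < n then i else n - 1)"

definition \<eta> :: "nat \<Rightarrow> int" where "\<eta> i = (if i < n then 1 else - 1)"

definition perm :: "nat \<Rightarrow> nat \<Rightarrow> nat" where "perm i = transpose (lower i) (lower i + 1)"

definition eps :: "nat \<Rightarrow> nat \<Rightarrow> int" where
  "eps i j = (if j = lower i \<or> j = lower i + 1 then - \<eta> i else - 1)"

definition coef :: "nat \<Rightarrow> nat \<Rightarrow> int" where
  "coef i j = (if j = lower i then 1 else if j = lower i + 1 then \<eta> i else 0)"

lemma lower_bounds: "i \<in> {1..n} \<Longrightarrow> 1 \<le> lower i \<and> lower i + 1 \<le> n"
  using n_ge_2 by (auto simp: lower_def)

lemma perm_closed: "i \<in> {1..n} \<Longrightarrow> j \<in> {1..n} \<Longrightarrow> perm i j \<in> {1..n}"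
  using lower_bounds[of i] by (auto simp: perm_def transpose_def)

lemma neg_int_mult: "f \<in> carrier P \<Longrightarrow> [(- 1::int)] \<cdot> f = \<ominus> f"
  by (simp add: add.int_pow_neg)

lemma \<sigma>_eq:
  assumes i: "i \<in> {1..n}" and j: "j \<in> {1..n}"
  shows "\<sigma> i j = [(eps i j)] \<cdot> x (perm i j)"
proof (cases "i < n")
  case True
  then have *: "lower i = i" "\<eta> i = 1" by (simp_all add: lower_def \<eta>_def)
  have "[(- 1::int)] \<cdot> x (perm i j) = \<ominus> x (perm i j)"
    by (rule neg_int_mult[OF x_closed[OF perm_closed[OF i j]]])
  moreover have "perm i j = (if j = i then i + 1 else if j = i + 1 then i else j)"
    by (simp add: perm_def * transpose_def)
  moreover have "eps i j = - 1" by (simp add: eps_def *)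
  ultimately show ?thesis using True by (simp add: \<sigma>_def)
next
  case False
  then have *: "lower i = n - 1" "\<eta> i = - 1" by (simp_all add: lower_def \<eta>_def)
  have n1: "n - 1 + 1 = n" "n - 1 \<noteq> n" using n_ge_2 by auto
  have "perm i j = (if j = n then n - 1 else if j = n - 1 then n else j)"
    unfolding perm_def * n1 transpose_def using n1 by simp
  moreover have "eps i j = (if j = n \<or> j = n - 1 then 1 else - 1)" unfolding eps_def * n1 by auto
  ultimately show ?thesis
    using False x_closed[OF perm_closed[OF i j]]
    by (auto simp: \<sigma>_def neg_int_mult)
qed

lemma \<kappa>_eq: "i \<in> {1..n} \<Longrightarrow> \<kappa> i j = [(coef i j)] \<cdot> \<one>"
  using n_ge_2 by (auto simp: \<kappa>_def coef_def lower_def \<eta>_def neg_int_mult)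

text \<open>The common form of the rules for moving an operator past a variable.\<close>

lemma D_x:
  assumes "i \<in> {1..n}" "j \<in> {1..n}" "f \<in> carrier P"
  shows "D i (x j \<otimes> f) = [(coef i j)] \<cdot> f \<oplus> [(eps i j)] \<cdot> (x (perm i j) \<otimes> D i f)"
  using demazure_props(4)[OF assms(1) x_closed[OF assms(2)] assms(3)] assms perm_closed[OF assms(1,2)]
  by (simp add: odd_refl_props(2) demazure_props(3) \<sigma>_eq \<kappa>_eq add_pow_ldistr_int del: atLeastAtMost_iff)

lemma D_D_x:
  assumes i: "i \<in> {1..n}" and k: "k \<in> {1..n}" and j: "j \<in> {1..n}" and f: "f \<in> carrier P"
  shows "D i (D k (x j \<otimes> f)) = [(coef k j)] \<cdot> D i f \<oplus> ([(eps k j * coef i (perm k j))] \<cdot> D k f \<oplus>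
    [(eps k j * eps i (perm k j))] \<cdot> (x (perm i (perm k j)) \<otimes> D i (D k f)))"
proof -
  note pc = perm_closed[OF k j] perm_closed[OF i perm_closed[OF k j]]
  show ?thesis
    using assms pc
    by (simp add: D_x D_add D_int add.int_pow_distrib add.int_pow_pow mult.commute del: atLeastAtMost_iff)
qed

text \<open>Like all relations between the operators, this one is checked on \<open>1\<close> and then propagated: both
  sides move past a variable in the same way.\<close>

lemma D_relation_square:
  assumes i: "i \<in> {1..n}" and f: "f \<in> carrier P"
  shows "D i (D i f) = \<zero>"
  using f
proof (induction rule: P_induct)
  case (gen j f)
  have "coef i j + eps i j * coef i (perm i j) = 0"
    by (simp add: coef_def eps_def perm_def \<eta>_def transpose_def)
  then have "[(coef i j)] \<cdot> D i f \<oplus> [(eps i j * coef i (perm i j))] \<cdot> D i f = \<zero>"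
    using i gen(2) by (simp add: add.int_pow_mult[symmetric] del: atLeastAtMost_iff)
  then show ?case
    using D_D_x[OF i i gen(1,2)] gen i perm_closed[OF i perm_closed[OF i gen(1)]]
    by (simp del: atLeastAtMost_iff)
qed (use i in \<open>simp_all add: demazure_props(2) D_zero D_add D_neg\<close>)

text \<open>Moving both sides past \<open>x\<^sub>j\<close> gives the same combination of single operators, and the same leading
  term, provided that the listed identities hold.\<close>

lemma D_relation_commute:
  assumes i: "i \<in> {1..n}" and k: "k \<in> {1..n}" and f: "f \<in> carrier P"
    and c1: "\<And>j. coef k j = \<epsilon> * (eps i j * coef k (perm i j))"
    and c2: "\<And>j. eps k j * coef i (perm k j) = \<epsilon> * coef i j"
    and c3: "\<And>j. eps k j * eps i (perm k j) = eps i j * eps k (perm i j)"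
    and c4: "\<And>j. perm i (perm k j) = perm k (perm i j)"
  shows "D i (D k f) = [(\<epsilon>::int)] \<cdot> D k (D i f)"
  using f
proof (induction rule: P_induct)
  case (gen j f)
  note pc = perm_closed[OF k perm_closed[OF i gen(1)]]
  show ?case
    unfolding D_D_x[OF i k gen(1,2)] D_D_x[OF k i gen(1,2)] gen(3) c4
    unfolding c1[of j] c2[of j] c3[of j]
    using i k gen(1,2) pc
    by (simp add: add.int_pow_distrib add.int_pow_pow add_pow_rdistr_int a_lcomm mult.commute
        mult.left_commute del: atLeastAtMost_iff)
qed (use i k in \<open>simp_all add: demazure_props(2) D_zero D_add D_neg add.int_pow_distrib add.int_pow_inv\<close>)

text \<open>The terms containing the square of an operator have dropped out.\<close>

lemma D_D_D_x:
  assumes i: "i \<in> {1..n}" and k: "k \<in> {1..n}" and j: "j \<in> {1..n}" and f: "f \<in> carrier P"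
  shows "D i (D k (D i (x j \<otimes> f))) = [(coef i j)] \<cdot> D i (D k f) \<oplus>
    ([(eps i j * eps k (perm i j) * coef i (perm k (perm i j)))] \<cdot> D k (D i f) \<oplus>
    [(eps i j * eps k (perm i j) * eps i (perm k (perm i j)))] \<cdot>
      (x (perm i (perm k (perm i j))) \<otimes> D i (D k (D i f))))"
proof -
  note pc = perm_closed[OF i j] perm_closed[OF k perm_closed[OF i j]]
    perm_closed[OF i perm_closed[OF k perm_closed[OF i j]]]
  show ?thesis
    using assms pc
    by (simp add: D_D_x D_x D_add D_int D_relation_square D_zero add.int_pow_distrib add.int_pow_pow
        mult.commute mult.left_commute del: atLeastAtMost_iff)
qed

lemma D_relation_braid:
  assumes i: "i \<in> {1..n}" and k: "k \<in> {1..n}" and f: "f \<in> carrier P"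
    and c1: "\<And>j. eps i j * eps k (perm i j) * coef i (perm k (perm i j)) = coef k j"
    and c2: "\<And>j. eps k j * eps i (perm k j) * coef k (perm i (perm k j)) = coef i j"
    and c3: "\<And>j. eps i j * eps k (perm i j) * eps i (perm k (perm i j)) =
                  eps k j * eps i (perm k j) * eps k (perm i (perm k j))"
    and c4: "\<And>j. perm i (perm k (perm i j)) = perm k (perm i (perm k j))"
  shows "D i (D k (D i f)) = D k (D i (D k f))"
  using f
proof (induction rule: P_induct)
  case (gen j f)
  note pc = perm_closed[OF k perm_closed[OF i perm_closed[OF k gen(1)]]]
  show ?case
    unfolding D_D_D_x[OF i k gen(1,2)] D_D_D_x[OF k i gen(1,2)] gen(3) c4
    unfolding c1[of j] c2[of j] c3[of j]
    using i k gen(1,2) pc by (simp add: a_lcomm del: atLeastAtMost_iff)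
qed (use i k in \<open>simp_all add: demazure_props(2) D_zero D_add D_neg\<close>)

lemma D_anticommute:
  assumes "i \<in> {1..n}" "k \<in> {1..n}" "f \<in> carrier P" "lower i + 1 < lower k \<or> lower k + 1 < lower i"
  shows "D i (D k f) = \<ominus> D k (D i f)"
proof -
  have "D i (D k f) = [(- 1::int)] \<cdot> D k (D i f)"
    using assms(4) by (intro D_relation_commute assms(1-3))
      (auto simp: coef_def eps_def perm_def transpose_def)
  then show ?thesis using assms by (simp add: neg_int_mult)
qed

lemma D_commute_last:
  assumes f: "f \<in> carrier P"
  shows "D n (D (n - 1) f) = D (n - 1) (D n f)"
proof -
  have mem: "n \<in> {1..n}" "n - 1 \<in> {1..n}" using n_ge_2 by auto
  have l: "lower n = n - 1" "lower (n - 1) = n - 1" "\<eta> n = - 1" "\<eta> (n - 1) = 1"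
    using n_ge_2 by (auto simp: lower_def \<eta>_def)
  have "D n (D (n - 1) f) = [(1::int)] \<cdot> D (n - 1) (D n f)"
    by (intro D_relation_commute mem f) (auto simp: coef_def eps_def perm_def transpose_def l)
  then show ?thesis using f mem by simp
qed

lemma D_braid:
  assumes "i \<in> {1..n}" "k \<in> {1..n}" "f \<in> carrier P" "i < n" "lower k = i + 1"
  shows "D i (D k (D i f)) = D k (D i (D k f))"
proof -
  have l: "lower i = i" "\<eta> i = 1" "\<eta> k * \<eta> k = 1" using assms by (auto simp: lower_def \<eta>_def)
  show ?thesis
    using assms(4,5) by (intro D_relation_braid assms(1-3))
      (auto simp: coef_def eps_def perm_def transpose_def l)
qed

end

section \<open>The nilHecke algebra and its action\<close>

text \<open>The defining relations of the nilHecke algebra, read in an arbitrary ring. One comparison with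
  the presentation then serves the algebra, its action and its reversal.\<close>

definition nh_relations ::
    "nat \<Rightarrow> ('a, 'm) ring_scheme \<Rightarrow> (nat \<Rightarrow> 'a) \<Rightarrow> (nat \<Rightarrow> 'a) \<Rightarrow> bool" where
  "nh_relations n R x d \<longleftrightarrow>
    (\<forall>i j. i \<in> {1..n} \<and> j \<in> {1..n} \<and> i \<noteq> j \<longrightarrow> x i \<otimes>\<^bsub>R\<^esub> x j \<oplus>\<^bsub>R\<^esub> x j \<otimes>\<^bsub>R\<^esub> x i = \<zero>\<^bsub>R\<^esub>) \<and>
    (\<forall>i. 1 \<le> i \<and> i < n \<longrightarrow> d i \<otimes>\<^bsub>R\<^esub> d i = \<zero>\<^bsub>R\<^esub>) \<and>
    (\<forall>i. 1 \<le> i \<and> i + 1 < n \<longrightarrow>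
      d i \<otimes>\<^bsub>R\<^esub> d (i + 1) \<otimes>\<^bsub>R\<^esub> d i = d (i + 1) \<otimes>\<^bsub>R\<^esub> d i \<otimes>\<^bsub>R\<^esub> d (i + 1)) \<and>
    (\<forall>i j. 1 \<le> i \<and> i < n \<and> 1 \<le> j \<and> j < n \<and> \<bar>int i - int j\<bar> > 1 \<longrightarrow>
      d i \<otimes>\<^bsub>R\<^esub> d j \<oplus>\<^bsub>R\<^esub> d j \<otimes>\<^bsub>R\<^esub> d i = \<zero>\<^bsub>R\<^esub>) \<and>
    (\<forall>i. 1 \<le> i \<and> i < n \<longrightarrow> x i \<otimes>\<^bsub>R\<^esub> d i \<oplus>\<^bsub>R\<^esub> d i \<otimes>\<^bsub>R\<^esub> x (i + 1) = \<one>\<^bsub>R\<^esub>) \<and>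
    (\<forall>i. 1 \<le> i \<and> i < n \<longrightarrow> d i \<otimes>\<^bsub>R\<^esub> x i \<oplus>\<^bsub>R\<^esub> x (i + 1) \<otimes>\<^bsub>R\<^esub> d i = \<one>\<^bsub>R\<^esub>) \<and>
    (\<forall>i j. 1 \<le> i \<and> i < n \<and> j \<in> {1..n} \<and> j \<noteq> i \<and> j \<noteq> i + 1 \<longrightarrow>
      d i \<otimes>\<^bsub>R\<^esub> x j \<oplus>\<^bsub>R\<^esub> x j \<otimes>\<^bsub>R\<^esub> d i = \<zero>\<^bsub>R\<^esub>) \<and>
    d n \<otimes>\<^bsub>R\<^esub> d n = \<zero>\<^bsub>R\<^esub> \<and>
    (3 \<le> n \<longrightarrow> d n \<otimes>\<^bsub>R\<^esub> d (n - 2) \<otimes>\<^bsub>R\<^esub> d n = d (n - 2) \<otimes>\<^bsub>R\<^esub> d n \<otimes>\<^bsub>R\<^esub> d (n - 2)) \<and>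
    (\<forall>i. 1 \<le> i \<and> i + 3 \<le> n \<longrightarrow> d n \<otimes>\<^bsub>R\<^esub> d i \<oplus>\<^bsub>R\<^esub> d i \<otimes>\<^bsub>R\<^esub> d n = \<zero>\<^bsub>R\<^esub>) \<and>
    d n \<otimes>\<^bsub>R\<^esub> d (n - 1) \<ominus>\<^bsub>R\<^esub> d (n - 1) \<otimes>\<^bsub>R\<^esub> d n = \<zero>\<^bsub>R\<^esub> \<and>
    x (n - 1) \<otimes>\<^bsub>R\<^esub> d n \<ominus>\<^bsub>R\<^esub> d n \<otimes>\<^bsub>R\<^esub> x n = \<one>\<^bsub>R\<^esub> \<and>
    d n \<otimes>\<^bsub>R\<^esub> x (n - 1) \<ominus>\<^bsub>R\<^esub> x n \<otimes>\<^bsub>R\<^esub> d n = \<one>\<^bsub>R\<^esub> \<and>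
    (\<forall>i. 1 \<le> i \<and> i + 2 \<le> n \<longrightarrow> d n \<otimes>\<^bsub>R\<^esub> x i \<oplus>\<^bsub>R\<^esub> x i \<otimes>\<^bsub>R\<^esub> d n = \<zero>\<^bsub>R\<^esub>)"

context type_D begin

lemma nh_gen_closed:
  "1 \<le> i \<Longrightarrow> i \<le> n \<Longrightarrow> free_gen (X i) \<in> carrier (free_alg (nh_gens n))"
  "1 \<le> i \<Longrightarrow> i \<le> n \<Longrightarrow> free_gen (Dl i) \<in> carrier (free_alg (nh_gens n))"
  by (auto intro!: free_gen_closed simp: nh_gens_def)

lemma last_bounds: "1 \<le> n - 1" "1 \<le> n"
  using n_ge_2 by auto

lemma ball_family_iff:
  "(\<forall>(l, r) \<in> {(f i, g i) | i. P i}. Q l r) \<longleftrightarrow> (\<forall>i. P i \<longrightarrow> Q (f i) (g i))"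
  "(\<forall>(l, r) \<in> {(f2 i j, g2 i j) | i j. P2 i j}. Q l r) \<longleftrightarrow> (\<forall>i j. P2 i j \<longrightarrow> Q (f2 i j) (g2 i j))"
  "(\<forall>(l, r) \<in> {(a, b)}. Q l r) \<longleftrightarrow> Q a b"
  "(\<forall>(l, r) \<in> (if c then {(a, b)} else {}). Q l r) \<longleftrightarrow> (c \<longrightarrow> Q a b)"
  by auto

lemma nh_presentation: "presentation (nh_gens n) (nh_rels n)"
proof (unfold_locales)
  interpret F: ring "free_alg (nh_gens n)" by (rule free_alg_ring)
  have "\<forall>(l, r) \<in> nh_rels n. l \<in> carrier (free_alg (nh_gens n)) \<and> r \<in> carrier (free_alg (nh_gens n))"
    unfolding nh_rels_def Let_def ball_Un ball_family_iff atLeastAtMost_iff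
    by (intro conjI allI impI) (simp_all add: nh_gen_closed last_bounds)
  then show "(l, r) \<in> nh_rels n \<Longrightarrow> l \<in> carrier (free_alg (nh_gens n)) \<and> r \<in> carrier (free_alg (nh_gens n))"
    for l r by blast
qed

text \<open>A homomorphism from the free ring identifies the two sides of every relation iff the images of
  the letters satisfy it.\<close>

lemma nh_rels_iff:
  assumes "ring_hom_ring (free_alg (nh_gens n)) R e"
  shows "(\<forall>(l, r) \<in> nh_rels n. e l = e r) \<longleftrightarrow>
    nh_relations n R (\<lambda>i. e (free_gen (X i))) (\<lambda>i. e (free_gen (Dl i)))"
proof -
  interpret e: ring_hom_ring "free_alg (nh_gens n)" R e by (rule assms)
  show ?thesis
    unfolding nh_rels_def Let_def ball_Un ball_family_iff nh_relations_def conj_assoc atLeastAtMost_iff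
    by (intro arg_cong2[of _ _ _ _ "(\<and>)"] all_cong1 imp_cong refl)
       (simp_all add: nh_gen_closed last_bounds a_minus_def)
qed

end

context type_D begin

lemma nh_relations_cong:
  assumes "\<And>i. i \<in> {1..n} \<Longrightarrow> x i = x' i" "\<And>i. i \<in> {1..n} \<Longrightarrow> d i = d' i"
  shows "nh_relations n R x d = nh_relations n R x' d'"
  unfolding nh_relations_def
  by (intro arg_cong2[of _ _ _ _ "(\<and>)"] all_cong1 imp_cong refl)
     (simp_all add: assms last_bounds)

end

lemma nh_relationsD:
  assumes "nh_relations n R x d"
  shows "i \<in> {1..n} \<Longrightarrow> j \<in> {1..n} \<Longrightarrow> i \<noteq> j \<Longrightarrow> x i \<otimes>\<^bsub>R\<^esub> x j \<oplus>\<^bsub>R\<^esub> x j \<otimes>\<^bsub>R\<^esub> x i = \<zero>\<^bsub>R\<^esub>"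
    and "1 \<le> i \<Longrightarrow> i < n \<Longrightarrow> d i \<otimes>\<^bsub>R\<^esub> d i = \<zero>\<^bsub>R\<^esub>"
    and "1 \<le> i \<Longrightarrow> i + 1 < n \<Longrightarrow> d i \<otimes>\<^bsub>R\<^esub> d (i + 1) \<otimes>\<^bsub>R\<^esub> d i = d (i + 1) \<otimes>\<^bsub>R\<^esub> d i \<otimes>\<^bsub>R\<^esub> d (i + 1)"
    and "1 \<le> i \<Longrightarrow> i < n \<Longrightarrow> 1 \<le> j \<Longrightarrow> j < n \<Longrightarrow> \<bar>int i - int j\<bar> > 1 \<Longrightarrow> d i \<otimes>\<^bsub>R\<^esub> d j \<oplus>\<^bsub>R\<^esub> d j \<otimes>\<^bsub>R\<^esub> d i = \<zero>\<^bsub>R\<^esub>"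
    and "1 \<le> i \<Longrightarrow> i < n \<Longrightarrow> x i \<otimes>\<^bsub>R\<^esub> d i \<oplus>\<^bsub>R\<^esub> d i \<otimes>\<^bsub>R\<^esub> x (i + 1) = \<one>\<^bsub>R\<^esub>"
    and "1 \<le> i \<Longrightarrow> i < n \<Longrightarrow> d i \<otimes>\<^bsub>R\<^esub> x i \<oplus>\<^bsub>R\<^esub> x (i + 1) \<otimes>\<^bsub>R\<^esub> d i = \<one>\<^bsub>R\<^esub>"
    and "1 \<le> i \<Longrightarrow> i < n \<Longrightarrow> j \<in> {1..n} \<Longrightarrow> j \<noteq> i \<Longrightarrow> j \<noteq> i + 1 \<Longrightarrow> d i \<otimes>\<^bsub>R\<^esub> x j \<oplus>\<^bsub>R\<^esub> x j \<otimes>\<^bsub>R\<^esub> d i = \<zero>\<^bsub>R\<^esub>"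
    and "d n \<otimes>\<^bsub>R\<^esub> d n = \<zero>\<^bsub>R\<^esub>"
    and "3 \<le> n \<Longrightarrow> d n \<otimes>\<^bsub>R\<^esub> d (n - 2) \<otimes>\<^bsub>R\<^esub> d n = d (n - 2) \<otimes>\<^bsub>R\<^esub> d n \<otimes>\<^bsub>R\<^esub> d (n - 2)"
    and "1 \<le> i \<Longrightarrow> i + 3 \<le> n \<Longrightarrow> d n \<otimes>\<^bsub>R\<^esub> d i \<oplus>\<^bsub>R\<^esub> d i \<otimes>\<^bsub>R\<^esub> d n = \<zero>\<^bsub>R\<^esub>"
    and "d n \<otimes>\<^bsub>R\<^esub> d (n - 1) \<ominus>\<^bsub>R\<^esub> d (n - 1) \<otimes>\<^bsub>R\<^esub> d n = \<zero>\<^bsub>R\<^esub>"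
    and "x (n - 1) \<otimes>\<^bsub>R\<^esub> d n \<ominus>\<^bsub>R\<^esub> d n \<otimes>\<^bsub>R\<^esub> x n = \<one>\<^bsub>R\<^esub>"
    and "d n \<otimes>\<^bsub>R\<^esub> x (n - 1) \<ominus>\<^bsub>R\<^esub> x n \<otimes>\<^bsub>R\<^esub> d n = \<one>\<^bsub>R\<^esub>"
    and "1 \<le> i \<Longrightarrow> i + 2 \<le> n \<Longrightarrow> d n \<otimes>\<^bsub>R\<^esub> x i \<oplus>\<^bsub>R\<^esub> x i \<otimes>\<^bsub>R\<^esub> d n = \<zero>\<^bsub>R\<^esub>"
proof -
  note rel = assms[unfolded nh_relations_def]
  show "i \<in> {1..n} \<Longrightarrow> j \<in> {1..n} \<Longrightarrow> i \<noteq> j \<Longrightarrow> x i \<otimes>\<^bsub>R\<^esub> x j \<oplus>\<^bsub>R\<^esub> x j \<otimes>\<^bsub>R\<^esub> x i = \<zero>\<^bsub>R\<^esub>" for i j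
    using rel[THEN conjunct1] by simp
  show "1 \<le> i \<Longrightarrow> i < n \<Longrightarrow> d i \<otimes>\<^bsub>R\<^esub> d i = \<zero>\<^bsub>R\<^esub>" for i
    using rel[THEN conjunct2, THEN conjunct1] by simp
  show "1 \<le> i \<Longrightarrow> i + 1 < n \<Longrightarrow> d i \<otimes>\<^bsub>R\<^esub> d (i + 1) \<otimes>\<^bsub>R\<^esub> d i = d (i + 1) \<otimes>\<^bsub>R\<^esub> d i \<otimes>\<^bsub>R\<^esub> d (i + 1)" for i
    using rel[THEN conjunct2, THEN conjunct2, THEN conjunct1] by simp
  show "1 \<le> i \<Longrightarrow> i < n \<Longrightarrow> 1 \<le> j \<Longrightarrow> j < n \<Longrightarrow> \<bar>int i - int j\<bar> > 1 \<Longrightarrow> d i \<otimes>\<^bsub>R\<^esub> d j \<oplus>\<^bsub>R\<^esub> d j \<otimes>\<^bsub>R\<^esub> d i = \<zero>\<^bsub>R\<^esub>" for i j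
    using rel[THEN conjunct2, THEN conjunct2, THEN conjunct2, THEN conjunct1] by simp
  show "1 \<le> i \<Longrightarrow> i < n \<Longrightarrow> x i \<otimes>\<^bsub>R\<^esub> d i \<oplus>\<^bsub>R\<^esub> d i \<otimes>\<^bsub>R\<^esub> x (i + 1) = \<one>\<^bsub>R\<^esub>" for i
    using rel[THEN conjunct2, THEN conjunct2, THEN conjunct2, THEN conjunct2, THEN conjunct1] by simp
  show "1 \<le> i \<Longrightarrow> i < n \<Longrightarrow> d i \<otimes>\<^bsub>R\<^esub> x i \<oplus>\<^bsub>R\<^esub> x (i + 1) \<otimes>\<^bsub>R\<^esub> d i = \<one>\<^bsub>R\<^esub>" for i
    using rel[THEN conjunct2, THEN conjunct2, THEN conjunct2, THEN conjunct2, THEN conjunct2, THEN conjunct1] by simp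
  show "1 \<le> i \<Longrightarrow> i < n \<Longrightarrow> j \<in> {1..n} \<Longrightarrow> j \<noteq> i \<Longrightarrow> j \<noteq> i + 1 \<Longrightarrow> d i \<otimes>\<^bsub>R\<^esub> x j \<oplus>\<^bsub>R\<^esub> x j \<otimes>\<^bsub>R\<^esub> d i = \<zero>\<^bsub>R\<^esub>" for i j
    using rel[THEN conjunct2, THEN conjunct2, THEN conjunct2, THEN conjunct2, THEN conjunct2, THEN conjunct2, THEN conjunct1] by simp
  show "d n \<otimes>\<^bsub>R\<^esub> d n = \<zero>\<^bsub>R\<^esub>"
    using rel[THEN conjunct2, THEN conjunct2, THEN conjunct2, THEN conjunct2, THEN conjunct2, THEN conjunct2, THEN conjunct2, THEN conjunct1] by simp
  show "3 \<le> n \<Longrightarrow> d n \<otimes>\<^bsub>R\<^esub> d (n - 2) \<otimes>\<^bsub>R\<^esub> d n = d (n - 2) \<otimes>\<^bsub>R\<^esub> d n \<otimes>\<^bsub>R\<^esub> d (n - 2)"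
    using rel[THEN conjunct2, THEN conjunct2, THEN conjunct2, THEN conjunct2, THEN conjunct2, THEN conjunct2, THEN conjunct2, THEN conjunct2, THEN conjunct1] by simp
  show "1 \<le> i \<Longrightarrow> i + 3 \<le> n \<Longrightarrow> d n \<otimes>\<^bsub>R\<^esub> d i \<oplus>\<^bsub>R\<^esub> d i \<otimes>\<^bsub>R\<^esub> d n = \<zero>\<^bsub>R\<^esub>" for i
    using rel[THEN conjunct2, THEN conjunct2, THEN conjunct2, THEN conjunct2, THEN conjunct2, THEN conjunct2, THEN conjunct2, THEN conjunct2, THEN conjunct2, THEN conjunct1] by simp
  show "d n \<otimes>\<^bsub>R\<^esub> d (n - 1) \<ominus>\<^bsub>R\<^esub> d (n - 1) \<otimes>\<^bsub>R\<^esub> d n = \<zero>\<^bsub>R\<^esub>"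
    using rel[THEN conjunct2, THEN conjunct2, THEN conjunct2, THEN conjunct2, THEN conjunct2, THEN conjunct2, THEN conjunct2, THEN conjunct2, THEN conjunct2, THEN conjunct2, THEN conjunct1] by simp
  show "x (n - 1) \<otimes>\<^bsub>R\<^esub> d n \<ominus>\<^bsub>R\<^esub> d n \<otimes>\<^bsub>R\<^esub> x n = \<one>\<^bsub>R\<^esub>"
    using rel[THEN conjunct2, THEN conjunct2, THEN conjunct2, THEN conjunct2, THEN conjunct2, THEN conjunct2, THEN conjunct2, THEN conjunct2, THEN conjunct2, THEN conjunct2, THEN conjunct2, THEN conjunct1] by simp
  show "d n \<otimes>\<^bsub>R\<^esub> x (n - 1) \<ominus>\<^bsub>R\<^esub> x n \<otimes>\<^bsub>R\<^esub> d n = \<one>\<^bsub>R\<^esub>"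
    using rel[THEN conjunct2, THEN conjunct2, THEN conjunct2, THEN conjunct2, THEN conjunct2, THEN conjunct2, THEN conjunct2, THEN conjunct2, THEN conjunct2, THEN conjunct2, THEN conjunct2, THEN conjunct2, THEN conjunct1] by simp
  show "1 \<le> i \<Longrightarrow> i + 2 \<le> n \<Longrightarrow> d n \<otimes>\<^bsub>R\<^esub> x i \<oplus>\<^bsub>R\<^esub> x i \<otimes>\<^bsub>R\<^esub> d n = \<zero>\<^bsub>R\<^esub>" for i
    using rel[THEN conjunct2, THEN conjunct2, THEN conjunct2, THEN conjunct2, THEN conjunct2, THEN conjunct2, THEN conjunct2, THEN conjunct2, THEN conjunct2, THEN conjunct2, THEN conjunct2, THEN conjunct2, THEN conjunct2] by simp
qed

lemma NH_ring: "n \<ge> 2 \<Longrightarrow> ring (NH n)"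
proof -
  assume "n \<ge> 2"
  then interpret type_D n by unfold_locales
  interpret presentation "nh_gens n" "nh_rels n" by (rule nh_presentation)
  show ?thesis unfolding NH_def by (rule proj.S.ring_axioms)
qed

locale nil_hecke = skew_polynomials n P + N: ring N
  for n :: nat and P :: "(nat list \<Rightarrow> int) set ring" (structure)
    and N :: "(nh_gen list \<Rightarrow> int) set ring" +
  assumes N_NH: "N = NH n"
begin

lemma nh_x_closed: "i \<in> {1..n} \<Longrightarrow> nh_x n i \<in> carrier N"
  and nh_d_closed: "i \<in> {1..n} \<Longrightarrow> nh_d n i \<in> carrier N"
proof -
  interpret presentation "nh_gens n" "nh_rels n" by (rule nh_presentation)
  assume "i \<in> {1..n}"
  then have "X i \<in> nh_gens n" "Dl i \<in> nh_gens n" by (simp_all add: nh_gens_def)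
  then show "nh_x n i \<in> carrier N" "nh_d n i \<in> carrier N"
    unfolding N_NH NH_def nh_x_def nh_d_def by (blast intro: gen_closed)+
qed

lemma nh_relations_N: "nh_relations n N (nh_x n) (nh_d n)"
proof -
  interpret presentation "nh_gens n" "nh_rels n" by (rule nh_presentation)
  have "\<forall>(l, r) \<in> nh_rels n. proj l = proj r" using proj_rel by blast
  then show ?thesis
    unfolding nh_rels_iff[OF proj.ring_hom_ring_axioms] N_NH NH_def nh_x_def[abs_def]
      nh_d_def[abs_def] presented_gen_def .
qed

lemma N_induct [consumes 1, case_names one x d add neg]:
  assumes "a \<in> carrier N"
    and one: "Q \<one>\<^bsub>N\<^esub>"
    and x: "\<And>i a. i \<in> {1..n} \<Longrightarrow> a \<in> carrier N \<Longrightarrow> Q a \<Longrightarrow> Q (nh_x n i \<otimes>\<^bsub>N\<^esub> a)"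
    and d: "\<And>i a. i \<in> {1..n} \<Longrightarrow> a \<in> carrier N \<Longrightarrow> Q a \<Longrightarrow> Q (nh_d n i \<otimes>\<^bsub>N\<^esub> a)"
    and add: "\<And>a b. a \<in> carrier N \<Longrightarrow> b \<in> carrier N \<Longrightarrow> Q a \<Longrightarrow> Q b \<Longrightarrow> Q (a \<oplus>\<^bsub>N\<^esub> b)"
    and neg: "\<And>a. a \<in> carrier N \<Longrightarrow> Q a \<Longrightarrow> Q (\<ominus>\<^bsub>N\<^esub> a)"
  shows "Q a"
proof -
  interpret presentation "nh_gens n" "nh_rels n" by (rule nh_presentation)
  show ?thesis
  proof (rule presented_induct[of a Q])
    fix g b assume g: "g \<in> nh_gens n" and b: "b \<in> carrier (presented_alg (nh_gens n) (nh_rels n))" "Q b"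
    show "Q (presented_gen (nh_gens n) (nh_rels n) g \<otimes>\<^bsub>presented_alg (nh_gens n) (nh_rels n)\<^esub> b)"
      using g x[of _ b] d[of _ b] b unfolding nh_gens_def N_NH NH_def nh_x_def nh_d_def by blast
  qed (use assms in \<open>unfold N_NH NH_def, blast+\<close>)
qed

lemma N_hom_exists:
  assumes R: "ring R" and x': "x' \<in> {1..n} \<rightarrow> carrier R" and d': "d' \<in> {1..n} \<rightarrow> carrier R"
    and rel: "nh_relations n R x' d'"
  shows "\<exists>h. h \<in> ring_hom N R \<inter> extensional (carrier N) \<and>
    (\<forall>i\<in>{1..n}. h (nh_x n i) = x' i) \<and> (\<forall>i\<in>{1..n}. h (nh_d n i) = d' i)"
proof -
  interpret presentation "nh_gens n" "nh_rels n" by (rule nh_presentation)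
  have "\<exists>h. h \<in> ring_hom Q R \<inter> extensional (carrier Q) \<and>
      (\<forall>g\<in>nh_gens n. h (presented_gen (nh_gens n) (nh_rels n) g) = case_nh_gen x' d' g)"
  proof (rule hom_exists[OF R])
    show "case_nh_gen x' d' \<in> nh_gens n \<rightarrow> carrier R"
      using x' d' by (auto simp: nh_gens_def)
    fix e l r
    assume e: "ring_hom_ring F R e" and gen: "\<And>g. g \<in> nh_gens n \<Longrightarrow> e (free_gen g) = case_nh_gen x' d' g"
      and lr: "(l, r) \<in> nh_rels n"
    have "nh_relations n R (\<lambda>i. e (free_gen (X i))) (\<lambda>i. e (free_gen (Dl i)))
        = nh_relations n R x' d'"
      by (rule nh_relations_cong) (simp_all add: gen nh_gens_def)
    then show "e l = e r" using rel nh_rels_iff[OF e] lr by blast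
  qed
  then show ?thesis unfolding N_NH NH_def nh_x_def nh_d_def nh_gens_def by force
qed

lemma N_hom_unique:
  assumes "ring R"
    and "h \<in> ring_hom N R \<inter> extensional (carrier N)" "h' \<in> ring_hom N R \<inter> extensional (carrier N)"
    and "\<And>i. i \<in> {1..n} \<Longrightarrow> h (nh_x n i) = h' (nh_x n i)"
    and "\<And>i. i \<in> {1..n} \<Longrightarrow> h (nh_d n i) = h' (nh_d n i)"
  shows "h = h'"
proof -
  interpret presentation "nh_gens n" "nh_rels n" by (rule nh_presentation)
  show ?thesis
  proof (rule hom_unique[OF assms(1)])
    fix g assume "g \<in> nh_gens n"
    then show "h (presented_gen (nh_gens n) (nh_rels n) g) = h' (presented_gen (nh_gens n) (nh_rels n) g)"
      using assms(4,5) unfolding nh_gens_def nh_x_def nh_d_def by blast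
  qed (use assms(2,3) in \<open>unfold N_NH NH_def, blast+\<close>)
qed

sublocale N: nil_coxeter n N "nh_d n"
proof
  note rel = nh_relationsD[OF nh_relations_N]
  fix i assume i: "i \<in> {1..n}"
  then show "nh_d n i \<in> carrier N" by (rule nh_d_closed)
  show "nh_d n i \<otimes>\<^bsub>N\<^esub> nh_d n i = \<zero>\<^bsub>N\<^esub>" using rel(2,8) letter_cases[OF i] by blast
next
  note rel = nh_relationsD[OF nh_relations_N]
  fix i j assume i: "i \<in> {1..n}" and j: "j \<in> {1..n}"
  let ?d = "nh_d n"
  have anti: "eq_upto_sign N (?d i \<otimes>\<^bsub>N\<^esub> ?d j) (?d j \<otimes>\<^bsub>N\<^esub> ?d i)"
    if "?d i \<otimes>\<^bsub>N\<^esub> ?d j \<oplus>\<^bsub>N\<^esub> ?d j \<otimes>\<^bsub>N\<^esub> ?d i = \<zero>\<^bsub>N\<^esub> \<or> ?d j \<otimes>\<^bsub>N\<^esub> ?d i \<oplus>\<^bsub>N\<^esub> ?d i \<otimes>\<^bsub>N\<^esub> ?d j = \<zero>\<^bsub>N\<^esub>"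
    using that N.minus_equality[of "?d i \<otimes>\<^bsub>N\<^esub> ?d j" "?d j \<otimes>\<^bsub>N\<^esub> ?d i"] nh_d_closed[OF i] nh_d_closed[OF j]
    by (auto simp: eq_upto_sign_def N.a_comm)
  have comm: "?d n \<otimes>\<^bsub>N\<^esub> ?d (n - 1) = ?d (n - 1) \<otimes>\<^bsub>N\<^esub> ?d n"
  proof -
    have mem: "n \<in> {1..n}" "n - 1 \<in> {1..n}" using n_ge_2 by auto
    have "?d n \<otimes>\<^bsub>N\<^esub> ?d (n - 1) \<ominus>\<^bsub>N\<^esub> ?d (n - 1) \<otimes>\<^bsub>N\<^esub> ?d n = \<zero>\<^bsub>N\<^esub>" by (rule rel(11))
    then show ?thesis
      using N.minus_equality[of "?d n \<otimes>\<^bsub>N\<^esub> ?d (n - 1)" "\<ominus>\<^bsub>N\<^esub> (?d (n - 1) \<otimes>\<^bsub>N\<^esub> ?d n)"]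
        mem[THEN nh_d_closed] by (simp add: a_minus_def)
  qed
  {
    assume ij: "i \<noteq> j" "\<not> adjacent i j"
    consider "i < n" "j < n" "\<bar>int i - int j\<bar> > 1" | "i = n" "j = n - 1" | "j = n" "i = n - 1"
      | "i = n" "j + 3 \<le> n" | "j = n" "i + 3 \<le> n"
    proof -
      have "(i < n \<and> j < n \<and> \<bar>int i - int j\<bar> > 1) \<or> (i = n \<and> (j = n - 1 \<or> j + 3 \<le> n)) \<or>
        (j = n \<and> (i = n - 1 \<or> i + 3 \<le> n))"
        using letter_cases[OF i] letter_cases[OF j] ij unfolding adjacent_def by (elim disjE) auto
      then show thesis using that by blast
    qed
    then show "eq_upto_sign N (?d i \<otimes>\<^bsub>N\<^esub> ?d j) (?d j \<otimes>\<^bsub>N\<^esub> ?d i)"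
    proof cases
      case 1
      then show ?thesis using i j by (intro anti disjI1 rel(4)) simp_all
    next
      case 2
      then show ?thesis using comm by (simp add: eq_upto_sign_def)
    next
      case 3
      then show ?thesis using comm by (simp add: eq_upto_sign_def)
    next
      case 4
      then show ?thesis using j rel(10)[of j] by (intro anti disjI1) simp
    next
      case 5
      then show ?thesis using i rel(10)[of i] by (intro anti disjI2) simp
    qed
  }
  {
    assume adj: "adjacent i j"
    have assoc: "?d a \<otimes>\<^bsub>N\<^esub> (?d b \<otimes>\<^bsub>N\<^esub> ?d c) = ?d a \<otimes>\<^bsub>N\<^esub> ?d b \<otimes>\<^bsub>N\<^esub> ?d c"
      if "a \<in> {1..n}" "b \<in> {1..n}" "c \<in> {1..n}" for a b c
      using that[THEN nh_d_closed] by (simp add: N.m_assoc)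
    consider "i < n" "j = i + 1" "j < n" | "j < n" "i = j + 1" "i < n"
      | "i = n" "j = n - 2" "3 \<le> n" | "j = n" "i = n - 2" "3 \<le> n"
    proof -
      have "(i < n \<and> j = i + 1 \<and> j < n) \<or> (j < n \<and> i = j + 1 \<and> i < n) \<or>
        (i = n \<and> j = n - 2 \<and> 3 \<le> n) \<or> (j = n \<and> i = n - 2 \<and> 3 \<le> n)"
        using adj i j unfolding adjacent_def by (elim disjE conjE) auto
      then show thesis using that by blast
    qed
    then show "?d i \<otimes>\<^bsub>N\<^esub> (?d j \<otimes>\<^bsub>N\<^esub> ?d i) = ?d j \<otimes>\<^bsub>N\<^esub> (?d i \<otimes>\<^bsub>N\<^esub> ?d j)"
      unfolding assoc[OF i j i] assoc[OF j i j]
      by cases (use i j rel(3)[of i] rel(3)[of j] rel(9) in simp_all)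
  }
qed

abbreviation "E \<equiv> end_ring P"

definition Lx :: "nat \<Rightarrow> (nat list \<Rightarrow> int) set \<Rightarrow> (nat list \<Rightarrow> int) set" where
  "Lx i = (\<lambda>f\<in>carrier P. x i \<otimes> f)"

sublocale E: ring E by (rule end_ring_ring)

lemma Lx_closed: "i \<in> {1..n} \<Longrightarrow> Lx i \<in> carrier E"
  unfolding end_ring_mem Lx_def by (auto simp: r_distr)

lemma Lx_apply: "f \<in> carrier P \<Longrightarrow> Lx i f = x i \<otimes> f"
  by (simp add: Lx_def)

lemma E_apply:
  assumes "f \<in> carrier P"
  shows "(a \<otimes>\<^bsub>E\<^esub> b) f = a (b f)" "(a \<oplus>\<^bsub>E\<^esub> b) f = a f \<oplus> b f" "\<one>\<^bsub>E\<^esub> f = f" "\<zero>\<^bsub>E\<^esub> f = \<zero>"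
  using assms by (simp_all add: end_ring_simps compose_def)

lemma E_neg_apply: "a \<in> carrier E \<Longrightarrow> f \<in> carrier P \<Longrightarrow> (\<ominus>\<^bsub>E\<^esub> a) f = \<ominus> a f"
proof -
  assume a: "a \<in> carrier E" and f: "f \<in> carrier P"
  have "(\<ominus>\<^bsub>E\<^esub> a) f \<oplus> a f = \<zero>" using E_apply(2)[OF f, of "\<ominus>\<^bsub>E\<^esub> a" a] a f
    by (simp add: E.l_neg E_apply)
  moreover have "(\<ominus>\<^bsub>E\<^esub> a) f \<in> carrier P" "a f \<in> carrier P"
    using a f E.a_inv_closed[OF a] by (auto simp: end_ring_mem)
  ultimately show ?thesis using minus_equality by metis
qed

lemma E_eqI: "a \<in> carrier E \<Longrightarrow> b \<in> carrier E \<Longrightarrow> (\<And>f. f \<in> carrier P \<Longrightarrow> a f = b f) \<Longrightarrow> a = b"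
  by (rule extensionalityI[of _ "carrier P"]) (auto simp: end_ring_mem)

lemma D_E: "i \<in> {1..n} \<Longrightarrow> D i \<in> carrier E"
  by (rule demazure_props(1))

lemma D_x_lt:
  assumes "1 \<le> i" "i < n" and f: "f \<in> carrier P"
  shows "D i (x i \<otimes> f) = f \<oplus> \<ominus> (x (i + 1) \<otimes> D i f)"
    "D i (x (i + 1) \<otimes> f) = f \<oplus> \<ominus> (x i \<otimes> D i f)"
    "j \<in> {1..n} \<Longrightarrow> j \<noteq> i \<Longrightarrow> j \<noteq> i + 1 \<Longrightarrow> D i (x j \<otimes> f) = \<ominus> (x j \<otimes> D i f)"
  using assms D_x[of i i f] D_x[of i "i + 1" f] D_x[of i j f]
  by (simp_all add: coef_def eps_def perm_def lower_def \<eta>_def neg_int_mult)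

lemma D_x_last:
  assumes f: "f \<in> carrier P"
  shows "D n (x n \<otimes> f) = \<ominus> f \<oplus> x (n - 1) \<otimes> D n f"
    "D n (x (n - 1) \<otimes> f) = f \<oplus> x n \<otimes> D n f"
    "1 \<le> j \<Longrightarrow> j + 2 \<le> n \<Longrightarrow> D n (x j \<otimes> f) = \<ominus> (x j \<otimes> D n f)"
proof -
  have n1: "n \<in> {1..n}" "n - 1 \<in> {1..n}" "n - 1 + 1 = n" "n - 1 \<noteq> n" "n \<noteq> n - 1" using n_ge_2 by auto
  have l: "lower n = n - 1" "\<eta> n = - 1" by (simp_all add: lower_def \<eta>_def)
  show "D n (x n \<otimes> f) = \<ominus> f \<oplus> x (n - 1) \<otimes> D n f"
    using D_x[OF n1(1) n1(1) f] n1 f unfolding coef_def eps_def perm_def l n1(3)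
    by (simp add: neg_int_mult del: atLeastAtMost_iff)
  show "D n (x (n - 1) \<otimes> f) = f \<oplus> x n \<otimes> D n f"
    using D_x[OF n1(1) n1(2) f] n1 f unfolding coef_def eps_def perm_def l n1(3)
    by (simp add: neg_int_mult del: atLeastAtMost_iff)
  assume j: "1 \<le> j" "j + 2 \<le> n"
  then have "j \<in> {1..n}" "j \<noteq> n" "j \<noteq> n - 1" by auto
  then show "D n (x j \<otimes> f) = \<ominus> (x j \<otimes> D n f)"
    using D_x[OF n1(1) _ f, of j] n1 f unfolding coef_def eps_def perm_def l n1(3)
    by (simp add: neg_int_mult del: atLeastAtMost_iff)
qed

lemma nh_relations_E: "nh_relations n E Lx D"
proof -
  have lower: "lower i = i" if "i < n" for i using that by (simp add: lower_def)
  have lower_n: "lower n = n - 1" by (simp add: lower_def)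
  have mem: "n \<in> {1..n}" "n - 1 \<in> {1..n}" using n_ge_2 by auto
  note closed = Lx_closed D_E
  note simps = E_apply E_neg_apply Lx_apply D_x_lt D_x_last last_bounds a_minus_def
    a_assoc a_lcomm r_neg l_neg r_neg1 r_neg2
  have comm: "D n (D (n - 1) f) = D (n - 1) (D n f)" if "f \<in> carrier P" for f
    by (rule D_commute_last[OF that])
  have sq: "D i (D i f) = \<zero>" if "i \<in> {1..n}" "f \<in> carrier P" for i f
    by (rule D_relation_square[OF that])
  have anti: "D i (D j f) = \<ominus> D j (D i f)"
    if "i \<in> {1..n}" "j \<in> {1..n}" "lower i + 1 < lower j \<or> lower j + 1 < lower i" "f \<in> carrier P" for i j f
    by (rule D_anticommute) fact+
  have xx: "x i \<otimes> (x j \<otimes> f) \<oplus> x j \<otimes> (x i \<otimes> f) = \<zero>"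
    if "i \<in> {1..n}" "j \<in> {1..n}" "i \<noteq> j" "f \<in> carrier P" for i j f
  proof -
    have "x i \<otimes> (x j \<otimes> f) \<oplus> x j \<otimes> (x i \<otimes> f) = (x i \<otimes> x j \<oplus> x j \<otimes> x i) \<otimes> f"
      using that by (simp add: m_assoc l_distr)
    then show ?thesis using x_anticommute[OF that(1-3)] that by simp
  qed
  show ?thesis
    unfolding nh_relations_def
  proof (intro conjI allI impI; (elim conjE)?)
    fix i j assume "i \<in> {1..n}" "j \<in> {1..n}" "i \<noteq> j"
    then show "Lx i \<otimes>\<^bsub>E\<^esub> Lx j \<oplus>\<^bsub>E\<^esub> Lx j \<otimes>\<^bsub>E\<^esub> Lx i = \<zero>\<^bsub>E\<^esub>"
      by (intro E_eqI) (simp_all add: closed simps xx)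
  next
    fix i assume "1 \<le> i" "i < n"
    then show "D i \<otimes>\<^bsub>E\<^esub> D i = \<zero>\<^bsub>E\<^esub>" by (intro E_eqI) (simp_all add: closed E_apply sq)
  next
    fix i assume "1 \<le> i" "i + 1 < n"
    then show "D i \<otimes>\<^bsub>E\<^esub> D (i + 1) \<otimes>\<^bsub>E\<^esub> D i = D (i + 1) \<otimes>\<^bsub>E\<^esub> D i \<otimes>\<^bsub>E\<^esub> D (i + 1)"
      by (intro E_eqI) (simp_all add: closed E_apply D_braid[of i "i + 1"] lower)
  next
    fix i j assume ij: "1 \<le> i" "i < n" "1 \<le> j" "j < n" "\<bar>int i - int j\<bar> > 1"
    then have "lower i + 1 < lower j \<or> lower j + 1 < lower i" by (auto simp: lower)
    with ij show "D i \<otimes>\<^bsub>E\<^esub> D j \<oplus>\<^bsub>E\<^esub> D j \<otimes>\<^bsub>E\<^esub> D i = \<zero>\<^bsub>E\<^esub>"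
      by (intro E_eqI) (simp_all add: closed E_apply anti[of i j] l_neg)
  next
    fix i assume "1 \<le> i" "i < n"
    then show "Lx i \<otimes>\<^bsub>E\<^esub> D i \<oplus>\<^bsub>E\<^esub> D i \<otimes>\<^bsub>E\<^esub> Lx (i + 1) = \<one>\<^bsub>E\<^esub>"
      by (intro E_eqI) (simp_all add: closed simps)
  next
    fix i assume "1 \<le> i" "i < n"
    then show "D i \<otimes>\<^bsub>E\<^esub> Lx i \<oplus>\<^bsub>E\<^esub> Lx (i + 1) \<otimes>\<^bsub>E\<^esub> D i = \<one>\<^bsub>E\<^esub>"
      by (intro E_eqI) (simp_all add: closed simps)
  next
    fix i j assume "1 \<le> i" "i < n" "j \<in> {1..n}" "j \<noteq> i" "j \<noteq> i + 1"
    then show "D i \<otimes>\<^bsub>E\<^esub> Lx j \<oplus>\<^bsub>E\<^esub> Lx j \<otimes>\<^bsub>E\<^esub> D i = \<zero>\<^bsub>E\<^esub>"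
      by (intro E_eqI) (simp_all add: closed simps)
  next
    show "D n \<otimes>\<^bsub>E\<^esub> D n = \<zero>\<^bsub>E\<^esub>" using mem by (intro E_eqI) (simp_all add: closed E_apply sq)
  next
    assume "3 \<le> n"
    then have "n - 2 \<in> {1..n}" "n - 2 < n" "lower n = n - 2 + 1" by (auto simp: lower_def)
    with mem show "D n \<otimes>\<^bsub>E\<^esub> D (n - 2) \<otimes>\<^bsub>E\<^esub> D n = D (n - 2) \<otimes>\<^bsub>E\<^esub> D n \<otimes>\<^bsub>E\<^esub> D (n - 2)"
      by (intro E_eqI) (simp_all add: closed E_apply D_braid[of "n - 2" n] del: atLeastAtMost_iff)
  next
    fix i assume i: "1 \<le> i" "i + 3 \<le> n"
    then have "lower i + 1 < lower n" "i \<in> {1..n}" by (auto simp: lower lower_n)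
    with mem show "D n \<otimes>\<^bsub>E\<^esub> D i \<oplus>\<^bsub>E\<^esub> D i \<otimes>\<^bsub>E\<^esub> D n = \<zero>\<^bsub>E\<^esub>"
      by (intro E_eqI) (simp_all add: closed E_apply anti[of n i] l_neg del: atLeastAtMost_iff)
  next
    show "D n \<otimes>\<^bsub>E\<^esub> D (n - 1) \<ominus>\<^bsub>E\<^esub> D (n - 1) \<otimes>\<^bsub>E\<^esub> D n = \<zero>\<^bsub>E\<^esub>"
      using mem by (intro E_eqI)
        (simp_all add: closed E_apply E_neg_apply comm a_minus_def r_neg del: atLeastAtMost_iff)
  next
    show "Lx (n - 1) \<otimes>\<^bsub>E\<^esub> D n \<ominus>\<^bsub>E\<^esub> D n \<otimes>\<^bsub>E\<^esub> Lx n = \<one>\<^bsub>E\<^esub>"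
      using mem by (intro E_eqI)
        (simp_all add: closed simps minus_add del: atLeastAtMost_iff)
  next
    show "D n \<otimes>\<^bsub>E\<^esub> Lx (n - 1) \<ominus>\<^bsub>E\<^esub> Lx n \<otimes>\<^bsub>E\<^esub> D n = \<one>\<^bsub>E\<^esub>"
      using mem by (intro E_eqI)
        (simp_all add: closed simps del: atLeastAtMost_iff)
  next
    fix i assume "1 \<le> i" "i + 2 \<le> n"
    moreover from this have "i \<in> {1..n}" by auto
    ultimately show "D n \<otimes>\<^bsub>E\<^esub> Lx i \<oplus>\<^bsub>E\<^esub> Lx i \<otimes>\<^bsub>E\<^esub> D n = \<zero>\<^bsub>E\<^esub>"
      using mem by (intro E_eqI) (simp_all add: closed simps del: atLeastAtMost_iff)
  qed
qed

text \<open>Existence comes from \<open>nh_relations_E\<close>, uniqueness from the generators.\<close>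

lemma nh_act_props:
  shows "nh_act n \<in> ring_hom N E"
    and "\<And>i. i \<in> {1..n} \<Longrightarrow> nh_act n (nh_x n i) = Lx i"
    and "\<And>i. i \<in> {1..n} \<Longrightarrow> nh_act n (nh_d n i) = D i"
proof -
  have "\<exists>!h. h \<in> ring_hom N E \<inter> extensional (carrier N) \<and>
    (\<forall>i\<in>{1..n}. h (nh_x n i) = Lx i) \<and> (\<forall>i\<in>{1..n}. h (nh_d n i) = D i)"
  proof (rule ex_ex1I)
    show "\<exists>h. h \<in> ring_hom N E \<inter> extensional (carrier N) \<and>
      (\<forall>i\<in>{1..n}. h (nh_x n i) = Lx i) \<and> (\<forall>i\<in>{1..n}. h (nh_d n i) = D i)"
      by (rule N_hom_exists[OF E.ring_axioms _ _ nh_relations_E]) (use Lx_closed D_E in blast)+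
  next
    fix h h'
    assume "h \<in> ring_hom N E \<inter> extensional (carrier N) \<and>
        (\<forall>i\<in>{1..n}. h (nh_x n i) = Lx i) \<and> (\<forall>i\<in>{1..n}. h (nh_d n i) = D i)"
      and "h' \<in> ring_hom N E \<inter> extensional (carrier N) \<and>
        (\<forall>i\<in>{1..n}. h' (nh_x n i) = Lx i) \<and> (\<forall>i\<in>{1..n}. h' (nh_d n i) = D i)"
    then show "h = h'" by (intro N_hom_unique[OF E.ring_axioms]) simp_all
  qed
  from theI'[OF this]
  have "nh_act n \<in> ring_hom N E \<and> (\<forall>i\<in>{1..n}. nh_act n (nh_x n i) = Lx i) \<and>
      (\<forall>i\<in>{1..n}. nh_act n (nh_d n i) = D i)"
    unfolding nh_act_def P_Pol[symmetric] N_NH[symmetric] Lx_def by blast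
  then show "nh_act n \<in> ring_hom N E" "\<And>i. i \<in> {1..n} \<Longrightarrow> nh_act n (nh_x n i) = Lx i"
    "\<And>i. i \<in> {1..n} \<Longrightarrow> nh_act n (nh_d n i) = D i" by blast+
qed

end

section \<open>Linear independence of the skew monomials\<close>

text \<open>Integer functions of exponent vectors under pointwise addition, packed as a ring record so that its
  additive endomorphisms form a ring. The fields for multiplication are placeholders.\<close>

definition exponent_group :: "((nat \<Rightarrow> nat) \<Rightarrow> int) ring" where
  "exponent_group = \<lparr>carrier = UNIV, monoid.mult = (\<lambda>f g. f), one = (\<lambda>r. 0),
     ring.zero = (\<lambda>r. 0), add = (\<lambda>f g r. f r + g r)\<rparr>"

text \<open>Multiplication by \<open>x\<^sub>i\<close> on coefficient functions. The sign comes from moving \<open>x\<^sub>i\<close> past the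
  variables of smaller index.\<close>

definition raise :: "nat \<Rightarrow> ((nat \<Rightarrow> nat) \<Rightarrow> int) \<Rightarrow> (nat \<Rightarrow> nat) \<Rightarrow> int" where
  "raise i p r = (if r i = 0 then 0 else (- 1) ^ (\<Sum>j<i. r j) * p (r(i := r i - 1)))"

definition unit_vector :: "(nat \<Rightarrow> nat) \<Rightarrow> (nat \<Rightarrow> nat) \<Rightarrow> int" where
  "unit_vector s r = (if r = s then 1 else 0)"

lemma exponent_group: "abelian_group exponent_group"
proof (rule abelian_groupI)
  fix f assume "f \<in> carrier exponent_group"
  show "\<exists>g\<in>carrier exponent_group. g \<oplus>\<^bsub>exponent_group\<^esub> f = \<zero>\<^bsub>exponent_group\<^esub>"
    by (rule bexI[of _ "\<lambda>r. - f r"]) (simp_all add: exponent_group_def)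
qed (auto simp: exponent_group_def)

lemma raise_anticommute:
  assumes "i \<noteq> j"
  shows "raise i (raise j p) r + raise j (raise i p) r = 0"
proof -
  have "raise i (raise j p) r + raise j (raise i p) r = 0" if "i < j" for i j
  proof (cases "r i = 0 \<or> r j = 0")
    case False
    have "(\<Sum>l<j. r l) = Suc (\<Sum>l<j. (r(i := r i - 1)) l)"
      using that False by (simp add: sum.remove[of "{..<j}" i])
    moreover have "(\<Sum>l<i. (r(j := r j - 1)) l) = (\<Sum>l<i. r l)"
      using that by (intro sum.cong) auto
    moreover have "r(i := r i - 1, j := r j - 1) = r(j := r j - 1, i := r i - 1)"
      using that by (intro fun_upd_twist) simp
    ultimately show ?thesis using False that by (simp add: raise_def)
  qed (use that in \<open>auto simp: raise_def\<close>)
  from this[of i j] this[of j i] show ?thesis using assms by (cases "i < j") (auto simp: add.commute)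
qed

lemma raise_unit_vector:
  assumes "\<And>j. j < i \<Longrightarrow> s j = 0"
  shows "raise i (unit_vector s) = unit_vector (s(i := s i + 1))"
proof
  fix r :: "nat \<Rightarrow> nat"
  show "raise i (unit_vector s) r = unit_vector (s(i := s i + 1)) r"
  proof (cases "r = s(i := s i + 1)")
    case True
    then have "(\<Sum>j<i. r j) = 0" using assms by simp
    moreover have "r(i := r i - 1) = s" using True by auto
    ultimately show ?thesis using True by (simp add: raise_def unit_vector_def)
  next
    case False
    moreover have "r = s(i := s i + 1)" if "r i \<noteq> 0" "r(i := r i - 1) = s"
      using that by auto
    ultimately show ?thesis by (auto simp: raise_def unit_vector_def)
  qed
qed

context skew_polynomials begin

text \<open>The regular representation in coordinates. It separates the monomials before these are known to
  be independent.\<close>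

definition \<rho> :: "(nat list \<Rightarrow> int) set \<Rightarrow> ((nat \<Rightarrow> nat) \<Rightarrow> int) \<Rightarrow> (nat \<Rightarrow> nat) \<Rightarrow> int" where
  "\<rho> = (SOME h. h \<in> ring_hom P (end_ring exponent_group) \<and> (\<forall>i\<in>{1..n}. h (x i) = raise i))"

lemma \<rho>_props: "\<rho> \<in> ring_hom P (end_ring exponent_group)" "i \<in> {1..n} \<Longrightarrow> \<rho> (x i) = raise i"
proof -
  have mem: "raise i \<in> carrier (end_ring exponent_group)" for i
    unfolding end_ring_mem by (auto simp: exponent_group_def raise_def fun_eq_iff algebra_simps)
  have "\<exists>h. h \<in> ring_hom P (end_ring exponent_group) \<inter> extensional (carrier P) \<and>
      (\<forall>i\<in>{1..n}. h (x i) = raise i)"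
  proof (rule P_hom_exists)
    show "ring (end_ring exponent_group)"
      by (rule abelian_group.end_ring_ring[OF exponent_group])
    fix i j :: nat assume "i \<noteq> j"
    then show "raise i \<otimes>\<^bsub>end_ring exponent_group\<^esub> raise j \<oplus>\<^bsub>end_ring exponent_group\<^esub>
        raise j \<otimes>\<^bsub>end_ring exponent_group\<^esub> raise i = \<zero>\<^bsub>end_ring exponent_group\<^esub>"
      unfolding end_ring_simps
      by (auto simp: exponent_group_def compose_def raise_anticommute fun_eq_iff)
  qed (use mem in blast)
  then have "\<exists>h. h \<in> ring_hom P (end_ring exponent_group) \<and> (\<forall>i\<in>{1..n}. h (x i) = raise i)"
    by blast
  from someI_ex[OF this] show "\<rho> \<in> ring_hom P (end_ring exponent_group)"
    "i \<in> {1..n} \<Longrightarrow> \<rho> (x i) = raise i"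
    unfolding \<rho>_def by blast+
qed

definition coefficient :: "(nat \<Rightarrow> nat) \<Rightarrow> (nat list \<Rightarrow> int) set \<Rightarrow> int" where
  "coefficient r f = \<rho> f (unit_vector (\<lambda>_. 0)) r"

lemma coefficient_add:
  "f \<in> carrier P \<Longrightarrow> g \<in> carrier P \<Longrightarrow> coefficient r (f \<oplus> g) = coefficient r f + coefficient r g"
  using ring_hom_add[OF \<rho>_props(1), of f g]
  by (simp add: coefficient_def end_ring_simps) (simp add: exponent_group_def)

definition monomial :: "(nat \<Rightarrow> nat) \<Rightarrow> (nat list \<Rightarrow> int) set" where
  "monomial r = foldr (\<lambda>i a. (x i [^] r i) \<otimes> a) [1..<Suc n] \<one>"

lemma monomial_foldr_closed:
  "set is \<subseteq> {1..n} \<Longrightarrow> foldr (\<lambda>i a. (x i [^] (r i :: nat)) \<otimes> a) is \<one> \<in> carrier P"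
  by (induction "is") auto

lemma \<rho>_x:
  assumes "i \<in> {1..n}" "f \<in> carrier P"
  shows "\<rho> (x i \<otimes> f) v = raise i (\<rho> f v)"
  using ring_hom_mult[OF \<rho>_props(1) x_closed[OF assms(1)] assms(2)] \<rho>_props(2)[OF assms(1)]
  by (simp add: end_ring_simps compose_def exponent_group_def)

text \<open>Factors are applied from the right, hence with decreasing index, and never meet a variable of
  smaller index: no signs arise.\<close>

lemma \<rho>_monomial:
  assumes "1 \<le> k" "k \<le> Suc n"
  shows "\<rho> (foldr (\<lambda>i a. (x i [^] r i) \<otimes> a) [k..<Suc n] \<one>) (unit_vector (\<lambda>_. 0))
    = unit_vector (\<lambda>j. if k \<le> j \<and> j \<le> n then r j else 0)"
  using assms(2,1)
proof (induction rule: inc_induct)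
  case base
  have "(\<lambda>j. if Suc n \<le> j \<and> j \<le> n then r j else 0) = (\<lambda>_. 0)" by auto
  then show ?case
    using ring_hom_one[OF \<rho>_props(1)] by (simp add: end_ring_simps) (simp add: exponent_group_def)
next
  case (step k)
  define f where "f = foldr (\<lambda>i a. (x i [^] r i) \<otimes> a) [Suc k..<Suc n] \<one>"
  define t where "t = (\<lambda>j. if Suc k \<le> j \<and> j \<le> n then r j else 0)"
  have k: "k \<in> {1..n}" using step by simp
  have f: "f \<in> carrier P" unfolding f_def by (rule monomial_foldr_closed) auto
  have IH: "\<rho> f (unit_vector (\<lambda>_. 0)) = unit_vector t" using step unfolding f_def t_def by simp
  have power: "\<rho> ((x k [^] m) \<otimes> f) (unit_vector (\<lambda>_. 0)) = unit_vector (t(k := m))" for m :: nat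
  proof (induction m)
    case 0
    have "t(k := 0) = t" by (auto simp: t_def)
    then show ?case using IH f by simp
  next
    case (Suc m)
    have "(x k [^] Suc m) \<otimes> f = x k \<otimes> ((x k [^] m) \<otimes> f)"
      unfolding nat_pow_Suc2[OF x_closed[OF k]]
      by (rule m_assoc[OF x_closed[OF k] nat_pow_closed[OF x_closed[OF k]] f])
    moreover have "raise k (unit_vector (t(k := m))) = unit_vector (t(k := Suc m))"
    proof -
      have "raise k (unit_vector (t(k := m))) = unit_vector ((t(k := m))(k := (t(k := m)) k + 1))"
        by (rule raise_unit_vector) (auto simp: t_def)
      moreover have "(t(k := m))(k := (t(k := m)) k + 1) = t(k := Suc m)"
        by (simp only: fun_upd_upd fun_upd_same Suc_eq_plus1)
      ultimately show ?thesis by (simp only:)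
    qed
    ultimately show ?case
      using \<rho>_x[OF k, of "(x k [^] m) \<otimes> f"] Suc.IH k f by (simp del: nat_pow_Suc fun_upd_apply)
  qed
  have "t(k := r k) = (\<lambda>j. if k \<le> j \<and> j \<le> n then r j else 0)" using k by (auto simp: t_def)
  moreover have "[k..<Suc n] = k # [Suc k..<Suc n]" using step(2) by (simp add: upt_rec)
  ultimately show ?case using power[of "r k"] unfolding f_def by simp
qed

lemma coefficient_monomial:
  assumes "r \<in> {1..n} \<rightarrow>\<^sub>E UNIV" "r' \<in> {1..n} \<rightarrow>\<^sub>E UNIV"
  shows "coefficient (\<lambda>j. if j \<in> {1..n} then r j else 0) (monomial r') = (if r = r' then 1 else 0)"
proof -
  have "r = r'" if "(\<lambda>j. if j \<in> {1..n} then r j else 0) = (\<lambda>j. if j \<in> {1..n} then r' j else 0)"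
  proof (rule PiE_ext[OF assms])
    fix j assume "j \<in> {1..n}"
    with fun_cong[OF that, of j] show "r j = r' j" by simp
  qed
  moreover have "coefficient s (monomial r') = unit_vector (\<lambda>j. if j \<in> {1..n} then r' j else 0) s" for s
    using \<rho>_monomial[of 1 r'] by (simp add: coefficient_def monomial_def)
  ultimately show ?thesis by (auto simp: unit_vector_def)
qed

end

section \<open>The longest operator does not vanish\<close>

context skew_polynomials begin

definition D_word :: "nat list \<Rightarrow> (nat list \<Rightarrow> int) set \<Rightarrow> (nat list \<Rightarrow> int) set" where
  "D_word is f = foldr D is f"

lemma D_word_simps [simp]:
  "D_word [] f = f" "D_word (i # is) f = D i (D_word is f)"
  "D_word (is @ js) f = D_word is (D_word js f)"
  by (simp_all add: D_word_def)

lemma D_word_closed [simp]: "set is \<subseteq> {1..n} \<Longrightarrow> f \<in> carrier P \<Longrightarrow> D_word is f \<in> carrier P"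
  by (induction "is") auto

lemma D_word_add:
  "set is \<subseteq> {1..n} \<Longrightarrow> f \<in> carrier P \<Longrightarrow> g \<in> carrier P \<Longrightarrow> D_word is (f \<oplus> g) = D_word is f \<oplus> D_word is g"
  by (induction "is") (auto simp: D_add)

lemma D_word_neg: "set is \<subseteq> {1..n} \<Longrightarrow> f \<in> carrier P \<Longrightarrow> D_word is (\<ominus> f) = \<ominus> D_word is f"
  by (induction "is") (auto simp: D_neg)

lemma D_word_zero: "set is \<subseteq> {1..n} \<Longrightarrow> D_word is \<zero> = \<zero>"
  by (induction "is") (auto simp: D_zero)

lemma D_word_int: "set is \<subseteq> {1..n} \<Longrightarrow> f \<in> carrier P \<Longrightarrow> D_word is ([(c::int)] \<cdot> f) = [c] \<cdot> D_word is f"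
  by (induction "is") (auto simp: D_int)

text \<open>Multiplication by the square of \<open>x\<^sub>j\<close>, which is central.\<close>

definition Y :: "nat \<Rightarrow> (nat list \<Rightarrow> int) set \<Rightarrow> (nat list \<Rightarrow> int) set" where
  "Y j f = x j \<otimes> (x j \<otimes> f)"

lemma Y_closed [simp]: "j \<in> {1..n} \<Longrightarrow> f \<in> carrier P \<Longrightarrow> Y j f \<in> carrier P"
  by (simp add: Y_def)

lemma Y_add: "j \<in> {1..n} \<Longrightarrow> f \<in> carrier P \<Longrightarrow> g \<in> carrier P \<Longrightarrow> Y j (f \<oplus> g) = Y j f \<oplus> Y j g"
  by (simp add: Y_def r_distr)

lemma Y_neg: "j \<in> {1..n} \<Longrightarrow> f \<in> carrier P \<Longrightarrow> Y j (\<ominus> f) = \<ominus> Y j f"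
  by (simp add: Y_def r_minus)

lemma Y_zero: "j \<in> {1..n} \<Longrightarrow> Y j \<zero> = \<zero>"
  by (simp add: Y_def)

lemma Y_int: "j \<in> {1..n} \<Longrightarrow> f \<in> carrier P \<Longrightarrow> Y j ([(c::int)] \<cdot> f) = [c] \<cdot> Y j f"
  by (simp add: Y_def add_pow_rdistr_int)

lemma x_x_swap:
  "i \<in> {1..n} \<Longrightarrow> j \<in> {1..n} \<Longrightarrow> i \<noteq> j \<Longrightarrow> f \<in> carrier P \<Longrightarrow> x i \<otimes> (x j \<otimes> f) = \<ominus> (x j \<otimes> (x i \<otimes> f))"
  using x_anticommute'[of i j] by (simp add: m_assoc[symmetric] l_minus del: atLeastAtMost_iff)

lemma Y_x:
  assumes "i \<in> {1..n}" "j \<in> {1..n}" "f \<in> carrier P"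
  shows "Y j (x i \<otimes> f) = x i \<otimes> Y j f"
proof (cases "i = j")
  case False
  have "x j \<otimes> (x i \<otimes> f) = \<ominus> (x i \<otimes> (x j \<otimes> f))" using x_x_swap[of j i f] assms False by simp
  then have "Y j (x i \<otimes> f) = \<ominus> (x j \<otimes> (x i \<otimes> (x j \<otimes> f)))" using assms by (simp add: Y_def r_minus)
  also have "x j \<otimes> (x i \<otimes> (x j \<otimes> f)) = \<ominus> (x i \<otimes> Y j f)"
    using x_x_swap[of j i "x j \<otimes> f"] assms False by (simp add: Y_def)
  finally show ?thesis using assms by simp
qed (simp add: Y_def)

lemma Y_Y: "i \<in> {1..n} \<Longrightarrow> j \<in> {1..n} \<Longrightarrow> f \<in> carrier P \<Longrightarrow> Y i (Y j f) = Y j (Y i f)"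
  using Y_x[of j i] unfolding Y_def[of j] by simp

text \<open>The operators treat the squares like commuting variables that they permute without signs. Only
  the correction term of the Leibniz rule differs from the commutative case: it is a difference of two
  variables for the first \<open>n - 1\<close> operators, and a sum for the last one.\<close>

lemma D_Y_lt:
  assumes "1 \<le> i" "i < n" and f: "f \<in> carrier P"
  shows "D i (Y i f) = (x i \<otimes> f \<oplus> \<ominus> (x (i + 1) \<otimes> f)) \<oplus> Y (i + 1) (D i f)"
    "D i (Y (i + 1) f) = (x (i + 1) \<otimes> f \<oplus> \<ominus> (x i \<otimes> f)) \<oplus> Y i (D i f)"
  using assms D_x[of i i] D_x[of i "i + 1"]
  by (simp_all add: Y_def coef_def eps_def perm_def lower_def \<eta>_def neg_int_mult r_distr r_minus
      minus_add a_assoc)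

lemma D_Y_last:
  assumes f: "f \<in> carrier P"
  shows "D n (Y (n - 1) f) = (x (n - 1) \<otimes> f \<oplus> x n \<otimes> f) \<oplus> Y n (D n f)"
proof -
  have n1: "n \<in> {1..n}" "n - 1 \<in> {1..n}" "n - 1 + 1 = n" "n - 1 \<noteq> n" "n \<noteq> n - 1" using n_ge_2 by auto
  have l: "lower n = n - 1" "\<eta> n = - 1" by (simp_all add: lower_def \<eta>_def)
  have "D n (x (n - 1) \<otimes> g) = g \<oplus> x n \<otimes> D n g" if "g \<in> carrier P" for g
    using D_x[OF n1(1) n1(2) that] n1 that unfolding coef_def eps_def perm_def l n1(3)
    by (simp add: neg_int_mult del: atLeastAtMost_iff)
  then show ?thesis using n1 f by (simp add: Y_def r_distr a_assoc del: atLeastAtMost_iff)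
qed

lemma D_Y_far:
  assumes "i \<in> {1..n}" "j \<in> {1..n}" "j \<noteq> lower i" "j \<noteq> lower i + 1" "f \<in> carrier P"
  shows "D i (x j \<otimes> f) = \<ominus> (x j \<otimes> D i f)" "D i (Y j f) = Y j (D i f)"
proof -
  have *: "D i (x j \<otimes> g) = \<ominus> (x j \<otimes> D i g)" if "g \<in> carrier P" for g
    using D_x[OF assms(1,2) that] assms that by (simp add: coef_def eps_def perm_def neg_int_mult)
  then show "D i (x j \<otimes> f) = \<ominus> (x j \<otimes> D i f)" "D i (Y j f) = Y j (D i f)"
    using assms by (simp_all add: Y_def r_minus)
qed

text \<open>The complete homogeneous symmetric polynomial of degree \<open>p - m\<close> in the squares of
  \<open>x\<^bsub>n-m\<^esub>, \<dots>, x\<^sub>n\<close>, shifted so that the recursion has no case distinction on the degree; it vanishes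
  for \<open>p < m\<close>.\<close>

fun q :: "nat \<Rightarrow> nat \<Rightarrow> (nat list \<Rightarrow> int) set" where
  "q 0 0 = \<one>"
| "q 0 (Suc p) = Y n (q 0 p)"
| "q (Suc m) 0 = \<zero>"
| "q (Suc m) (Suc p) = Y (n - Suc m) (q (Suc m) p) \<oplus> q m p"

lemma q_closed [simp]: "m < n \<Longrightarrow> q m p \<in> carrier P"
  using n_ge_2 by (induction m p rule: q.induct) auto

lemma q_small: "p < m \<Longrightarrow> m < n \<Longrightarrow> q m p = \<zero>"
  by (induction m p rule: q.induct) (auto simp: Y_zero)

lemma q_diagonal: "m < n \<Longrightarrow> q m m = \<one>"
proof (induction m)
  case (Suc m)
  then show ?case using q_small[of m "Suc m"] by (simp add: Y_zero)
qed simp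

lemma D_q_far: "1 \<le> i \<Longrightarrow> i + m + 1 < n \<Longrightarrow> D i (q m p) = \<zero>"
proof (induction m p rule: q.induct)
  case (2 p)
  then have "D i (Y n (q 0 p)) = Y n (D i (q 0 p))"
    by (intro D_Y_far) (auto simp: lower_def)
  then show ?case using 2 n_ge_2 by (simp add: Y_zero)
next
  case (4 m p)
  have *: "n - Suc m \<noteq> i" "n - Suc m \<noteq> i + 1" "i < n" "n - Suc m \<in> {1..n}" using 4(4) by auto
  have "D i (Y (n - Suc m) (q (Suc m) p)) = Y (n - Suc m) (D i (q (Suc m) p))"
    using 4(3,4) * by (intro D_Y_far) (auto simp: lower_def)
  then show ?case using 4 * by (simp add: D_add Y_zero)
qed (use n_ge_2 in \<open>simp_all add: demazure_props(2) D_zero\<close>)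

text \<open>The second claim is the symmetry of \<open>q (Suc m) p\<close> in its first two squares. Its proof needs the
  first claim, which differentiates the polynomial that lacks the first of the two variables.\<close>

lemma D_q:
  assumes m: "m + 2 \<le> n"
  shows "D (n - Suc m) (q m p) =
      \<ominus> (x (n - Suc m) \<otimes> q (Suc m) p) \<oplus> x (n - m) \<otimes> q (Suc m) p \<and>
    D (n - Suc m) (q (Suc m) p) = \<zero>"
proof (induction p)
  case 0
  have "n - Suc m \<in> {1..n}" "n - m \<in> {1..n}" using m by auto
  then show ?case by (cases m) (simp_all add: demazure_props(2) D_zero)
next
  case (Suc p)
  define k where "k = n - Suc m"
  have k: "1 \<le> k" "k < n" "n - m = k + 1" "k \<in> {1..n}" "k + 1 \<in> {1..n}" using m by (auto simp: k_def)
  let ?a = "q m p" and ?b = "q (Suc m) p"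
  have closed: "?a \<in> carrier P" "?b \<in> carrier P" using m by simp_all
  have IH: "D k ?a = \<ominus> (x k \<otimes> ?b) \<oplus> x (k + 1) \<otimes> ?b" "D k ?b = \<zero>"
    using Suc by (simp_all add: k_def[symmetric] k(3))
  have q_Suc: "q (Suc m) (Suc p) = Y k ?b \<oplus> ?a" by (simp add: k_def)
  have "D k (q m (Suc p)) = D k (Y (k + 1) ?a)"
  proof (cases m)
    case 0
    then show ?thesis by (simp only: 0 q.simps k(3)[symmetric] diff_zero)
  next
    case (Suc m')
    have "D k (q m' p) = \<zero>" using k m Suc by (intro D_q_far) (auto simp: k_def)
    moreover have "n - Suc m' = k + 1" using k(3) Suc by simp
    moreover have "q m' p \<in> carrier P" using m Suc by simp
    ultimately show ?thesis using Suc k closed by (simp add: D_add)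
  qed
  also have "\<dots> = (x (k + 1) \<otimes> ?a \<oplus> \<ominus> (x k \<otimes> ?a)) \<oplus> Y k (\<ominus> (x k \<otimes> ?b) \<oplus> x (k + 1) \<otimes> ?b)"
    using D_Y_lt(2)[OF k(1,2) closed(1)] IH(1) by simp
  also have "\<dots> = \<ominus> (x k \<otimes> (Y k ?b \<oplus> ?a)) \<oplus> x (k + 1) \<otimes> (Y k ?b \<oplus> ?a)"
    using k(4,5) closed
    by (simp add: Y_add Y_neg Y_x r_distr minus_add a_ac del: atLeastAtMost_iff)
  finally have 1: "D k (q m (Suc p)) =
    \<ominus> (x k \<otimes> q (Suc m) (Suc p)) \<oplus> x (k + 1) \<otimes> q (Suc m) (Suc p)" unfolding q_Suc .
  have "D k (q (Suc m) (Suc p)) =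
      (x k \<otimes> ?b \<oplus> \<ominus> (x (k + 1) \<otimes> ?b)) \<oplus> (\<ominus> (x k \<otimes> ?b) \<oplus> x (k + 1) \<otimes> ?b)"
    unfolding q_Suc using k(4,5) closed D_Y_lt(1)[OF k(1,2) closed(2)] IH
    by (simp add: D_add Y_zero del: atLeastAtMost_iff)
  also have "\<dots> = \<zero>"
    using k(4,5) closed by (simp add: a_ac r_neg1 r_neg2 r_neg l_neg del: atLeastAtMost_iff)
  finally have 2: "D k (q (Suc m) (Suc p)) = \<zero>" .
  show ?case using 1 2 by (simp only: k_def[symmetric] k(3))
qed

lemma Y_pow_closed [simp]: "j \<in> {1..n} \<Longrightarrow> f \<in> carrier P \<Longrightarrow> (Y j ^^ p) f \<in> carrier P"
  by (induction p) auto

lemma Y_pow_zero: "j \<in> {1..n} \<Longrightarrow> (Y j ^^ p) \<zero> = \<zero>"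
  by (induction p) (auto simp: Y_zero)

lemma Y_pow_int: "j \<in> {1..n} \<Longrightarrow> f \<in> carrier P \<Longrightarrow> (Y j ^^ p) ([(c::int)] \<cdot> f) = [c] \<cdot> (Y j ^^ p) f"
  by (induction p) (auto simp: Y_int)

lemma D_word_Y_far:
  assumes "set is \<subseteq> {1..n}" "\<And>i. i \<in> set is \<Longrightarrow> j < lower i" "j \<in> {1..n}" "f \<in> carrier P"
  shows "D_word is (Y j f) = Y j (D_word is f)"
  using assms(1,2)
proof (induction "is")
  case (Cons i "is")
  then show ?case using assms(3,4) D_Y_far(2)[of i j "D_word is f"] by force
qed simp

lemma D_word_Y_pow_far:
  assumes "set is \<subseteq> {1..n}" "\<And>i. i \<in> set is \<Longrightarrow> j < lower i" "j \<in> {1..n}" "f \<in> carrier P"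
  shows "D_word is ((Y j ^^ p) f) = (Y j ^^ p) (D_word is f)"
  using assms by (induction p) (auto simp: D_word_Y_far)

lemma D_word_x_far:
  assumes "set is \<subseteq> {1..n}" "\<And>i. i \<in> set is \<Longrightarrow> j < lower i" "j \<in> {1..n}" "f \<in> carrier P"
  shows "D_word is (x j \<otimes> f) = [((- 1) ^ length is :: int)] \<cdot> (x j \<otimes> D_word is f)"
  using assms(1,2)
proof (induction "is")
  case Nil
  then show ?case using assms by simp
next
  case (Cons i "is")
  then have i: "i \<in> {1..n}" "j < lower i" "set is \<subseteq> {1..n}" by auto
  then have ne: "j \<noteq> lower i" "j \<noteq> lower i + 1" by simp_all
  have "D_word (i # is) (x j \<otimes> f) = [((- 1) ^ length is :: int)] \<cdot> (\<ominus> (x j \<otimes> D i (D_word is f)))"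
    using Cons i assms(3,4) D_Y_far(1)[OF i(1) assms(3) ne, of "D_word is f"] by (simp add: D_int)
  then show ?case using i assms(3,4) by (simp add: add.int_pow_neg add.int_pow_inv)
qed

lemma block_lower:
  assumes "m + 2 \<le> n" "i \<in> set (block m)" shows "n - 1 - m \<le> lower i" "i \<in> {1..n}"
proof -
  have m: "m \<le> n - 2" "1 \<le> n - 1 - m" using assms(1) by auto
  have "n - 1 - m \<le> i" "i \<le> n" using subsetD[OF block_letters[OF m(1)] assms(2)] by auto
  with m(2) show "n - 1 - m \<le> lower i" "i \<in> {1..n}" unfolding lower_def by auto
qed

lemma block_length: "length (block m) = 2 * m + 2" by (induction m) auto

text \<open>The symmetry of \<open>q (Suc 0)\<close> in the last two squares gives a second recursion for it. It makes
  the two terms of the Leibniz rule for the last operator combine.\<close>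

lemma block_zero_base:
  shows "D_word (block 0) ((Y (n - 1) ^^ p) \<one>) = q (Suc 0) p \<oplus> q (Suc 0) p"
    "D_word (block 0) (x (n - 1) \<otimes> (Y (n - 1) ^^ p) \<one>) = \<zero>"
proof -
  define k where "k = n - 1"
  have k: "1 \<le> k" "k < n" "k + 1 = n" "k \<in> {1..n}" "n \<in> {1..n}" "n - Suc 0 = k"
    using n_ge_2 by (auto simp: k_def)
  have closed [simp]: "q (Suc 0) p \<in> carrier P" "q 0 p \<in> carrier P" for p using n_ge_2 by simp_all
  have q0: "q 0 p = (Y n ^^ p) \<one>" for p by (induction p) auto
  have sym: "q (Suc 0) (Suc p) = (Y k ^^ p) \<one> \<oplus> Y n (q (Suc 0) p)" for p
  proof (induction p)
    case 0
    then show ?case using k by (simp add: Y_zero)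
  next
    case (Suc p)
    have "q (Suc 0) (Suc (Suc p)) = Y k (q (Suc 0) (Suc p)) \<oplus> q 0 (Suc p)" by (simp add: k(6))
    also have "\<dots> = Y k ((Y k ^^ p) \<one> \<oplus> Y n (q (Suc 0) p)) \<oplus> Y n (q 0 p)" by (simp only: Suc) simp
    also have "\<dots> = (Y k ^^ Suc p) \<one> \<oplus> Y n (Y k (q (Suc 0) p) \<oplus> q 0 p)"
      using k(4,5) by (simp add: Y_add Y_Y[of k n] a_assoc del: atLeastAtMost_iff)
    finally show ?case by (simp add: k(6))
  qed
  have Dn: "D n ((Y k ^^ p) \<one>) = x k \<otimes> q (Suc 0) p \<oplus> x n \<otimes> q (Suc 0) p" for p
  proof (induction p)
    case 0
    then show ?case using k by (simp add: demazure_props(2) del: atLeastAtMost_iff)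
  next
    case (Suc p)
    let ?b = "q (Suc 0) p" and ?y = "(Y k ^^ p) \<one>"
    have "D n ((Y k ^^ Suc p) \<one>) = (x k \<otimes> ?y \<oplus> x n \<otimes> ?y) \<oplus> Y n (x k \<otimes> ?b \<oplus> x n \<otimes> ?b)"
      using D_Y_last[of ?y] Suc k(4) by (simp add: k_def[symmetric] del: atLeastAtMost_iff)
    also have "\<dots> = x k \<otimes> (?y \<oplus> Y n ?b) \<oplus> x n \<otimes> (?y \<oplus> Y n ?b)"
      using k(4,5) by (simp add: Y_add Y_x r_distr a_ac del: atLeastAtMost_iff)
    finally show ?case by (simp only: sym)
  qed
  have Dk: "D k (q (Suc 0) p) = \<zero>" for p using D_q[of 0 p] n_ge_2 by (simp add: k(6))
  have Dx: "D k (x k \<otimes> f) = f \<oplus> \<ominus> (x n \<otimes> D k f)" "D k (x n \<otimes> f) = f \<oplus> \<ominus> (x k \<otimes> D k f)"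
    if "f \<in> carrier P" for f
    using D_x[of k k f] D_x[of k "k + 1" f] k that
    by (simp_all add: coef_def eps_def perm_def lower_def \<eta>_def neg_int_mult del: atLeastAtMost_iff)
  show "D_word (block 0) ((Y (n - 1) ^^ p) \<one>) = q (Suc 0) p \<oplus> q (Suc 0) p"
    unfolding k_def[symmetric] using k(4,5)
    by (simp add: k_def[symmetric] Dn D_add Dx Dk del: atLeastAtMost_iff)
  have Dn_x: "D n (x k \<otimes> f) = f \<oplus> x n \<otimes> D n f" if f: "f \<in> carrier P" for f
  proof -
    have l: "lower n = k" "\<eta> n = - 1" by (simp_all add: lower_def \<eta>_def k_def)
    show ?thesis using D_x[OF k(5) k(4) f] k(2,4,5) f unfolding coef_def eps_def perm_def l k(3)
      by (simp del: atLeastAtMost_iff)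
  qed
  let ?b = "q (Suc 0) p" and ?y = "(Y k ^^ p) \<one>"
  have "D n (x k \<otimes> ?y) = ?y \<oplus> x n \<otimes> (x k \<otimes> ?b \<oplus> x n \<otimes> ?b)"
    using Dn_x[of ?y] k(4) by (simp add: Dn del: atLeastAtMost_iff)
  also have "\<dots> = q (Suc 0) (Suc p) \<oplus> x n \<otimes> (x k \<otimes> ?b)"
    unfolding sym using k(4,5) by (simp add: r_distr Y_def a_ac del: atLeastAtMost_iff)
  finally have "D k (D n (x k \<otimes> ?y)) = x k \<otimes> ?b \<oplus> \<ominus> (x k \<otimes> (?b \<oplus> \<ominus> (x n \<otimes> D k ?b)))"
    using k(4,5) closed[of p] closed[of "Suc p"]
    by (simp add: D_add Dk Dx del: q.simps atLeastAtMost_iff)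
  also have "\<dots> = \<zero>" using k(4,5) closed[of p] by (simp add: Dk r_neg del: q.simps atLeastAtMost_iff)
  finally show "D_word (block 0) (x (n - 1) \<otimes> (Y (n - 1) ^^ p) \<one>) = \<zero>"
    by (simp add: k_def[symmetric])
qed

lemma twice_add: "a \<in> carrier P \<Longrightarrow> b \<in> carrier P \<Longrightarrow> (a \<oplus> b) \<oplus> (a \<oplus> b) = (a \<oplus> a) \<oplus> (b \<oplus> b)"
  by (simp add: a_ac)

text \<open>Induction on \<open>m\<close>: the word is \<open>k\<close>, the previous block, and \<open>k\<close> again. The inner \<open>D k\<close> is expanded
  in powers of the next square, to which the induction hypothesis applies; the previous block
  commutes with \<open>x\<^sub>k\<close>, having an even number of letters. What results is a multiple of a symmetric
  polynomial, on which the outer \<open>D k\<close> acts only through the factor \<open>x\<^sub>k\<close>. The odd powers in the second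
  claim are what makes the induction close.\<close>

lemma block_power:
  assumes "m + 2 \<le> n"
  shows "D_word (block m) ((Y (n - 1 - m) ^^ p) \<one>) = q (Suc m) p \<oplus> q (Suc m) p \<and>
    D_word (block m) (x (n - 1 - m) \<otimes> (Y (n - 1 - m) ^^ p) \<one>) = \<zero>"
  using assms
proof (induction m arbitrary: p)
  case 0
  then show ?case using block_zero_base[of p] by simp
next
  case (Suc m)
  define k where "k = n - 2 - m"
  define T where "T = D_word (block m)"
  have k: "1 \<le> k" "k < n" "k \<in> {1..n}" "k + 1 \<in> {1..n}" "n - 1 - m = k + 1" "n - 1 - Suc m = k"
    "n - Suc (Suc m) = k" "n - Suc m = k + 1" "m + 2 \<le> n"
    using Suc.prems by (auto simp: k_def)
  have closed [simp]: "q (Suc m) p \<in> carrier P" "q (Suc (Suc m)) p \<in> carrier P" for p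
    using Suc.prems by simp_all
  have lower: "i \<in> set (block m) \<Longrightarrow> k < lower i" for i using block_lower[OF k(9)] k(5) by fastforce
  have set: "set (block m) \<subseteq> {1..n}" using block_lower[OF k(9)] by blast
  have T_closed [simp]: "f \<in> carrier P \<Longrightarrow> T f \<in> carrier P" for f by (simp add: T_def set)
  have T_x: "T (x k \<otimes> f) = x k \<otimes> T f" if "f \<in> carrier P" for f
    using D_word_x_far[OF set lower k(3) that] k(3) that T_closed
    by (simp add: T_def[symmetric] block_length)
  have T_Y: "T (Y k f) = Y k (T f)" if "f \<in> carrier P" for f
    using that k(3) by (simp add: Y_def T_x)
  have T_Y_pow: "T ((Y k ^^ p) f) = (Y k ^^ p) (T f)" if "f \<in> carrier P" for f p
    using that k(3) by (induction p) (simp_all add: T_Y)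
  have T_add: "T (f \<oplus> g) = T f \<oplus> T g" if "f \<in> carrier P" "g \<in> carrier P" for f g
    using that by (simp add: T_def D_word_add set)
  have T_neg: "T (\<ominus> f) = \<ominus> T f" if "f \<in> carrier P" for f
    using that by (simp add: T_def D_word_neg set)
  let ?y = "\<lambda>p. (Y k ^^ p) \<one>" and ?z = "\<lambda>p. (Y (k + 1) ^^ p) \<one>"
  let ?q = "\<lambda>p. q (Suc (Suc m)) p"
  have IH: "T (?z p) = q (Suc m) p \<oplus> q (Suc m) p" "T (x (k + 1) \<otimes> ?z p) = \<zero>" for p
    using Suc.IH[OF k(9), of p] by (simp_all only: T_def k(5))
  have yz: "?y p \<in> carrier P" "?z p \<in> carrier P" for p
    using k(3,4) by simp_all
  note D_y = D_Y_lt(1)[OF k(1,2)]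
  \<comment> \<open>the Leibniz rule read from the right: the last factor is differentiated separately\<close>
  have leibniz: "D k (?y (Suc p)) = Y k (D k (?y p)) \<oplus> (x k \<otimes> ?z p \<oplus> \<ominus> (x (k + 1) \<otimes> ?z p))" for p
  proof (induction p)
    case 0
    show ?case using D_y[of \<one>] k(3,4) by (simp add: demazure_props(2) Y_zero del: atLeastAtMost_iff)
  next
    case (Suc p)
    let ?d = "D k (?y p)"
    have d: "?d \<in> carrier P" using k(3) yz by simp
    have d_Suc: "D k (?y (Suc p)) = (x k \<otimes> ?y p \<oplus> \<ominus> (x (k + 1) \<otimes> ?y p)) \<oplus> Y (k + 1) ?d"
      using D_y[OF yz(1)[of p]] by simp
    have "D k (?y (Suc (Suc p))) = (x k \<otimes> ?y (Suc p) \<oplus> \<ominus> (x (k + 1) \<otimes> ?y (Suc p))) \<oplus>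
        Y (k + 1) (D k (?y (Suc p)))"
      using D_y[OF yz(1)[of "Suc p"]] by simp
    also have "\<dots> = (x k \<otimes> Y k (?y p) \<oplus> \<ominus> (x (k + 1) \<otimes> Y k (?y p))) \<oplus>
        (Y k (Y (k + 1) ?d) \<oplus> (x k \<otimes> ?z (Suc p) \<oplus> \<ominus> (x (k + 1) \<otimes> ?z (Suc p))))"
      unfolding Suc using k(3,4) d yz
      by (simp add: Y_add Y_neg Y_x Y_Y[of "k + 1" k] del: atLeastAtMost_iff)
    also have "\<dots> = Y k (D k (?y (Suc p))) \<oplus> (x k \<otimes> ?z (Suc p) \<oplus> \<ominus> (x (k + 1) \<otimes> ?z (Suc p)))"
      unfolding d_Suc using k(3,4) d yz
      by (simp add: Y_add Y_neg Y_x a_assoc del: atLeastAtMost_iff)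
    finally show ?case .
  qed
  have D_yc: "D k (?y p) \<in> carrier P" for p using k(3) yz by simp
  have q_Suc: "?q (Suc p) = Y k (?q p) \<oplus> q (Suc m) p" for p by (simp add: k(7))
  have T_D: "T (D k (?y p)) = x k \<otimes> (?q p \<oplus> ?q p)" for p
  proof (induction p)
    case 0
    show ?case using k(3) by (simp add: demazure_props(2) T_def D_word_zero set del: atLeastAtMost_iff)
  next
    case (Suc p)
    have "T (D k (?y (Suc p))) = Y k (x k \<otimes> (?q p \<oplus> ?q p)) \<oplus> (x k \<otimes> (q (Suc m) p \<oplus> q (Suc m) p) \<oplus> \<ominus> \<zero>)"
      unfolding leibniz using k(3,4) yz D_yc Suc
      by (simp add: T_add T_neg T_Y T_x IH del: atLeastAtMost_iff)
    also have "\<dots> = x k \<otimes> (?q (Suc p) \<oplus> ?q (Suc p))"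
      unfolding q_Suc twice_add[OF Y_closed[OF k(3) closed(2)] closed(1)] using k(3)
      by (simp add: Y_x Y_add r_distr a_ac del: atLeastAtMost_iff q.simps)
    finally show ?case .
  qed
  have Dq: "D k (?q p) = \<zero>" for p using D_q[of "Suc m" p] Suc.prems by (simp add: k(7) del: q.simps)
  have D_xk: "D k (x k \<otimes> f) = f \<oplus> \<ominus> (x (k + 1) \<otimes> D k f)" if "f \<in> carrier P" for f
    using D_x[of k k f] k that
    by (simp_all add: coef_def eps_def perm_def lower_def \<eta>_def neg_int_mult del: atLeastAtMost_iff)
  have "D_word (block (Suc m)) (?y p) = D k (T (D k (?y p)))" by (simp add: T_def k_def)
  also have "\<dots> = ?q p \<oplus> ?q p"
    unfolding T_D using k(3,4) by (simp add: D_xk D_add Dq del: q.simps atLeastAtMost_iff)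
  finally have A: "D_word (block (Suc m)) (?y p) = ?q p \<oplus> ?q p" .
  have W: "T (x (k + 1) \<otimes> D k (?y p)) = \<ominus> (?q (Suc p) \<oplus> ?q (Suc p))" for p
  proof (induction p)
    case 0
    show ?case using k(3,4)
      by (simp add: demazure_props(2) T_def D_word_zero set k(7) Y_zero del: atLeastAtMost_iff)
  next
    case (Suc p)
    have swap: "x (k + 1) \<otimes> (x k \<otimes> ?z p) = \<ominus> (x k \<otimes> (x (k + 1) \<otimes> ?z p))"
      using k(3,4) yz by (intro x_x_swap) simp_all
    have "x (k + 1) \<otimes> D k (?y (Suc p)) = Y k (x (k + 1) \<otimes> D k (?y p)) \<oplus>
        (\<ominus> (x k \<otimes> (x (k + 1) \<otimes> ?z p)) \<oplus> \<ominus> (?z (Suc p)))"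
      unfolding leibniz swap[symmetric] using k(3,4) yz D_yc
      by (simp add: r_distr r_minus Y_x) (simp add: Y_def)
    then have "T (x (k + 1) \<otimes> D k (?y (Suc p))) = Y k (\<ominus> (?q (Suc p) \<oplus> ?q (Suc p))) \<oplus>
        (\<ominus> \<zero> \<oplus> \<ominus> (q (Suc m) (Suc p) \<oplus> q (Suc m) (Suc p)))"
      using k(3,4) yz D_yc Suc
      by (simp add: T_add T_neg T_Y T_x IH del: atLeastAtMost_iff q.simps funpow.simps)
    also have "\<dots> = \<ominus> (?q (Suc (Suc p)) \<oplus> ?q (Suc (Suc p)))"
      unfolding q_Suc[of "Suc p"] twice_add[OF Y_closed[OF k(3) closed(2)] closed(1)] using k(3)
      by (simp add: Y_neg Y_add minus_add a_ac del: atLeastAtMost_iff q.simps)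
    finally show ?case .
  qed
  have T_y: "T (?y p) = \<zero>"
    using T_Y_pow[of \<one> p] IH(1)[of 0] k(3) by (simp add: Y_pow_zero del: atLeastAtMost_iff)
  have "D_word (block (Suc m)) (x k \<otimes> ?y p) = D k (T (?y p \<oplus> \<ominus> (x (k + 1) \<otimes> D k (?y p))))"
    using D_xk[OF yz(1)] by (simp add: T_def k_def)
  also have "\<dots> = \<zero>"
    using k(3,4) yz D_yc by (simp add: T_add T_neg T_y W D_add Dq del: q.simps atLeastAtMost_iff)
  finally have B: "D_word (block (Suc m)) (x k \<otimes> ?y p) = \<zero>" .
  show ?case using A B by (simp only: k(6))
qed

text \<open>The product of the \<open>x\<^sub>k\<close> to the powers \<open>2 (n - k)\<close>, for \<open>n - 1 - m \<le> k < n\<close>.\<close>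

fun top_poly :: "nat \<Rightarrow> (nat list \<Rightarrow> int) set" where
  "top_poly 0 = (Y (n - 1) ^^ 1) \<one>"
| "top_poly (Suc m) = (Y (n - 1 - Suc m) ^^ (Suc m + 1)) (top_poly m)"

lemma top_poly_closed: "m + 2 \<le> n \<Longrightarrow> top_poly m \<in> carrier P"
proof (induction m)
  case 0
  then have "n - 1 \<in> {1..n}" by auto
  then show ?case by (simp del: atLeastAtMost_iff)
next
  case (Suc m)
  then have "n - 1 - Suc m \<in> {1..n}" by auto
  then show ?case using Suc by (simp only: top_poly.simps Y_pow_closed)
qed

text \<open>The exponents of \<open>top_poly\<close> are the smallest for which \<open>block_power\<close> gives a nonzero value: there
  \<open>q\<close> has degree zero and each block contributes a factor \<open>2\<close>.\<close>

lemma longest_top: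
  "m + 2 \<le> n \<Longrightarrow> D_word (longest_word m) (top_poly m) = [(2 ^ (m + 1) :: int)] \<cdot> \<one>"
proof (induction m)
  case 0
  have "n - 1 < n" "0 < n" "1 < n" using 0 by auto
  then show ?case
    using block_power[OF 0, of 1] q_diagonal[of 1] add.int_pow_mult[OF one_closed, of 1 1]
    by (simp add: One_nat_def del: block.simps q.simps)
next
  case (Suc m)
  define k where "k = n - 1 - Suc m"
  have k: "k \<in> {1..n}" "m + 2 \<le> n" "m \<le> n - 2" "n - 1 - m = k + 1" using Suc.prems by (auto simp: k_def)
  have letters: "i \<in> {1..n}" "k < lower i" if "i \<in> set (longest_word m)" for i
  proof -
    have "i \<in> {k + 1..n}" using longest_word_letters[OF k(3)] that k(4) by auto
    moreover have "k + 1 \<le> n - 1" using k(4) by simp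
    ultimately show "i \<in> {1..n}" "k < lower i" unfolding lower_def by auto
  qed
  have set: "set (longest_word m) \<subseteq> {1..n}" using letters(1) by blast
  have set': "set (block (Suc m)) \<subseteq> {1..n}" using block_lower(2)[OF Suc.prems] by blast
  have "D_word (longest_word (Suc m)) (top_poly (Suc m)) =
      D_word (block (Suc m)) ((Y k ^^ (Suc m + 1)) ([(2 ^ (m + 1) :: int)] \<cdot> \<one>))"
    using D_word_Y_pow_far[OF set letters(2) k(1) top_poly_closed[OF k(2)]] Suc.IH[OF k(2)]
    by (simp only: longest_word.simps top_poly.simps D_word_simps k_def)
  also have "\<dots> = [(2 ^ (m + 1) :: int)] \<cdot> D_word (block (Suc m)) ((Y k ^^ (Suc m + 1)) \<one>)"
    using k(1) set' by (simp only: Y_pow_int one_closed D_word_int Y_pow_closed)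
  also have "D_word (block (Suc m)) ((Y k ^^ (Suc m + 1)) \<one>) = [(2::int)] \<cdot> \<one>"
  proof -
    have "q (Suc (Suc m)) (Suc m + 1) = \<one>"
      using q_diagonal[of "Suc (Suc m)"] Suc.prems by (simp only: Suc_eq_plus1)
    then show ?thesis
      using block_power[OF Suc.prems, of "Suc m + 1"] add.int_pow_mult[OF one_closed, of 1 1]
      by (simp only: k_def) simp
  qed
  finally show ?case by (simp add: add.int_pow_pow mult.commute)
qed

end

section \<open>Integral bases\<close>

text \<open>The smallest additive subgroup that contains \<open>B\<close> and is stable under left multiplication by \<open>A\<close>.
  With \<open>A\<close> empty it is the integral span of \<open>B\<close>.\<close>

inductive_set left_span :: "('a, 'm) ring_scheme \<Rightarrow> 'a set \<Rightarrow> 'a set \<Rightarrow> 'a set"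
  for R and A and B where
  base: "b \<in> B \<Longrightarrow> b \<in> left_span R A B"
| zero: "\<zero>\<^bsub>R\<^esub> \<in> left_span R A B"
| add: "a \<in> left_span R A B \<Longrightarrow> b \<in> left_span R A B \<Longrightarrow> a \<oplus>\<^bsub>R\<^esub> b \<in> left_span R A B"
| neg: "a \<in> left_span R A B \<Longrightarrow> \<ominus>\<^bsub>R\<^esub> a \<in> left_span R A B"
| mult: "c \<in> A \<Longrightarrow> a \<in> left_span R A B \<Longrightarrow> c \<otimes>\<^bsub>R\<^esub> a \<in> left_span R A B"

context ring begin

lemma left_span_closed:
  "A \<subseteq> carrier R \<Longrightarrow> B \<subseteq> carrier R \<Longrightarrow> a \<in> left_span R A B \<Longrightarrow> a \<in> carrier R"
  by (rotate_tac 2, induction rule: left_span.induct) auto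

lemma left_span_sign: "eq_upto_sign R a b \<Longrightarrow> b \<in> left_span R A B \<Longrightarrow> a \<in> left_span R A B"
  by (auto simp: eq_upto_sign_def intro: left_span.neg)

lemma additive_zero: "(\<And>a b. a \<in> carrier R \<Longrightarrow> b \<in> carrier R \<Longrightarrow> L (a \<oplus> b) = L a + L b) \<Longrightarrow> L \<zero> = (0::int)"
  by (metis add_cancel_right_right l_zero zero_closed)

lemma additive_int:
  assumes L: "\<And>a b. a \<in> carrier R \<Longrightarrow> b \<in> carrier R \<Longrightarrow> L (a \<oplus> b) = L a + L b" and a: "a \<in> carrier R"
  shows "L ([(k::int)] \<cdot> a) = k * (L a :: int)"
proof -
  have nat: "L ([(m::nat)] \<cdot> a) = int m * L a" for m
    using a by (induction m) (simp_all add: additive_zero[of L, OF L] L algebra_simps)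
  show ?thesis
  proof (cases "k \<ge> 0")
    case True
    then show ?thesis using nat[of "nat k"] by (simp add: add_pow_int_ge)
  next
    case False
    have "L (\<ominus> b) = - L b" if "b \<in> carrier R" for b
      using L[OF a_inv_closed[OF that] that] that by (simp add: l_neg additive_zero[of L, OF L])
    then show ?thesis using False nat[of "nat (- k)"] a by (simp add: add_pow_int_lt)
  qed
qed

lemma additive_finsum:
  assumes L: "\<And>a b. a \<in> carrier R \<Longrightarrow> b \<in> carrier R \<Longrightarrow> L (a \<oplus> b) = L a + L b"
    and "finite J" "b \<in> J \<rightarrow> carrier R"
  shows "L (\<Oplus>j\<in>J. [(c j :: int)] \<cdot> b j) = (\<Sum>j\<in>J. c j * (L (b j) :: int))"
  using assms(2,3)
proof (induction J)
  case empty
  then show ?case by (simp add: additive_zero[of L, OF L])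
next
  case (insert i J)
  then have "b i \<in> carrier R" "(\<lambda>j. [c j] \<cdot> b j) \<in> J \<rightarrow> carrier R" by auto
  then show ?case
    using insert additive_int[of L, OF L] by (simp add: L)
qed

text \<open>In a nontrivial relation, the functional that belongs to a term of minimal size kills all other
  terms but not this one.\<close>

lemma independent_by_functionals:
  fixes size :: "'i \<Rightarrow> nat"
  assumes b: "b \<in> I \<rightarrow> carrier R"
    and L: "\<And>i a a'. i \<in> I \<Longrightarrow> a \<in> carrier R \<Longrightarrow> a' \<in> carrier R \<Longrightarrow> L i (a \<oplus> a') = L i a + (L i a' :: int)"
    and diag: "\<And>i. i \<in> I \<Longrightarrow> L i (b i) \<noteq> 0"
    and off: "\<And>i j. i \<in> I \<Longrightarrow> j \<in> I \<Longrightarrow> j \<noteq> i \<Longrightarrow> size i \<le> size j \<Longrightarrow> L i (b j) = 0"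
  shows "z_independent R I b"
  unfolding z_independent_def
proof (intro conjI b allI impI ballI)
  fix J and c :: "'i \<Rightarrow> int" and j
  assume J: "finite J \<and> J \<subseteq> I \<and> (\<Oplus>j\<in>J. [c j] \<cdot> b j) = \<zero>" and j: "j \<in> J"
  show "c j = 0"
  proof (rule ccontr)
    assume "c j \<noteq> 0"
    define i where "i = arg_min size (\<lambda>i. i \<in> J \<and> c i \<noteq> 0)"
    have i: "i \<in> J" "c i \<noteq> 0" and least: "\<And>k. k \<in> J \<Longrightarrow> c k \<noteq> 0 \<Longrightarrow> size i \<le> size k"
      using arg_min_natI[of "\<lambda>i. i \<in> J \<and> c i \<noteq> 0" j size] arg_min_nat_le[of "\<lambda>i. i \<in> J \<and> c i \<noteq> 0" _ size]
        j \<open>c j \<noteq> 0\<close> unfolding i_def by blast+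
    have iI: "i \<in> I" using i J by blast
    have "b \<in> J \<rightarrow> carrier R" using b J by auto
    then have "(\<Sum>k\<in>J. c k * L i (b k)) = 0"
      using additive_finsum[of "L i" J b c] L[OF iI] J additive_zero[of "L i"] by simp
    moreover have "(\<Sum>k\<in>J. c k * L i (b k)) = (\<Sum>k\<in>J. if k = i then c i * L i (b i) else 0)"
      using least off[OF iI] J by (intro sum.cong refl) (metis mult_eq_0_iff subsetD)
    ultimately show False using i J diag[OF iI] by simp
  qed
qed

lemma spanned_representation:
  assumes b: "b \<in> I \<rightarrow> carrier R" and a: "a \<in> left_span R {} (b ` I)"
  shows "\<exists>J (c :: 'i \<Rightarrow> int). finite J \<and> J \<subseteq> I \<and> a = (\<Oplus>j\<in>J. [c j] \<cdot> b j)"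
  using a
proof (induction rule: left_span.induct)
  case (base a)
  then obtain i where i: "i \<in> I" "a = b i" by blast
  then have "b i \<in> carrier R" using b by blast
  then show ?case using i by (intro exI[of _ "{i}"] exI[of _ "\<lambda>_. 1"]) simp
next
  case zero
  then show ?case by (intro exI[of _ "{}"]) simp
next
  case (add a a')
  then obtain J c J' c' where J: "finite J" "J \<subseteq> I" "a = (\<Oplus>j\<in>J. [(c j :: int)] \<cdot> b j)"
    and J': "finite J'" "J' \<subseteq> I" "a' = (\<Oplus>j\<in>J'. [(c' j :: int)] \<cdot> b j)" by blast
  have bc: "b j \<in> carrier R" if "j \<in> J \<union> J'" for j using b J(2) J'(2) that by blast
  have extend: "(\<Oplus>j\<in>K. [(e j :: int)] \<cdot> b j) = (\<Oplus>j\<in>J \<union> J'. [(if j \<in> K then e j else 0)] \<cdot> b j)"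
    if "K \<subseteq> J \<union> J'" for K e
    using that J(1) J'(1) bc by (intro add.finprod_mono_neutral_cong_left) auto
  have "a \<oplus> a' = (\<Oplus>j\<in>J \<union> J'. [(if j \<in> J then c j else 0)] \<cdot> b j \<oplus> [(if j \<in> J' then c' j else 0)] \<cdot> b j)"
    unfolding J(3) J'(3) extend[OF Un_upper1] extend[OF Un_upper2]
    using bc by (intro finsum_addf[symmetric] funcsetI) auto
  also have "\<dots> = (\<Oplus>j\<in>J \<union> J'. [((if j \<in> J then c j else 0) + (if j \<in> J' then c' j else 0))] \<cdot> b j)"
    using bc by (intro finsum_cong' refl funcsetI) (auto simp only: add.int_pow_mult add.int_pow_closed)
  finally have sum: "a \<oplus> a' =
    (\<Oplus>j\<in>J \<union> J'. [((if j \<in> J then c j else 0) + (if j \<in> J' then c' j else 0))] \<cdot> b j)" .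
  show ?case
    by (rule exI[of _ "J \<union> J'"], rule exI[of _ "\<lambda>j. (if j \<in> J then c j else 0) + (if j \<in> J' then c' j else 0)"],
        intro conjI sum) (use J(1,2) J'(1,2) in blast)+
next
  case (neg a)
  then obtain J c where J: "finite J" "J \<subseteq> I" "a = (\<Oplus>j\<in>J. [(c j :: int)] \<cdot> b j)" by blast
  have bc: "b j \<in> carrier R" if "j \<in> J" for j using b J(2) that by blast
  have "(\<Oplus>j\<in>J. [(- c j)] \<cdot> b j) \<oplus> a = (\<Oplus>j\<in>J. [(- c j)] \<cdot> b j \<oplus> [c j] \<cdot> b j)"
    unfolding J(3) using bc by (intro finsum_addf[symmetric] funcsetI) auto
  also have "\<dots> = (\<Oplus>j\<in>J. \<zero>)"
    using bc by (intro finsum_cong' refl funcsetI) (auto simp: add.int_pow_neg l_neg)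
  finally have "\<ominus> a = (\<Oplus>j\<in>J. [(- c j)] \<cdot> b j)"
    using bc J(3) by (intro minus_equality) (auto intro!: finsum_closed)
  then show ?case using J(1,2) by (intro exI[of _ J] exI[of _ "\<lambda>j. - c j"]) simp
qed simp

lemma basisI:
  assumes "z_independent R I b" "\<And>a. a \<in> carrier R \<Longrightarrow> a \<in> left_span R {} (b ` I)"
  shows "z_basis R I b"
proof -
  have "b \<in> I \<rightarrow> carrier R" using assms(1) by (simp add: z_independent_def)
  from spanned_representation[OF this assms(2)] show ?thesis
    unfolding z_basis_def by (intro conjI ballI assms(1))
qed

end

lemma (in ring_hom_ring) hom_combination:
  assumes "finite J" "b \<in> J \<rightarrow> carrier R"
  shows "h (\<Oplus>\<^bsub>R\<^esub>j\<in>J. [(c j :: int)] \<cdot>\<^bsub>R\<^esub> b j) = (\<Oplus>\<^bsub>S\<^esub>j\<in>J. [c j] \<cdot>\<^bsub>S\<^esub> h (b j))"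
  using assms
proof (induction J)
  case (insert i J)
  have int: "h ([(k::int)] \<cdot>\<^bsub>R\<^esub> a) = [k] \<cdot>\<^bsub>S\<^esub> h a" if "a \<in> carrier R" for k a
  proof -
    have "h \<in> hom (add_monoid R) (add_monoid S)" by (auto simp: hom_def)
    from hom_int_pow[OF this _ R.a_group S.a_group] show ?thesis using that by (simp add: add_pow_def)
  qed
  have "b i \<in> carrier R" "(\<lambda>j. [c j] \<cdot>\<^bsub>R\<^esub> b j) \<in> J \<rightarrow> carrier R"
    "\<forall>j\<in>J. b j \<in> carrier R" using insert.prems by auto
  then have "(\<lambda>j. [c j] \<cdot>\<^bsub>S\<^esub> h (b j)) \<in> J \<rightarrow> carrier S" by simp
  with \<open>b i \<in> carrier R\<close> \<open>(\<lambda>j. [c j] \<cdot>\<^bsub>R\<^esub> b j) \<in> J \<rightarrow> carrier R\<close>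
  show ?case using insert by (simp add: int)
qed simp

text \<open>An element of the kernel is a combination of the basis whose image is a trivial combination.\<close>

lemma (in ring_hom_ring) basis_imp_injective:
  assumes "z_basis R I b" "z_independent S I (\<lambda>i. h (b i))" "a \<in> carrier R" "h a = \<zero>\<^bsub>S\<^esub>"
  shows "a = \<zero>\<^bsub>R\<^esub>"
proof -
  obtain J and c :: "'e \<Rightarrow> int" where J: "finite J" "J \<subseteq> I" "a = (\<Oplus>\<^bsub>R\<^esub>j\<in>J. [c j] \<cdot>\<^bsub>R\<^esub> b j)"
    using assms(1,3) unfolding z_basis_def by blast
  have b: "b \<in> J \<rightarrow> carrier R" using assms(1) J(2) unfolding z_basis_def z_independent_def by blast
  have "(\<Oplus>\<^bsub>S\<^esub>j\<in>J. [c j] \<cdot>\<^bsub>S\<^esub> h (b j)) = \<zero>\<^bsub>S\<^esub>"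
    using hom_combination[OF J(1) b] J(3) assms(4) by simp
  then have "\<forall>j\<in>J. c j = 0" using assms(2) J(1,2) unfolding z_independent_def by blast
  then have "a = (\<Oplus>\<^bsub>R\<^esub>j\<in>J. \<zero>\<^bsub>R\<^esub>)" unfolding J(3) by (intro R.finsum_cong') auto
  then show ?thesis by simp
qed

lemma (in ring_hom_ring) injective_independent:
  assumes inj: "\<And>a. a \<in> carrier R \<Longrightarrow> h a = \<zero>\<^bsub>S\<^esub> \<Longrightarrow> a = \<zero>\<^bsub>R\<^esub>" and ind: "z_independent R I b"
  shows "z_independent S I (\<lambda>i. h (b i))"
  unfolding z_independent_def
proof (intro conjI allI impI)
  have b: "b \<in> I \<rightarrow> carrier R" using ind by (simp add: z_independent_def)
  then have "\<forall>i\<in>I. b i \<in> carrier R" by blast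
  then show "(\<lambda>i. h (b i)) \<in> I \<rightarrow> carrier S" by simp
  fix J and c :: "'e \<Rightarrow> int"
  assume J: "finite J \<and> J \<subseteq> I \<and> (\<Oplus>\<^bsub>S\<^esub>j\<in>J. [c j] \<cdot>\<^bsub>S\<^esub> h (b j)) = \<zero>\<^bsub>S\<^esub>"
  then have bJ: "b \<in> J \<rightarrow> carrier R" using b by auto
  have "(\<lambda>j. [c j] \<cdot>\<^bsub>R\<^esub> b j) \<in> J \<rightarrow> carrier R" using bJ by auto
  then have "(\<Oplus>\<^bsub>R\<^esub>j\<in>J. [c j] \<cdot>\<^bsub>R\<^esub> b j) = \<zero>\<^bsub>R\<^esub>"
    using inj[OF R.finsum_closed] hom_combination[of J b c] J bJ by simp
  then show "\<forall>j\<in>J. c j = 0" using ind J unfolding z_independent_def by blast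
qed

context type_D begin

lemma weyl_D_iff: "w \<in> weyl_D n \<longleftrightarrow> (\<exists>is. set is \<subseteq> {1..n} \<and> w = wp is)"
proof
  interpret B: group "BijGroup (UNIV :: int set)" by (rule group_BijGroup)
  have carrier: "f \<in> carrier (BijGroup (UNIV :: int set)) \<longleftrightarrow> bij f" for f
    by (simp add: BijGroup_def Bij_def extensional_def)
  have mult: "f \<otimes>\<^bsub>BijGroup UNIV\<^esub> g = f \<circ> g" if "bij f" "bij g" for f g :: "int \<Rightarrow> int"
    using that by (simp add: BijGroup_def Bij_def extensional_def compose_def fun_eq_iff)
  have one: "\<one>\<^bsub>BijGroup UNIV\<^esub> = (id :: int \<Rightarrow> int)" by (simp add: BijGroup_def fun_eq_iff)
  {
    assume "w \<in> weyl_D n"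
    then show "\<exists>is. set is \<subseteq> {1..n} \<and> w = wp is"
      unfolding weyl_D_def
    proof (induction rule: generate.induct)
      case one
      then show ?case by (intro exI[of _ "[]"]) (simp add: \<open>\<one>\<^bsub>BijGroup UNIV\<^esub> = id\<close>)
    next
      case (incl h)
      then obtain i where "i \<in> {1..n}" "h = s i" by blast
      then show ?case by (intro exI[of _ "[i]"]) simp
    next
      case (inv h)
      then obtain i where i: "i \<in> {1..n}" "h = s i" by blast
      have "inv\<^bsub>BijGroup UNIV\<^esub> (s i) = s i"
        using bij_s[OF i(1)] s_comp_s[OF i(1)]
        by (intro B.inv_equality) (simp_all add: carrier mult \<open>\<one>\<^bsub>BijGroup UNIV\<^esub> = id\<close>)
      then show ?case using i by (intro exI[of _ "[i]"]) simp
    next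
      case (eng h1 h2)
      then obtain us vs where "set us \<subseteq> {1..n}" "h1 = wp us" "set vs \<subseteq> {1..n}" "h2 = wp vs" by blast
      then show ?case by (intro exI[of _ "us @ vs"]) (simp add: mult wp_bij)
    qed
  }
  {
    assume "\<exists>is. set is \<subseteq> {1..n} \<and> w = wp is"
    then obtain "is" where "set is \<subseteq> {1..n}" "w = wp is" by blast
    moreover have "wp is \<in> generate (BijGroup UNIV) (s ` {1..n})" if "set is \<subseteq> {1..n}" for "is"
      using that
    proof (induction "is")
      case Nil
      show ?case using generate.one[of "BijGroup (UNIV :: int set)" "s ` {1..n}"] by (simp only: one wp_Nil)
    next
      case (Cons i "is")
      then have "s i \<otimes>\<^bsub>BijGroup UNIV\<^esub> wp is \<in> generate (BijGroup UNIV) (s ` {1..n})"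
        by (intro generate.eng[OF generate.incl]) auto
      moreover have "s i \<otimes>\<^bsub>BijGroup UNIV\<^esub> wp is = wp (i # is)"
        using Cons.prems by (simp add: mult bij_s wp_bij)
      ultimately show ?case by (simp only:)
    qed
    ultimately show "w \<in> weyl_D n" by (simp add: weyl_D_def)
  }
qed

end

context nil_hecke begin

abbreviation "h \<equiv> nh_act n"
abbreviation "dw \<equiv> nh_d_word n"

lemma d_word_eq: "N.d_word = dw"
  by (rule ext) (simp only: N.d_word_def nh_d_word_def, simp only: N_NH)

sublocale h: ring_hom_ring N E h
  by (rule ring_hom_ringI2[OF N.ring_axioms E.ring_axioms nh_act_props(1)])

lemma act_mult:
  assumes "a \<in> carrier N" "b \<in> carrier N" "f \<in> carrier P"
  shows "h (a \<otimes>\<^bsub>N\<^esub> b) f = h a (h b f)"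
  using assms by (simp add: E_apply)

lemma act_closed [simp]: "a \<in> carrier N \<Longrightarrow> f \<in> carrier P \<Longrightarrow> h a f \<in> carrier P"
  using h.hom_closed[of a] by (auto simp: end_ring_mem)

lemma act_d_word: "set is \<subseteq> {1..n} \<Longrightarrow> f \<in> carrier P \<Longrightarrow> h (dw is) f = D_word is f"
proof (induction "is")
  case Nil
  then show ?case by (simp add: d_word_eq[symmetric] E_apply)
next
  case (Cons i "is")
  then show ?case
    using act_mult[OF nh_d_closed[of i] N.d_word_closed[of "is"]]
    by (simp add: d_word_eq[symmetric] nh_act_props(3))
qed

definition x_word :: "(nat \<Rightarrow> nat) \<Rightarrow> nat list \<Rightarrow> (nh_gen list \<Rightarrow> int) set" where
  "x_word r is = foldr (\<lambda>i a. (nh_x n i [^]\<^bsub>N\<^esub> r i) \<otimes>\<^bsub>N\<^esub> a) is \<one>\<^bsub>N\<^esub>"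

lemma x_word_simps [simp]:
  "x_word r [] = \<one>\<^bsub>N\<^esub>" "x_word r (i # is) = (nh_x n i [^]\<^bsub>N\<^esub> r i) \<otimes>\<^bsub>N\<^esub> x_word r is"
  by (simp_all add: x_word_def)

lemma x_word_closed [simp]: "set is \<subseteq> {1..n} \<Longrightarrow> x_word r is \<in> carrier N"
  by (induction "is") (auto simp: nh_x_closed)

lemma nh_monom_x_word: "nh_monom n r = x_word r [1..<Suc n]"
  by (simp only: nh_monom_def x_word_def) (simp only: N_NH)

lemma nh_monom_closed: "nh_monom n r \<in> carrier N"
  unfolding nh_monom_x_word by (rule x_word_closed) auto

lemma act_x_power:
  "i \<in> {1..n} \<Longrightarrow> f \<in> carrier P \<Longrightarrow> h (nh_x n i [^]\<^bsub>N\<^esub> k) f = (x i [^] k) \<otimes> f" for k :: nat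
proof (induction k)
  case (Suc k)
  have "h (nh_x n i [^]\<^bsub>N\<^esub> Suc k) f = x i \<otimes> ((x i [^] k) \<otimes> f)"
    unfolding N.nat_pow_Suc2[OF nh_x_closed[OF Suc.prems(1)]]
    using Suc act_mult[OF nh_x_closed[OF Suc.prems(1)] N.nat_pow_closed[OF nh_x_closed[OF Suc.prems(1)]]]
    by (simp add: nh_act_props(2) Lx_apply)
  then show ?case
    unfolding nat_pow_Suc2[OF x_closed[OF Suc.prems(1)]]
    using Suc.prems by (simp add: m_assoc)
qed (simp add: E_apply)

lemma act_monom:
  assumes "f \<in> carrier P"
  shows "h (nh_monom n r) f = monomial r \<otimes> f"
proof -
  have "h (x_word r is) f = foldr (\<lambda>i a. (x i [^] r i) \<otimes> a) is \<one> \<otimes> f" if "set is \<subseteq> {1..n}" for "is"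
    using that
  proof (induction "is")
    case (Cons i "is")
    then have i: "i \<in> {1..n}" "set is \<subseteq> {1..n}" by auto
    show ?case
      using Cons i assms act_x_power[OF i(1), of _ "r i"] monomial_foldr_closed[OF i(2), of r]
        act_mult[OF N.nat_pow_closed[OF nh_x_closed[OF i(1)]] x_word_closed[OF i(2)]]
      by (simp add: m_assoc)
  qed (use assms in \<open>simp add: E_apply\<close>)
  moreover have "set [1..<Suc n] \<subseteq> {1..n}" by auto
  ultimately show ?thesis unfolding nh_monom_x_word monomial_def by blast
qed

text \<open>The product of generators along this word is nonzero, as its action shows; along a non-reduced
  word it would vanish.\<close>

lemma longest_reduced: "reduced (longest_word (n - 2))"
proof -
  have m: "n - 2 + 2 \<le> n" using n_ge_2 by simp
  have letters: "set (longest_word (n - 2)) \<subseteq> {1..n}"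
    using longest_word_letters[of "n - 2"] n_ge_2 by auto
  have nz: "dw (longest_word (n - 2)) \<noteq> \<zero>\<^bsub>N\<^esub>"
  proof
    assume "dw (longest_word (n - 2)) = \<zero>\<^bsub>N\<^esub>"
    then have "[(2 ^ (n - 2 + 1) :: int)] \<cdot> \<one> = \<zero>"
      using act_d_word[OF letters top_poly_closed[OF m]] longest_top[OF m] top_poly_closed[OF m]
      by (simp add: E_apply)
    moreover have "coefficient (\<lambda>_. 0) \<one> = 1"
      using ring_hom_one[OF \<rho>_props(1)]
      by (simp add: coefficient_def end_ring_simps) (simp add: exponent_group_def unit_vector_def)
    ultimately show False
      using additive_int[of "coefficient (\<lambda>_. 0)" \<one> "2 ^ (n - 2 + 1)"] coefficient_add
        additive_zero[of "coefficient (\<lambda>_. 0)"] by simp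
  qed
  show "reduced (longest_word (n - 2))"
    using N.d_word_not_reduced[OF letters] nz unfolding d_word_eq by blast
qed

definition extend_zero :: "(nat \<Rightarrow> nat) \<Rightarrow> nat \<Rightarrow> nat" where
  "extend_zero r = (\<lambda>j. if j \<in> {1..n} then r j else 0)"

text \<open>The functional of \<open>(w, r)\<close> composes an operator with the divided difference operator of a word
  completing \<open>red w\<close> to the longest element, evaluates at \<open>top_poly\<close>, and takes the coefficient at
  the exponent vector \<open>r\<close>. By \<open>complement_word\<close> it is triangular with respect to the length.\<close>

lemma act_functionals:
  assumes red: "\<And>w. w \<in> weyl_D n \<Longrightarrow> reduced_expr n w (red w)"
  obtains L :: "(int \<Rightarrow> int) \<times> (nat \<Rightarrow> nat) \<Rightarrow> ((nat list \<Rightarrow> int) set \<Rightarrow> (nat list \<Rightarrow> int) set) \<Rightarrow> int"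
  where "\<And>i T T'. i \<in> basis_index n \<Longrightarrow> T \<in> carrier E \<Longrightarrow> T' \<in> carrier E \<Longrightarrow> L i (T \<oplus>\<^bsub>E\<^esub> T') = L i T + L i T'"
    and "\<And>w r. (w, r) \<in> basis_index n \<Longrightarrow> L (w, r) (h (nh_monom n r \<otimes>\<^bsub>N\<^esub> dw (red w))) \<noteq> 0"
    and "\<And>w r v t. (w, r) \<in> basis_index n \<Longrightarrow> (v, t) \<in> basis_index n \<Longrightarrow> (v, t) \<noteq> (w, r) \<Longrightarrow>
      length (red w) \<le> length (red v) \<Longrightarrow> L (w, r) (h (nh_monom n t \<otimes>\<^bsub>N\<^esub> dw (red v))) = 0"
proof -
  define g where "g = top_poly (n - 2)"
  define w0 where "w0 = longest_word (n - 2)"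
  have m: "n - 2 + 2 \<le> n" "n - 2 \<le> n - 2" using n_ge_2 by simp_all
  have g: "g \<in> carrier P" unfolding g_def by (rule top_poly_closed[OF m(1)])
  have w0_letters: "set w0 \<subseteq> {1..n}"
    unfolding w0_def using longest_word_letters[OF m(2)] n_ge_2 by auto
  have redw: "reduced (red w)" "wp (red w) = w" if "w \<in> weyl_D n" for w
    using red[OF that] by (auto simp: reduced_expr_iff)
  have "\<exists>us. reduced us \<and> wp (red w @ us) = wp w0 \<and> reduced (red w @ us) \<and>
      (\<forall>js. reduced (js @ us) \<and> length (red w) \<le> length js \<longrightarrow> wp js = wp (red w))" if "w \<in> weyl_D n" for w
    using complement_word[OF w0_letters longest_height[folded w0_def] redw(1)[OF that]] by metis
  then obtain U where U: "\<And>w. w \<in> weyl_D n \<Longrightarrow> reduced (U w) \<and> wp (red w @ U w) = wp w0 \<and>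
      reduced (red w @ U w) \<and> (\<forall>js. reduced (js @ U w) \<and> length (red w) \<le> length js \<longrightarrow> wp js = wp (red w))"
    by metis
  define L where "L = (\<lambda>(w, r) T. coefficient (extend_zero r) (T (D_word (U w) g)))"
  have U_closed: "D_word (U w) g \<in> carrier P" if "w \<in> weyl_D n" for w
    using D_word_closed[OF reduced_letters g] U[OF that] by blast
  have eval: "L (w, r) (h (nh_monom n t \<otimes>\<^bsub>N\<^esub> dw (red v))) =
      coefficient (extend_zero r) (monomial t \<otimes> h (dw (red v @ U w)) g)"
    if "w \<in> weyl_D n" "v \<in> weyl_D n" for w v r t
  proof -
    have letters: "set (red v) \<subseteq> {1..n}" "set (red v @ U w) \<subseteq> {1..n}"
      using reduced_letters[OF redw(1)[OF that(2)]] reduced_letters[of "U w"] U[OF that(1)] by auto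
    have dw_closed: "dw (red v) \<in> carrier N" using N.d_word_closed[OF letters(1)] by (simp add: d_word_eq)
    have "h (nh_monom n t \<otimes>\<^bsub>N\<^esub> dw (red v)) (D_word (U w) g) = monomial t \<otimes> h (dw (red v)) (D_word (U w) g)"
      using act_mult[OF nh_monom_closed dw_closed U_closed[OF that(1)]]
        act_monom[OF act_closed[OF dw_closed U_closed[OF that(1)]]] by simp
    also have "h (dw (red v)) (D_word (U w) g) = h (dw (red v @ U w)) g"
      using act_d_word[OF letters(1) U_closed[OF that(1)]] act_d_word[OF letters(2) g] by simp
    finally show ?thesis by (simp add: L_def)
  qed
  have mon: "monomial t \<in> carrier P" for t unfolding monomial_def by (rule monomial_foldr_closed) auto
  have coef_add: "coefficient s (a \<oplus> b) = coefficient s a + coefficient s b"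
    if "a \<in> carrier P" "b \<in> carrier P" for s a b using coefficient_add[OF that] .
  have coef_zero: "coefficient s \<zero> = 0" for s
    using additive_zero[of "coefficient s"] coef_add by blast
  have coef_int: "coefficient s ([(k::int)] \<cdot> a) = k * coefficient s a" if "a \<in> carrier P" for s k a
    using additive_int[of "coefficient s"] coef_add that by blast
  have diag: "coefficient (extend_zero r) (monomial t \<otimes> h (dw (red w @ U w)) g) =
      2 ^ (n - 2 + 1) * coefficient (extend_zero r) (monomial t) \<or>
      coefficient (extend_zero r) (monomial t \<otimes> h (dw (red w @ U w)) g) =
      - (2 ^ (n - 2 + 1)) * coefficient (extend_zero r) (monomial t)"
    if w: "w \<in> weyl_D n" for w r t
  proof -
    have letters: "set (red w @ U w) \<subseteq> {1..n}" using reduced_letters U[OF w] by blast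
    note closed = N.d_word_closed[OF letters, unfolded d_word_eq] N.d_word_closed[OF w0_letters, unfolded d_word_eq]
    have "h (dw w0) g = [(2 ^ (n - 2 + 1) :: int)] \<cdot> \<one>"
      using act_d_word[OF w0_letters g] longest_top[OF m(1)] by (simp add: g_def w0_def)
    moreover have "eq_upto_sign N (dw (red w @ U w)) (dw w0)"
      using N.matsumoto[OF _ longest_reduced[folded w0_def]] U[OF w] unfolding d_word_eq by blast
    then have "h (dw (red w @ U w)) g = h (dw w0) g \<or> h (dw (red w @ U w)) g = \<ominus> h (dw w0) g"
      unfolding eq_upto_sign_def using h.hom_a_inv[OF closed(2)] E_neg_apply[OF h.hom_closed[OF closed(2)] g]
      by auto
    ultimately have "h (dw (red w @ U w)) g = [(2 ^ (n - 2 + 1) :: int)] \<cdot> \<one> \<or>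
        h (dw (red w @ U w)) g = [(- (2 ^ (n - 2 + 1)) :: int)] \<cdot> \<one>"
      by (simp add: add.int_pow_neg)
    then show ?thesis using mon by (auto simp: add_pow_rdistr_int coef_int)
  qed
  show ?thesis
  proof (rule that[of L])
    fix i T T' assume "i \<in> basis_index n" "T \<in> carrier E" "T' \<in> carrier E"
    moreover obtain w r where "i = (w, r)" by (cases i)
    ultimately have *: "w \<in> weyl_D n" "T \<in> carrier E" "T' \<in> carrier E" "i = (w, r)"
      by (auto simp: basis_index_def)
    then have "T (D_word (U w) g) \<in> carrier P" "T' (D_word (U w) g) \<in> carrier P"
      using U_closed[OF *(1)] by (auto simp: end_ring_mem)
    then show "L i (T \<oplus>\<^bsub>E\<^esub> T') = L i T + L i T'"
      using * U_closed[OF *(1)] by (simp add: L_def E_apply coef_add)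
  next
    fix w r assume "(w, r) \<in> basis_index n"
    then have *: "w \<in> weyl_D n" "r \<in> {1..n} \<rightarrow>\<^sub>E UNIV" by (auto simp: basis_index_def)
    have "coefficient (extend_zero r) (monomial r) = 1"
      using coefficient_monomial[OF *(2) *(2)] by (simp add: extend_zero_def)
    then show "L (w, r) (h (nh_monom n r \<otimes>\<^bsub>N\<^esub> dw (red w))) \<noteq> 0"
      using eval[OF *(1) *(1)] diag[OF *(1), of r r] by auto
  next
    fix w r v t
    assume wr: "(w, r) \<in> basis_index n" and vt: "(v, t) \<in> basis_index n" and ne: "(v, t) \<noteq> (w, r)"
      and len: "length (red w) \<le> length (red v)"
    then have *: "w \<in> weyl_D n" "r \<in> {1..n} \<rightarrow>\<^sub>E UNIV" "v \<in> weyl_D n" "t \<in> {1..n} \<rightarrow>\<^sub>E UNIV"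
      by (auto simp: basis_index_def)
    show "L (w, r) (h (nh_monom n t \<otimes>\<^bsub>N\<^esub> dw (red v))) = 0"
    proof (cases "v = w")
      case True
      then have "coefficient (extend_zero r) (monomial t) = 0"
        using coefficient_monomial[OF *(2,4)] ne by (auto simp: extend_zero_def)
      then show ?thesis using eval[OF *(1) *(3)] diag[OF *(1), of r t] True by auto
    next
      case False
      have "\<not> reduced (red v @ U w)"
        using U[OF *(1)] len redw[OF *(1)] redw[OF *(3)] False by auto
      moreover have "set (red v @ U w) \<subseteq> {1..n}"
        using reduced_letters[OF redw(1)[OF *(3)]] reduced_letters[of "U w"] U[OF *(1)] by auto
      ultimately have "dw (red v @ U w) = \<zero>\<^bsub>N\<^esub>" using N.d_word_not_reduced unfolding d_word_eq by blast
      then show ?thesis using eval[OF *(1) *(3)] g mon by (simp add: E_apply coef_zero)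
    qed
  qed
qed

text \<open>The relation \<open>D_x\<close> between operators holds in the algebra already.\<close>

lemma nh_d_x:
  assumes "i \<in> {1..n}" "j \<in> {1..n}"
  shows "nh_d n i \<otimes>\<^bsub>N\<^esub> nh_x n j = [(coef i j)] \<cdot>\<^bsub>N\<^esub> \<one>\<^bsub>N\<^esub> \<oplus>\<^bsub>N\<^esub>
    [(eps i j)] \<cdot>\<^bsub>N\<^esub> (nh_x n (perm i j) \<otimes>\<^bsub>N\<^esub> nh_d n i)"
proof -
  note rel = nh_relationsD[OF nh_relations_N]
  have move: "a = c \<oplus>\<^bsub>N\<^esub> \<ominus>\<^bsub>N\<^esub> b" if "a \<in> carrier N" "b \<in> carrier N" "a \<oplus>\<^bsub>N\<^esub> b = c" for a b c
    using that by (auto simp: N.a_assoc N.r_neg)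
  have xd: "nh_x n k \<in> carrier N" "nh_d n k \<in> carrier N" if "1 \<le> k" "k \<le> n" for k
    using that by (simp_all add: nh_x_closed nh_d_closed)
  have neg: "[(- 1::int)] \<cdot>\<^bsub>N\<^esub> a = \<ominus>\<^bsub>N\<^esub> a" if "a \<in> carrier N" for a
    using that by (simp add: N.add.int_pow_neg)
  show ?thesis
  proof (cases "i < n")
    case True
    then have l: "lower i = i" "\<eta> i = 1" and i: "1 \<le> i" "i < n" using assms by (auto simp: lower_def \<eta>_def)
    consider "j = i" | "j = i + 1" | "j \<noteq> i" "j \<noteq> i + 1" by blast
    then show ?thesis
    proof cases
      case 1
      have "nh_d n i \<otimes>\<^bsub>N\<^esub> nh_x n i = \<one>\<^bsub>N\<^esub> \<oplus>\<^bsub>N\<^esub> \<ominus>\<^bsub>N\<^esub> (nh_x n (i + 1) \<otimes>\<^bsub>N\<^esub> nh_d n i)"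
        using i xd by (intro move rel(6)) auto
      then show ?thesis using 1 i xd by (simp add: coef_def eps_def perm_def l neg)
    next
      case 2
      have "nh_d n i \<otimes>\<^bsub>N\<^esub> nh_x n (i + 1) = \<one>\<^bsub>N\<^esub> \<oplus>\<^bsub>N\<^esub> \<ominus>\<^bsub>N\<^esub> (nh_x n i \<otimes>\<^bsub>N\<^esub> nh_d n i)"
        using i xd rel(5)[OF i] by (intro move) (auto simp: N.a_comm)
      then show ?thesis using 2 i xd by (simp add: coef_def eps_def perm_def l neg)
    next
      case 3
      have "nh_d n i \<otimes>\<^bsub>N\<^esub> nh_x n j = \<zero>\<^bsub>N\<^esub> \<oplus>\<^bsub>N\<^esub> \<ominus>\<^bsub>N\<^esub> (nh_x n j \<otimes>\<^bsub>N\<^esub> nh_d n i)"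
        using i assms(2) 3 xd by (intro move rel(7)) auto
      then show ?thesis using 3 i assms(2) xd by (simp add: coef_def eps_def perm_def transpose_def l neg)
    qed
  next
    case False
    then have i: "i = n" using assms(1) by simp
    have n1: "1 \<le> n - 1" "n - 1 \<le> n" "1 \<le> n" "n \<le> n" "n - 1 \<noteq> n" "n \<noteq> n - 1" "n - 1 + 1 = n"
      using n_ge_2 by auto
    have l: "lower n = n - 1" "\<eta> n = - 1" by (simp_all add: lower_def \<eta>_def)
    note closed = xd[OF n1(1,2)] xd[OF n1(3,4)]
    consider "j = n - 1" | "j = n" | "j \<noteq> n - 1" "j \<noteq> n" by blast
    then show ?thesis
    proof cases
      case 1
      have "nh_d n n \<otimes>\<^bsub>N\<^esub> nh_x n (n - 1) = \<one>\<^bsub>N\<^esub> \<oplus>\<^bsub>N\<^esub> \<ominus>\<^bsub>N\<^esub> (\<ominus>\<^bsub>N\<^esub> (nh_x n n \<otimes>\<^bsub>N\<^esub> nh_d n n))"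
        using closed rel(13) by (intro move) (auto simp: a_minus_def)
      then show ?thesis using 1 i n1 closed unfolding coef_def eps_def perm_def by (simp add: l)
    next
      case 2
      have "\<ominus>\<^bsub>N\<^esub> (nh_d n n \<otimes>\<^bsub>N\<^esub> nh_x n n) = \<one>\<^bsub>N\<^esub> \<oplus>\<^bsub>N\<^esub> \<ominus>\<^bsub>N\<^esub> (nh_x n (n - 1) \<otimes>\<^bsub>N\<^esub> nh_d n n)"
        using closed rel(12) by (intro move) (auto simp: a_minus_def N.a_comm)
      then have "nh_d n n \<otimes>\<^bsub>N\<^esub> nh_x n n = \<ominus>\<^bsub>N\<^esub> \<one>\<^bsub>N\<^esub> \<oplus>\<^bsub>N\<^esub> nh_x n (n - 1) \<otimes>\<^bsub>N\<^esub> nh_d n n"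
        using closed N.minus_minus[of "nh_d n n \<otimes>\<^bsub>N\<^esub> nh_x n n"] by (simp add: N.minus_add)
      then show ?thesis using n1 closed unfolding coef_def eps_def perm_def 2 i l n1(7) by (simp add: neg)
    next
      case 3
      then have j: "1 \<le> j" "j + 2 \<le> n" "j \<le> n" using assms(2) by auto
      have "nh_d n n \<otimes>\<^bsub>N\<^esub> nh_x n j = \<zero>\<^bsub>N\<^esub> \<oplus>\<^bsub>N\<^esub> \<ominus>\<^bsub>N\<^esub> (nh_x n j \<otimes>\<^bsub>N\<^esub> nh_d n n)"
        using closed xd[OF j(1,3)] by (intro move rel(14) j(1,2)) auto
      then show ?thesis using 3 closed xd[OF j(1,3)]
        unfolding coef_def eps_def perm_def i l n1(7) by (simp add: neg transpose_def)
    qed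
  qed
qed

lemma x_anticommute_N:
  "i \<in> {1..n} \<Longrightarrow> j \<in> {1..n} \<Longrightarrow> i \<noteq> j \<Longrightarrow>
    eq_upto_sign N (nh_x n i \<otimes>\<^bsub>N\<^esub> nh_x n j) (nh_x n j \<otimes>\<^bsub>N\<^esub> nh_x n i)"
  using nh_relationsD(1)[OF nh_relations_N, of i j] nh_x_closed[of i] nh_x_closed[of j]
    N.minus_equality[of "nh_x n i \<otimes>\<^bsub>N\<^esub> nh_x n j" "nh_x n j \<otimes>\<^bsub>N\<^esub> nh_x n i"]
  by (simp add: eq_upto_sign_def)

lemma x_power_commute:
  fixes k :: nat
  assumes "i \<in> {1..n}" "j \<in> {1..n}" "i \<noteq> j"
  shows "eq_upto_sign N (nh_x n j \<otimes>\<^bsub>N\<^esub> (nh_x n i [^]\<^bsub>N\<^esub> k)) ((nh_x n i [^]\<^bsub>N\<^esub> k) \<otimes>\<^bsub>N\<^esub> nh_x n j)"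
proof (induction k)
  case 0
  then show ?case using nh_x_closed[OF assms(2)] by (simp add: N.eq_upto_sign_refl)
next
  case (Suc k)
  let ?a = "nh_x n i" and ?b = "nh_x n j" and ?p = "nh_x n i [^]\<^bsub>N\<^esub> k"
  have c: "?a \<in> carrier N" "?b \<in> carrier N" "?p \<in> carrier N"
    using assms by (simp_all add: nh_x_closed)
  have "eq_upto_sign N ((?b \<otimes>\<^bsub>N\<^esub> ?p) \<otimes>\<^bsub>N\<^esub> ?a) ((?p \<otimes>\<^bsub>N\<^esub> ?b) \<otimes>\<^bsub>N\<^esub> ?a)"
    using c by (intro N.eq_upto_sign_mult[OF _ _ Suc N.eq_upto_sign_refl]) auto
  moreover have "eq_upto_sign N (?p \<otimes>\<^bsub>N\<^esub> (?b \<otimes>\<^bsub>N\<^esub> ?a)) (?p \<otimes>\<^bsub>N\<^esub> (?a \<otimes>\<^bsub>N\<^esub> ?b))"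
    using c assms by (intro N.eq_upto_sign_mult[OF _ _ N.eq_upto_sign_refl x_anticommute_N]) auto
  ultimately show ?case
    using c N.eq_upto_sign_trans[of "?p \<otimes>\<^bsub>N\<^esub> (?a \<otimes>\<^bsub>N\<^esub> ?b)"] by (simp add: N.m_assoc)
qed

lemma x_word_commute:
  assumes "i \<in> {1..n}" "set is \<subseteq> {1..n}" "i \<notin> set is"
  shows "eq_upto_sign N (x_word r is \<otimes>\<^bsub>N\<^esub> nh_x n i) (nh_x n i \<otimes>\<^bsub>N\<^esub> x_word r is)"
  using assms(2,3)
proof (induction "is")
  case Nil
  then show ?case using nh_x_closed[OF assms(1)] by (simp add: N.eq_upto_sign_refl)
next
  case (Cons j "is")
  let ?a = "nh_x n i" and ?p = "nh_x n j [^]\<^bsub>N\<^esub> r j" and ?w = "x_word r is"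
  have j: "j \<in> {1..n}" "j \<noteq> i" and set: "set is \<subseteq> {1..n}" "i \<notin> set is" using Cons.prems by auto
  have c: "?a \<in> carrier N" "?p \<in> carrier N" "?w \<in> carrier N"
    using assms(1) j set by (simp_all add: nh_x_closed)
  have "eq_upto_sign N (?p \<otimes>\<^bsub>N\<^esub> (?w \<otimes>\<^bsub>N\<^esub> ?a)) (?p \<otimes>\<^bsub>N\<^esub> (?a \<otimes>\<^bsub>N\<^esub> ?w))"
    using c by (intro N.eq_upto_sign_mult[OF _ _ N.eq_upto_sign_refl Cons.IH[OF set]]) auto
  moreover have "eq_upto_sign N ((?p \<otimes>\<^bsub>N\<^esub> ?a) \<otimes>\<^bsub>N\<^esub> ?w) ((?a \<otimes>\<^bsub>N\<^esub> ?p) \<otimes>\<^bsub>N\<^esub> ?w)"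
    using c by (intro N.eq_upto_sign_mult[OF _ _
      N.eq_upto_sign_sym[OF _ x_power_commute[OF j(1) assms(1) j(2)]] N.eq_upto_sign_refl]) auto
  ultimately show ?case
    using c N.eq_upto_sign_trans[of "?a \<otimes>\<^bsub>N\<^esub> (?p \<otimes>\<^bsub>N\<^esub> ?w)"] by (simp add: N.m_assoc)
qed

lemma x_word_cong: "(\<And>j. j \<in> set is \<Longrightarrow> r j = r' j) \<Longrightarrow> x_word r is = x_word r' is"
  by (induction "is") auto

lemma x_times_x_word:
  assumes "i \<in> set is" "set is \<subseteq> {1..n}" "distinct is"
  shows "eq_upto_sign N (nh_x n i \<otimes>\<^bsub>N\<^esub> x_word r is) (x_word (r(i := Suc (r i))) is)"
  using assms
proof (induction "is")
  case (Cons j "is")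
  let ?a = "nh_x n i" and ?w = "x_word r is" and ?r = "r(i := Suc (r i))"
  have set: "set is \<subseteq> {1..n}" "j \<in> {1..n}" "i \<in> {1..n}" using Cons.prems by auto
  have c: "?a \<in> carrier N" "nh_x n j [^]\<^bsub>N\<^esub> r j \<in> carrier N" "?w \<in> carrier N" "x_word ?r is \<in> carrier N"
    using set by (simp_all add: nh_x_closed del: fun_upd_apply)
  show ?case
  proof (cases "i = j")
    case True
    then have word: "x_word (r(j := Suc (r j))) is = ?w" using Cons.prems(3) by (intro x_word_cong) auto
    have power: "nh_x n j [^]\<^bsub>N\<^esub> Suc (r j) = nh_x n j \<otimes>\<^bsub>N\<^esub> (nh_x n j [^]\<^bsub>N\<^esub> r j)"
      using N.nat_pow_Suc2[OF nh_x_closed[OF set(2)]] .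
    have "x_word ?r (j # is) = ?a \<otimes>\<^bsub>N\<^esub> x_word r (j # is)"
      unfolding x_word_simps True fun_upd_same power word
      by (rule N.m_assoc[OF nh_x_closed[OF set(2)] c(2,3)])
    then show ?thesis by (simp only: N.eq_upto_sign_refl)
  next
    case False
    have "eq_upto_sign N ((?a \<otimes>\<^bsub>N\<^esub> (nh_x n j [^]\<^bsub>N\<^esub> r j)) \<otimes>\<^bsub>N\<^esub> ?w)
        (((nh_x n j [^]\<^bsub>N\<^esub> r j) \<otimes>\<^bsub>N\<^esub> ?a) \<otimes>\<^bsub>N\<^esub> ?w)"
      using c False by (intro N.eq_upto_sign_mult[OF _ _ x_power_commute[OF set(2,3)] N.eq_upto_sign_refl]) auto
    moreover have "eq_upto_sign N ((nh_x n j [^]\<^bsub>N\<^esub> r j) \<otimes>\<^bsub>N\<^esub> (?a \<otimes>\<^bsub>N\<^esub> ?w))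
        ((nh_x n j [^]\<^bsub>N\<^esub> r j) \<otimes>\<^bsub>N\<^esub> x_word ?r is)"
      using c Cons.prems False by (intro N.eq_upto_sign_mult[OF _ _ N.eq_upto_sign_refl Cons.IH]) auto
    ultimately show ?thesis
      using c fun_upd_other[OF not_sym[OF False], of r]
        N.eq_upto_sign_trans[of "(nh_x n j [^]\<^bsub>N\<^esub> r j) \<otimes>\<^bsub>N\<^esub> x_word ?r is"]
      by (simp add: N.m_assoc del: fun_upd_apply)
  qed
qed simp

text \<open>Closure under left multiplication by \<open>x\<^sub>j\<close> is built into the larger span, closure under \<open>\<partial>\<^sub>i\<close>
  is proved for it, and only afterwards are the products of variables sorted into monomials.\<close>

lemma monom_spanning:
  assumes red: "\<And>w. w \<in> weyl_D n \<Longrightarrow> reduced_expr n w (red w)" and a: "a \<in> carrier N"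
  shows "a \<in> left_span N {} ((\<lambda>(w, r). nh_monom n r \<otimes>\<^bsub>N\<^esub> dw (red w)) ` basis_index n)"
    (is "a \<in> left_span N {} ?B")
proof -
  let ?X = "nh_x n ` {1..n}" and ?D = "(\<lambda>w. dw (red w)) ` weyl_D n"
  have redw: "reduced (red w)" "wp (red w) = w" if "w \<in> weyl_D n" for w
    using red[OF that] by (auto simp: reduced_expr_iff)
  have dw_closed: "dw (red w) \<in> carrier N" if "w \<in> weyl_D n" for w
    using N.d_word_closed[OF reduced_letters[OF redw(1)[OF that]]] by (simp add: d_word_eq)
  have X_closed: "?X \<subseteq> carrier N" using nh_x_closed by blast
  have D_closed: "?D \<subseteq> carrier N" using dw_closed by blast
  have B_closed: "?B \<subseteq> carrier N" using dw_closed nh_monom_closed by (auto simp: basis_index_def)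
  note S_closed = N.left_span_closed[OF X_closed D_closed]
  \<comment> \<open>the generator moves past the variables until it meets a word of generators, where it
    lengthens a reduced word up to sign or gives zero\<close>
  have S_d: "nh_d n i \<otimes>\<^bsub>N\<^esub> b \<in> left_span N ?X ?D" if b: "b \<in> left_span N ?X ?D" and i: "i \<in> {1..n}" for b i
    using b i
  proof (induction arbitrary: i rule: left_span.induct)
    case (base b)
    then obtain w where w: "w \<in> weyl_D n" "b = dw (red w)" by blast
    have "s i \<circ> w \<in> weyl_D n"
    proof -
      obtain us where "set us \<subseteq> {1..n}" "w = wp us" using w(1) weyl_D_iff by blast
      then show ?thesis using base.prems unfolding weyl_D_iff by (intro exI[of _ "i # us"]) simp
    qed
    then have "nh_d n i \<otimes>\<^bsub>N\<^esub> b = \<zero>\<^bsub>N\<^esub> \<or> eq_upto_sign N (nh_d n i \<otimes>\<^bsub>N\<^esub> b) (dw (red (s i \<circ> w)))"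
      using N.d_word_product[OF redw(1)[OF w(1)] redw(1) _ base.prems] redw(2)[OF w(1)] redw(2)
      by (simp add: d_word_eq w(2))
    moreover have "dw (red (s i \<circ> w)) \<in> left_span N ?X ?D"
      using \<open>s i \<circ> w \<in> weyl_D n\<close> by (intro left_span.base) blast
    ultimately show ?case using N.left_span_sign left_span.zero by metis
  next
    case zero
    then show ?case using nh_d_closed by (simp add: left_span.zero)
  next
    case (add a b)
    then show ?case using S_closed nh_d_closed[of i] by (simp add: N.r_distr left_span.add)
  next
    case (neg a)
    then show ?case using S_closed nh_d_closed[of i] by (simp add: N.r_minus left_span.neg)
  next
    case (mult c a)
    then obtain j where j: "j \<in> {1..n}" "c = nh_x n j" by blast
    have a: "a \<in> carrier N" using S_closed[OF mult(2)] .
    have p: "perm i j \<in> {1..n}" by (rule perm_closed[OF mult.prems j(1)])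
    have int_mem: "[(k::int)] \<cdot>\<^bsub>N\<^esub> b \<in> left_span N ?X ?D"
      if "b \<in> left_span N ?X ?D" "k \<in> {-1, 0, 1}" for b k
      using that S_closed[OF that(1)]
      by (auto simp: N.add.int_pow_neg intro: left_span.neg left_span.zero)
    have "nh_d n i \<otimes>\<^bsub>N\<^esub> (c \<otimes>\<^bsub>N\<^esub> a) = [(coef i j)] \<cdot>\<^bsub>N\<^esub> a \<oplus>\<^bsub>N\<^esub>
        [(eps i j)] \<cdot>\<^bsub>N\<^esub> (nh_x n (perm i j) \<otimes>\<^bsub>N\<^esub> (nh_d n i \<otimes>\<^bsub>N\<^esub> a))"
      using arg_cong[OF nh_d_x[OF mult.prems j(1)], of "\<lambda>b. b \<otimes>\<^bsub>N\<^esub> a"] a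
        nh_x_closed[OF j(1)] nh_x_closed[OF p] nh_d_closed[OF mult.prems] unfolding j(2)
      by (simp add: N.m_assoc N.l_distr N.add_pow_ldistr_int)
    moreover have "coef i j \<in> {-1, 0, 1}" "eps i j \<in> {-1, 0, 1}"
      by (auto simp: coef_def eps_def \<eta>_def)
    moreover have "nh_x n (perm i j) \<otimes>\<^bsub>N\<^esub> (nh_d n i \<otimes>\<^bsub>N\<^esub> a) \<in> left_span N ?X ?D"
      by (rule left_span.mult[OF imageI[OF p] mult.IH[OF mult.prems]])
    ultimately show ?case using int_mem mult(2) by (simp only: left_span.add)
  qed
  have id_weyl: "id \<in> weyl_D n" unfolding weyl_D_iff by (intro exI[of _ "[]"]) simp
  have "red id = []"
  proof -
    have "length (red id) \<le> length ([] :: nat list)"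
      using redw[OF id_weyl] by (intro reduced_le) auto
    then show ?thesis by simp
  qed
  then have one: "\<one>\<^bsub>N\<^esub> \<in> left_span N ?X ?D"
    using left_span.base[of "dw (red id)" ?D N ?X] id_weyl
    by (metis N.d_word_simps(1) d_word_eq image_eqI)
  from a have "a \<in> left_span N ?X ?D"
  proof (induction rule: N_induct)
    case (x i a)
    then show ?case by (intro left_span.mult) auto
  qed (auto intro: S_d one left_span.add left_span.neg)
  then show ?thesis
  proof (induction rule: left_span.induct)
    case (base b)
    then obtain w where w: "w \<in> weyl_D n" "b = dw (red w)" by blast
    define z where "z = restrict (\<lambda>_. 0 :: nat) {1..n}"
    have "x_word z is = \<one>\<^bsub>N\<^esub>" if "set is \<subseteq> {1..n}" for "is"
      using that by (induction "is") (auto simp: z_def)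
    moreover have "set [1..<Suc n] \<subseteq> {1..n}" by auto
    ultimately have "nh_monom n z = \<one>\<^bsub>N\<^esub>" unfolding nh_monom_x_word by blast
    then have "b = (case (w, z) of (w, r) \<Rightarrow> nh_monom n r \<otimes>\<^bsub>N\<^esub> dw (red w))"
      using w dw_closed by simp
    moreover have "(w, z) \<in> basis_index n" using w by (simp add: basis_index_def z_def)
    ultimately show ?case by (intro left_span.base) blast
  next
    case (mult c a)
    then obtain j where j: "j \<in> {1..n}" "c = nh_x n j" by blast
    from mult(3) show ?case
    proof (induction rule: left_span.induct)
      case (base b)
      then obtain w r where wr: "w \<in> weyl_D n" "r \<in> {1..n} \<rightarrow>\<^sub>E UNIV" "b = nh_monom n r \<otimes>\<^bsub>N\<^esub> dw (red w)"
        by (auto simp: basis_index_def)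
      define t where "t = r(j := Suc (r j))"
      have t: "t \<in> {1..n} \<rightarrow>\<^sub>E UNIV" using wr(2) j(1) by (auto simp: t_def PiE_def extensional_def)
      have "eq_upto_sign N (c \<otimes>\<^bsub>N\<^esub> nh_monom n r) (nh_monom n t)"
        unfolding nh_monom_x_word t_def j(2) using j(1) by (intro x_times_x_word) auto
      then have "eq_upto_sign N ((c \<otimes>\<^bsub>N\<^esub> nh_monom n r) \<otimes>\<^bsub>N\<^esub> dw (red w)) (nh_monom n t \<otimes>\<^bsub>N\<^esub> dw (red w))"
        using dw_closed[OF wr(1)] nh_monom_closed by (intro N.eq_upto_sign_mult N.eq_upto_sign_refl)
      moreover have "nh_monom n t \<otimes>\<^bsub>N\<^esub> dw (red w) \<in> left_span N {} ?B"
        using wr(1) t by (intro left_span.base image_eqI[of _ _ "(w, t)"]) (auto simp: basis_index_def)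
      ultimately show ?case
        using N.left_span_sign dw_closed[OF wr(1)] nh_monom_closed nh_x_closed[OF j(1)] j(2) wr(3)
        by (simp add: N.m_assoc)
    next
      case zero
      then show ?case using nh_x_closed[OF j(1)] j(2) by (simp add: left_span.zero)
    next
      case (add a b)
      then show ?case
        using N.left_span_closed[OF empty_subsetI B_closed] nh_x_closed[OF j(1)] j(2)
        by (simp add: N.r_distr left_span.add)
    next
      case (neg a)
      then show ?case
        using N.left_span_closed[OF empty_subsetI B_closed] nh_x_closed[OF j(1)] j(2)
        by (simp add: N.r_minus left_span.neg)
    qed simp
  qed (auto intro: left_span.zero left_span.add left_span.neg)
qed

text \<open>Reading the relations backwards permutes them, up to an overall sign in the commutation of the
  last two generators and up to the order of the summands.\<close>

lemma reversal_exists: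
  obtains \<tau> where "\<tau> \<in> ring_hom N (opposite_ring N)"
    "\<And>i. i \<in> {1..n} \<Longrightarrow> \<tau> (nh_x n i) = nh_x n i" "\<And>i. i \<in> {1..n} \<Longrightarrow> \<tau> (nh_d n i) = nh_d n i"
proof -
  note rel = nh_relationsD[OF nh_relations_N]
  have minus: "a \<ominus>\<^bsub>opposite_ring N\<^esub> b = a \<ominus>\<^bsub>N\<^esub> b" for a b
    by (simp add: a_minus_def opposite_ring_simps)
  have xd: "nh_x n k \<in> carrier N" "nh_d n k \<in> carrier N" if "1 \<le> k" "k \<le> n" for k
    using that by (simp_all add: nh_x_closed nh_d_closed)
  have n1: "1 \<le> n - 1" "n - 1 \<le> n" "1 \<le> n" "n \<le> n" using n_ge_2 by auto
  note closed = xd[OF n1(1,2)] xd[OF n1(3,4)]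
  have comm: "nh_d n (n - 1) \<otimes>\<^bsub>N\<^esub> nh_d n n \<ominus>\<^bsub>N\<^esub> nh_d n n \<otimes>\<^bsub>N\<^esub> nh_d n (n - 1) = \<zero>\<^bsub>N\<^esub>"
  proof -
    have "nh_d n (n - 1) \<otimes>\<^bsub>N\<^esub> nh_d n n \<ominus>\<^bsub>N\<^esub> nh_d n n \<otimes>\<^bsub>N\<^esub> nh_d n (n - 1) =
        \<ominus>\<^bsub>N\<^esub> (nh_d n n \<otimes>\<^bsub>N\<^esub> nh_d n (n - 1) \<ominus>\<^bsub>N\<^esub> nh_d n (n - 1) \<otimes>\<^bsub>N\<^esub> nh_d n n)"
      using closed by (simp add: a_minus_def N.minus_add N.a_comm)
    then show ?thesis by (simp add: rel(11))
  qed
  have "nh_relations n (opposite_ring N) (nh_x n) (nh_d n)"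
    unfolding nh_relations_def opposite_ring_simps minus
  proof (intro conjI allI impI; (elim conjE)?)
    fix i j assume ij: "i \<in> {1..n}" "j \<in> {1..n}" "i \<noteq> j"
    show "nh_x n j \<otimes>\<^bsub>N\<^esub> nh_x n i \<oplus>\<^bsub>N\<^esub> nh_x n i \<otimes>\<^bsub>N\<^esub> nh_x n j = \<zero>\<^bsub>N\<^esub>"
      using ij by (intro rel(1)) auto
  next
    fix i assume i: "1 \<le> i" "i < n"
    then show "nh_d n i \<otimes>\<^bsub>N\<^esub> nh_d n i = \<zero>\<^bsub>N\<^esub>" by (rule rel(2))
    show "nh_d n i \<otimes>\<^bsub>N\<^esub> nh_x n i \<oplus>\<^bsub>N\<^esub> nh_x n (i + 1) \<otimes>\<^bsub>N\<^esub> nh_d n i = \<one>\<^bsub>N\<^esub>" using i by (rule rel(6))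
    show "nh_x n i \<otimes>\<^bsub>N\<^esub> nh_d n i \<oplus>\<^bsub>N\<^esub> nh_d n i \<otimes>\<^bsub>N\<^esub> nh_x n (i + 1) = \<one>\<^bsub>N\<^esub>" using i by (rule rel(5))
  next
    fix i assume i: "1 \<le> i" "i + 1 < n"
    then show "nh_d n i \<otimes>\<^bsub>N\<^esub> (nh_d n (i + 1) \<otimes>\<^bsub>N\<^esub> nh_d n i) = nh_d n (i + 1) \<otimes>\<^bsub>N\<^esub> (nh_d n i \<otimes>\<^bsub>N\<^esub> nh_d n (i + 1))"
      using rel(3)[OF i] xd[of i] xd[of "i + 1"] by (simp add: N.m_assoc)
  next
    fix i j assume "1 \<le> i" "i < n" "1 \<le> j" "j < n" "\<bar>int i - int j\<bar> > 1"
    then show "nh_d n j \<otimes>\<^bsub>N\<^esub> nh_d n i \<oplus>\<^bsub>N\<^esub> nh_d n i \<otimes>\<^bsub>N\<^esub> nh_d n j = \<zero>\<^bsub>N\<^esub>"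
      by (intro rel(4)) auto
  next
    fix i j assume ij: "1 \<le> i" "i < n" "j \<in> {1..n}" "j \<noteq> i" "j \<noteq> i + 1"
    then show "nh_x n j \<otimes>\<^bsub>N\<^esub> nh_d n i \<oplus>\<^bsub>N\<^esub> nh_d n i \<otimes>\<^bsub>N\<^esub> nh_x n j = \<zero>\<^bsub>N\<^esub>"
      using rel(7)[OF ij] xd[of i] xd[of j] by (simp add: N.a_comm)
  next
    show "nh_d n n \<otimes>\<^bsub>N\<^esub> nh_d n n = \<zero>\<^bsub>N\<^esub>" by (rule rel(8))
  next
    assume n3: "3 \<le> n"
    then have "nh_d n (n - 2) \<in> carrier N" by (intro xd) auto
    then show "nh_d n n \<otimes>\<^bsub>N\<^esub> (nh_d n (n - 2) \<otimes>\<^bsub>N\<^esub> nh_d n n) = nh_d n (n - 2) \<otimes>\<^bsub>N\<^esub> (nh_d n n \<otimes>\<^bsub>N\<^esub> nh_d n (n - 2))"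
      using rel(9)[OF n3] closed by (simp add: N.m_assoc)
  next
    fix i assume i: "1 \<le> i" "i + 3 \<le> n"
    then show "nh_d n i \<otimes>\<^bsub>N\<^esub> nh_d n n \<oplus>\<^bsub>N\<^esub> nh_d n n \<otimes>\<^bsub>N\<^esub> nh_d n i = \<zero>\<^bsub>N\<^esub>"
      using rel(10)[OF i] xd[of i] closed by (simp add: N.a_comm)
  next
    show "nh_d n (n - 1) \<otimes>\<^bsub>N\<^esub> nh_d n n \<ominus>\<^bsub>N\<^esub> nh_d n n \<otimes>\<^bsub>N\<^esub> nh_d n (n - 1) = \<zero>\<^bsub>N\<^esub>" by (rule comm)
    show "nh_d n n \<otimes>\<^bsub>N\<^esub> nh_x n (n - 1) \<ominus>\<^bsub>N\<^esub> nh_x n n \<otimes>\<^bsub>N\<^esub> nh_d n n = \<one>\<^bsub>N\<^esub>" by (rule rel(13))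
    show "nh_x n (n - 1) \<otimes>\<^bsub>N\<^esub> nh_d n n \<ominus>\<^bsub>N\<^esub> nh_d n n \<otimes>\<^bsub>N\<^esub> nh_x n n = \<one>\<^bsub>N\<^esub>" by (rule rel(12))
  next
    fix i assume i: "1 \<le> i" "i + 2 \<le> n"
    then show "nh_x n i \<otimes>\<^bsub>N\<^esub> nh_d n n \<oplus>\<^bsub>N\<^esub> nh_d n n \<otimes>\<^bsub>N\<^esub> nh_x n i = \<zero>\<^bsub>N\<^esub>"
      using rel(14)[OF i] xd[of i] closed by (simp add: N.a_comm)
  qed
  from N_hom_exists[OF N.opposite_ring_ring _ _ this]
  have "\<exists>\<tau>. \<tau> \<in> ring_hom N (opposite_ring N) \<inter> extensional (carrier N) \<and>
    (\<forall>i\<in>{1..n}. \<tau> (nh_x n i) = nh_x n i) \<and> (\<forall>i\<in>{1..n}. \<tau> (nh_d n i) = nh_d n i)"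
    using nh_x_closed nh_d_closed by (simp add: opposite_ring_simps Pi_iff)
  then show ?thesis using that by blast
qed

text \<open>The second family is carried to the first by the reversal, \<open>(w, r)\<close> going to the inverse of \<open>w\<close>
  and \<open>r\<close>, up to signs. Both spanning and the triangular functionals are transported along it.\<close>

theorem monomial_bases:
  assumes red: "\<And>w. w \<in> weyl_D n \<Longrightarrow> reduced_expr n w (red w)"
  shows "z_independent E (basis_index n) (\<lambda>(w, r). h (nh_monom n r \<otimes>\<^bsub>N\<^esub> dw (red w))) \<and>
    z_independent E (basis_index n) (\<lambda>(w, r). h (dw (red w) \<otimes>\<^bsub>N\<^esub> nh_monom n r)) \<and>
    z_basis N (basis_index n) (\<lambda>(w, r). nh_monom n r \<otimes>\<^bsub>N\<^esub> dw (red w)) \<and>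
    z_basis N (basis_index n) (\<lambda>(w, r). dw (red w) \<otimes>\<^bsub>N\<^esub> nh_monom n r)"
proof -
  let ?I = "basis_index n"
  define left where "left = (\<lambda>(w, r). nh_monom n r \<otimes>\<^bsub>N\<^esub> dw (red w))"
  define right where "right = (\<lambda>(w, r). dw (red w) \<otimes>\<^bsub>N\<^esub> nh_monom n r)"
  define len :: "(int \<Rightarrow> int) \<times> (nat \<Rightarrow> nat) \<Rightarrow> nat" where "len = (\<lambda>(w, r). length (red w))"
  define flip :: "(int \<Rightarrow> int) \<times> (nat \<Rightarrow> nat) \<Rightarrow> (int \<Rightarrow> int) \<times> (nat \<Rightarrow> nat)"
    where "flip = (\<lambda>(w, r). (inv_into UNIV w, r))"
  have redw: "reduced (red w)" "wp (red w) = w" if "w \<in> weyl_D n" for w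
    using red[OF that] by (auto simp: reduced_expr_iff)
  have dw_closed: "dw is \<in> carrier N" if "set is \<subseteq> {1..n}" for "is"
    using N.d_word_closed[OF that] by (simp add: d_word_eq)
  note red_closed = dw_closed[OF reduced_letters[OF redw(1)]]
  have left_closed: "left i \<in> carrier N" and right_closed: "right i \<in> carrier N" if "i \<in> ?I" for i
    using that red_closed nh_monom_closed by (auto simp: left_def right_def basis_index_def)
  obtain L where L_add: "\<And>i T T'. i \<in> ?I \<Longrightarrow> T \<in> carrier E \<Longrightarrow> T' \<in> carrier E \<Longrightarrow> L i (T \<oplus>\<^bsub>E\<^esub> T') = (L i T + L i T' :: int)"
    and L_diag: "\<And>w r. (w, r) \<in> ?I \<Longrightarrow> L (w, r) (h (nh_monom n r \<otimes>\<^bsub>N\<^esub> dw (red w))) \<noteq> 0"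
    and L_off: "\<And>w r v t. (w, r) \<in> ?I \<Longrightarrow> (v, t) \<in> ?I \<Longrightarrow> (v, t) \<noteq> (w, r) \<Longrightarrow>
      length (red w) \<le> length (red v) \<Longrightarrow> L (w, r) (h (nh_monom n t \<otimes>\<^bsub>N\<^esub> dw (red v))) = 0"
    using act_functionals[OF red] by blast
  have diag: "L i (h (left i)) \<noteq> 0" if "i \<in> ?I" for i
    using that L_diag by (cases i) (simp add: left_def)
  have off: "L i (h (left j)) = 0" if "i \<in> ?I" "j \<in> ?I" "j \<noteq> i" "len i \<le> len j" for i j
    using that L_off by (cases i; cases j) (simp add: left_def len_def)
  have ind_E: "z_independent E ?I (\<lambda>i. h (left i))"
    by (rule E.independent_by_functionals[of _ _ L len]) (use left_closed L_add diag off in auto)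
  have Lh_add: "L i (h (a \<oplus>\<^bsub>N\<^esub> b)) = L i (h a) + L i (h b)" if "i \<in> ?I" "a \<in> carrier N" "b \<in> carrier N" for i a b
    using that L_add by simp
  have ind_N: "z_independent N ?I left"
    by (rule N.independent_by_functionals[of _ _ "\<lambda>i a. L i (h a)" len])
       (use left_closed Lh_add diag off in auto)
  have basis_left: "z_basis N ?I left"
    using monom_spanning[OF red] by (intro N.basisI ind_N) (simp add: left_def)
  obtain \<tau> where \<tau>: "\<tau> \<in> ring_hom N (opposite_ring N)"
    and \<tau>_x: "\<And>i. i \<in> {1..n} \<Longrightarrow> \<tau> (nh_x n i) = nh_x n i"
    and \<tau>_d: "\<And>i. i \<in> {1..n} \<Longrightarrow> \<tau> (nh_d n i) = nh_d n i"
    using reversal_exists by blast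
  interpret \<tau>: ring_hom_ring N "opposite_ring N" \<tau>
    by (rule ring_hom_ringI2[OF N.ring_axioms N.opposite_ring_ring \<tau>])
  have \<tau>_closed: "\<tau> a \<in> carrier N" if "a \<in> carrier N" for a
    using \<tau>.hom_closed[OF that] by (simp add: opposite_ring_simps)
  have \<tau>_mult: "\<tau> (a \<otimes>\<^bsub>N\<^esub> b) = \<tau> b \<otimes>\<^bsub>N\<^esub> \<tau> a" if "a \<in> carrier N" "b \<in> carrier N" for a b
    using \<tau>.hom_mult[OF that] by (simp add: opposite_ring_simps)
  have \<tau>_add: "\<tau> (a \<oplus>\<^bsub>N\<^esub> b) = \<tau> a \<oplus>\<^bsub>N\<^esub> \<tau> b" if "a \<in> carrier N" "b \<in> carrier N" for a b
    using \<tau>.hom_add[OF that] by (simp add: opposite_ring_simps)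
  have \<tau>_one: "\<tau> \<one>\<^bsub>N\<^esub> = \<one>\<^bsub>N\<^esub>" using \<tau>.hom_one by (simp add: opposite_ring_simps)
  have \<tau>_zero: "\<tau> \<zero>\<^bsub>N\<^esub> = \<zero>\<^bsub>N\<^esub>" using \<tau>.hom_zero by (simp add: opposite_ring_simps)
  have \<tau>_neg: "\<tau> (\<ominus>\<^bsub>N\<^esub> a) = \<ominus>\<^bsub>N\<^esub> \<tau> a" if "a \<in> carrier N" for a
    using \<tau>.hom_a_inv[OF that] by (simp add: opposite_ring_simps)
  note [simp del] = \<tau>.hom_one \<tau>.hom_add \<tau>.hom_mult \<tau>.hom_a_inv \<tau>.hom_zero
  have involution: "\<tau> (\<tau> a) = a" if "a \<in> carrier N" for a
    using that
  proof (induction rule: N_induct)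
    case (x i a)
    note c = nh_x_closed[OF x(1)] x(2) \<tau>_closed[OF x(2)]
    show ?case by (simp only: \<tau>_mult[OF c(1,2)] \<tau>_x[OF x(1)] \<tau>_mult[OF c(3,1)] x(3))
  next
    case (d i a)
    note c = nh_d_closed[OF d(1)] d(2) \<tau>_closed[OF d(2)]
    show ?case by (simp only: \<tau>_mult[OF c(1,2)] \<tau>_d[OF d(1)] \<tau>_mult[OF c(3,1)] d(3))
  qed (simp_all add: \<tau>_one \<tau>_add \<tau>_neg \<tau>_closed opposite_ring_simps)
  have \<tau>_word: "\<tau> (dw is) = dw (rev is)" if "set is \<subseteq> {1..n}" for "is"
    using that
  proof (induction "is")
    case Nil
    then show ?case by (simp add: d_word_eq[symmetric] \<tau>_one)
  next
    case (Cons i "is")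
    then have i: "i \<in> {1..n}" "set is \<subseteq> {1..n}" by auto
    have "\<tau> (dw (i # is)) = dw (rev is) \<otimes>\<^bsub>N\<^esub> nh_d n i"
      using \<tau>_mult[OF nh_d_closed[OF i(1)] dw_closed[OF i(2)]] Cons.IH[OF i(2)] \<tau>_d[OF i(1)]
      by (simp add: d_word_eq[symmetric])
    also have "\<dots> = dw (rev (i # is))"
      using N.d_word_append[of "rev is" "[i]"] i nh_d_closed[OF i(1)] by (simp add: d_word_eq[symmetric])
    finally show ?case .
  qed
  have \<tau>_x_power: "\<tau> (nh_x n i [^]\<^bsub>N\<^esub> k) = nh_x n i [^]\<^bsub>N\<^esub> k" if "i \<in> {1..n}" for i and k :: nat
  proof (induction k)
    case (Suc k)
    then show ?case
      unfolding N.nat_pow_Suc2[OF nh_x_closed[OF that]] using that nh_x_closed[OF that] \<tau>_x[OF that]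
      by (simp add: \<tau>_mult N.nat_pow_Suc2[symmetric] del: N.nat_pow_Suc)
  qed (simp add: \<tau>_one)
  have \<tau>_x_word: "eq_upto_sign N (\<tau> (x_word r is)) (x_word r is)"
    if "set is \<subseteq> {1..n}" "distinct is" for r "is"
    using that
  proof (induction "is")
    case Nil
    then show ?case by (simp add: \<tau>_one N.eq_upto_sign_refl)
  next
    case (Cons i "is")
    let ?p = "nh_x n i [^]\<^bsub>N\<^esub> r i"
    have i: "i \<in> {1..n}" "set is \<subseteq> {1..n}" "i \<notin> set is" "distinct is" using Cons.prems by auto
    have c: "?p \<in> carrier N" "x_word r is \<in> carrier N" using i nh_x_closed by simp_all
    have power: "eq_upto_sign N (x_word r is \<otimes>\<^bsub>N\<^esub> (nh_x n i [^]\<^bsub>N\<^esub> k)) ((nh_x n i [^]\<^bsub>N\<^esub> k) \<otimes>\<^bsub>N\<^esub> x_word r is)" for k :: nat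
    proof (induction k)
      case 0
      then show ?case using c by (simp add: N.eq_upto_sign_refl)
    next
      case (Suc k)
      let ?q = "nh_x n i [^]\<^bsub>N\<^esub> k" and ?a = "nh_x n i" and ?w = "x_word r is"
      have c': "?q \<in> carrier N" "?a \<in> carrier N" "?w \<in> carrier N" using i nh_x_closed by simp_all
      have "eq_upto_sign N ((?w \<otimes>\<^bsub>N\<^esub> ?q) \<otimes>\<^bsub>N\<^esub> ?a) ((?q \<otimes>\<^bsub>N\<^esub> ?w) \<otimes>\<^bsub>N\<^esub> ?a)"
        using c' by (intro N.eq_upto_sign_mult Suc N.eq_upto_sign_refl) auto
      moreover have "eq_upto_sign N (?q \<otimes>\<^bsub>N\<^esub> (?w \<otimes>\<^bsub>N\<^esub> ?a)) (?q \<otimes>\<^bsub>N\<^esub> (?a \<otimes>\<^bsub>N\<^esub> ?w))"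
        using c' i by (intro N.eq_upto_sign_mult x_word_commute N.eq_upto_sign_refl) auto
      ultimately show ?case
        using c' N.eq_upto_sign_trans[of "?q \<otimes>\<^bsub>N\<^esub> (?a \<otimes>\<^bsub>N\<^esub> ?w)"] by (simp add: N.m_assoc)
    qed
    have "eq_upto_sign N (\<tau> (x_word r is) \<otimes>\<^bsub>N\<^esub> ?p) (x_word r is \<otimes>\<^bsub>N\<^esub> ?p)"
      using c i by (intro N.eq_upto_sign_mult Cons.IH N.eq_upto_sign_refl) auto
    then show ?case
      using N.eq_upto_sign_trans[OF _ _ power] c by (simp add: \<tau>_mult \<tau>_x_power[OF i(1)])
  qed
  have \<tau>_monom: "eq_upto_sign N (\<tau> (nh_monom n r)) (nh_monom n r)" for r
    unfolding nh_monom_x_word by (rule \<tau>_x_word) auto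
  have inverse: "inv_into UNIV w \<in> weyl_D n" "eq_upto_sign N (\<tau> (dw (red w))) (dw (red (inv_into UNIV w)))"
    "inv_into UNIV (inv_into UNIV w) = w"
    if "w \<in> weyl_D n" for w
  proof -
    have letters: "set (red w) \<subseteq> {1..n}" using reduced_letters[OF redw(1)[OF that]] .
    have inv: "inv_into UNIV w = wp (rev (red w))" using wp_inv[OF letters] redw(2)[OF that] by simp
    then show mem: "inv_into UNIV w \<in> weyl_D n"
      unfolding weyl_D_iff using letters by (intro exI[of _ "rev (red w)"]) simp
    show "inv_into UNIV (inv_into UNIV w) = w"
      using wp_bij[OF letters] redw(2)[OF that] by (simp add: inv_inv_eq)
    show "eq_upto_sign N (\<tau> (dw (red w))) (dw (red (inv_into UNIV w)))"
      using N.matsumoto[OF reduced_rev[OF redw(1)[OF that]] redw(1)[OF mem]] redw(2)[OF mem] inv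
      by (simp add: \<tau>_word[OF letters] d_word_eq)
  qed
  have flip_mem: "flip i \<in> ?I" and flip_flip: "flip (flip i) = i" if "i \<in> ?I" for i
    using that inverse by (auto simp: flip_def basis_index_def)
  have flip_right: "eq_upto_sign N (\<tau> (right i)) (left (flip i))"
    and flip_left: "eq_upto_sign N (\<tau> (left i)) (right (flip i))" if "i \<in> ?I" for i
  proof -
    obtain w r where i: "i = (w, r)" and w: "w \<in> weyl_D n" using \<open>i \<in> ?I\<close> by (cases i) (auto simp: basis_index_def)
    note c = red_closed[OF w] nh_monom_closed[of r] red_closed[OF inverse(1)[OF w]]
    show "eq_upto_sign N (\<tau> (right i)) (left (flip i))"
      using N.eq_upto_sign_mult[OF _ _ \<tau>_monom inverse(2)[OF w]] c
      by (simp add: i right_def left_def flip_def \<tau>_mult)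
    show "eq_upto_sign N (\<tau> (left i)) (right (flip i))"
      using N.eq_upto_sign_mult[OF _ _ inverse(2)[OF w] \<tau>_monom] c
      by (simp add: i right_def left_def flip_def \<tau>_mult)
  qed
  have L_sign: "L i (h a) = L i (h b) \<or> L i (h a) = - L i (h b)"
    if "i \<in> ?I" "eq_upto_sign N a b" "b \<in> carrier N" for i a b
  proof -
    have zero: "L i (h \<zero>\<^bsub>N\<^esub>) = 0" using N.additive_zero[of "\<lambda>a. L i (h a)"] Lh_add[OF that(1)] by blast
    have "L i (h (\<ominus>\<^bsub>N\<^esub> b)) + L i (h b) = 0"
      using Lh_add[OF that(1) N.a_inv_closed[OF that(3)] that(3)] that(3) zero by (simp only: N.l_neg)
    then show ?thesis using that(2) unfolding eq_upto_sign_def by auto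
  qed
  have ind_right: "z_independent N ?I right"
  proof (rule N.independent_by_functionals[of _ _ "\<lambda>i a. L (flip i) (h (\<tau> a))" "\<lambda>i. len (flip i)"])
    show "right \<in> ?I \<rightarrow> carrier N" using right_closed by blast
    show "L (flip i) (h (\<tau> (a \<oplus>\<^bsub>N\<^esub> a'))) = L (flip i) (h (\<tau> a)) + L (flip i) (h (\<tau> a'))"
      if "i \<in> ?I" "a \<in> carrier N" "a' \<in> carrier N" for i a a'
      using Lh_add[OF flip_mem[OF that(1)] \<tau>_closed[OF that(2)] \<tau>_closed[OF that(3)]] \<tau>_add[OF that(2,3)]
      by (simp only:)
    show "L (flip i) (h (\<tau> (right i))) \<noteq> 0" if "i \<in> ?I" for i
      using L_sign[OF flip_mem[OF that] flip_right[OF that] left_closed[OF flip_mem[OF that]]]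
        diag[OF flip_mem[OF that]] by auto
    show "L (flip i) (h (\<tau> (right j))) = 0"
      if "i \<in> ?I" "j \<in> ?I" "j \<noteq> i" "len (flip i) \<le> len (flip j)" for i j
    proof -
      have "flip j \<noteq> flip i" using flip_flip that(1-3) by metis
      then show ?thesis
        using L_sign[OF flip_mem[OF that(1)] flip_right[OF that(2)] left_closed[OF flip_mem[OF that(2)]]]
          off[OF flip_mem[OF that(1)] flip_mem[OF that(2)] _ that(4)] by auto
    qed
  qed
  have span_right: "a \<in> left_span N {} (right ` ?I)" if "a \<in> carrier N" for a
  proof -
    have "left ` ?I \<subseteq> carrier N" using left_closed by blast
    note closed = N.left_span_closed[OF empty_subsetI this]
    have "\<tau> a \<in> left_span N {} (left ` ?I)"
      using monom_spanning[OF red \<tau>_closed[OF that]] by (simp add: left_def)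
    then have "\<tau> (\<tau> a) \<in> left_span N {} (right ` ?I)"
    proof (induction rule: left_span.induct)
      case (base b)
      then obtain i where i: "i \<in> ?I" "b = left i" by blast
      have "right (flip i) \<in> left_span N {} (right ` ?I)"
        using flip_mem[OF i(1)] by (intro left_span.base) blast
      then show ?case using N.left_span_sign[OF flip_left[OF i(1)]] i(2) by simp
    next
      case zero
      then show ?case by (simp only: \<tau>_zero left_span.zero)
    next
      case (add a b)
      then show ?case by (simp only: \<tau>_add[OF closed closed] left_span.add)
    next
      case (neg a)
      then show ?case by (simp only: \<tau>_neg[OF closed] left_span.neg)
    qed simp
    then show ?thesis by (simp only: involution[OF that])
  qed
  have basis_right: "z_basis N ?I right" by (rule N.basisI[OF ind_right span_right])
  have "z_independent E ?I (\<lambda>i. h (right i))"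
    by (rule h.injective_independent[OF h.basis_imp_injective[OF basis_left ind_E] ind_right])
  moreover have "(\<lambda>(w, r). h (nh_monom n r \<otimes>\<^bsub>N\<^esub> dw (red w))) = (\<lambda>i. h (left i))"
    "(\<lambda>(w, r). h (dw (red w) \<otimes>\<^bsub>N\<^esub> nh_monom n r)) = (\<lambda>i. h (right i))"
    by (auto simp: left_def right_def)
  ultimately show ?thesis
    using ind_E basis_left basis_right by (simp only: left_def[symmetric] right_def[symmetric])
qed

end

theorem proposition4p9:
  fixes n :: nat and red :: "(int \<Rightarrow> int) \<Rightarrow> nat list"
  assumes "n \<ge> 2"
    and "\<And>w. w \<in> weyl_D n \<Longrightarrow> reduced_expr n w (red w)"
  shows "z_independent (end_ring (Pol n)) (basis_index n)
           (\<lambda>(w, r). nh_act n (nh_monom n r \<otimes>\<^bsub>NH n\<^esub> nh_d_word n (red w))) \<and>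
         z_independent (end_ring (Pol n)) (basis_index n)
           (\<lambda>(w, r). nh_act n (nh_d_word n (red w) \<otimes>\<^bsub>NH n\<^esub> nh_monom n r)) \<and>
         z_basis (NH n) (basis_index n)
           (\<lambda>(w, r). nh_monom n r \<otimes>\<^bsub>NH n\<^esub> nh_d_word n (red w)) \<and>
         z_basis (NH n) (basis_index n)
           (\<lambda>(w, r). nh_d_word n (red w) \<otimes>\<^bsub>NH n\<^esub> nh_monom n r)"
proof -
  interpret P: ring "Pol n" by (rule Pol_ring)
  interpret N: ring "NH n" by (rule NH_ring[OF assms(1)])
  interpret nil_hecke n "Pol n" "NH n" by unfold_locales (simp_all add: assms(1))
  show ?thesis by (rule monomial_bases[OF assms(2)])
qed

end
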